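(* For any integer $n\ge1$ and any partition $\lambda$ with at most $n$ parts, $$K_{\lambda,0}^{C_{n+1}}(t)-K_{\lambda,0}^{C_n}(t)\in\mathbb Z_{\ge0}[t].$$
   Context: For $m\ge1$ and the Lie algebra $\mathfrak{sp}_{2m}$ (type $C_m$) with positive roots $R_+$, Weyl group $W$, length function $\ell$, half-sum $\rho$ of positive roots, let $\prod_{\alpha\in R_+}\frac1{1-te^\alpha}=\sum_\beta P_t(\beta)e^\beta$. For a partition $\lambda$ with at most $m$ parts, viewed as the dominant weight $\sum_i\lambda_i\varepsilon_i$, the generalized exponent is $K^{C_m}_{\lambda,0}(t)=\sum_{w\in W}(-1)^{\ell(w)}P_t(w(\lambda+\rho)-\rho)$. *)

theory Defs
  imports
    Complex_Main
    "HOL-Library.Function_Algebras"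
    "HOL-Computational_Algebra.Polynomial"
begin

text \<open>
  A weight is given by its coordinates in the basis of the epsilons, indexed from 0. The weights of
  \<open>C\<^sub>m\<close> are those supported on \<open>{..<m}\<close>; using one type for all \<open>m\<close> lets
  the same partition be a weight of both \<open>C\<^sub>n\<close> and \<open>C\<^sub>n\<^sub>+\<^sub>1\<close>.
\<close>

type_synonym weight = "nat \<Rightarrow> real"

definition eps :: "nat \<Rightarrow> weight" where
  "eps i = (\<lambda>k. if k = i then 1 else 0)"

definition pos_roots :: "nat \<Rightarrow> weight set" where
  "pos_roots m = {eps i - eps j | i j. i < j \<and> j < m}
               \<union> {eps i + eps j | i j. i < j \<and> j < m}
               \<union> {eps i + eps i | i. i < m}"

definition simple_roots :: "nat \<Rightarrow> weight set" where
  "simple_roots m = {eps i - eps (Suc i) | i. Suc i < m} \<union> {eps i + eps i | i. Suc i = m}"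

definition half_sum :: "nat \<Rightarrow> weight" where
  "half_sum m = (\<lambda>k. (\<Sum>\<alpha>\<in>pos_roots m. \<alpha> k) / 2)"

definition inner_prod :: "nat \<Rightarrow> weight \<Rightarrow> weight \<Rightarrow> real" where
  "inner_prod m v u = (\<Sum>i<m. v i * u i)"

definition reflection :: "nat \<Rightarrow> weight \<Rightarrow> weight \<Rightarrow> weight" where
  "reflection m \<alpha> v = (\<lambda>k. v k - 2 * inner_prod m v \<alpha> / inner_prod m \<alpha> \<alpha> * \<alpha> k)"

text \<open>
  Reflections are involutions, so the monoid they generate is the group they generate. Its elements
  fix all coordinates outside \<open>{..<m}\<close>, so it acts faithfully on the weights of
  \<open>C\<^sub>m\<close>.
\<close>

inductive_set weyl_group :: "nat \<Rightarrow> (weight \<Rightarrow> weight) set" for m where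
  one: "id \<in> weyl_group m"
| mult: "\<alpha> \<in> pos_roots m \<Longrightarrow> w \<in> weyl_group m \<Longrightarrow> reflection m \<alpha> \<circ> w \<in> weyl_group m"

definition weyl_length :: "nat \<Rightarrow> (weight \<Rightarrow> weight) \<Rightarrow> nat" where
  "weyl_length m w =
     (LEAST k. \<exists>\<alpha>s. length \<alpha>s = k \<and> set \<alpha>s \<subseteq> simple_roots m \<and>
                    w = foldr (\<lambda>\<alpha> u. reflection m \<alpha> \<circ> u) \<alpha>s id)"

text \<open>
  Expanding each factor \<open>1 / (1 - t e\<^sup>\<alpha>)\<close> as a geometric series, the coefficient of
  \<open>e\<^sup>\<beta>\<close> in the product is the sum, over all ways to write \<open>\<beta>\<close> as
  \<open>\<Sum>\<alpha>. c \<alpha> \<cdot> \<alpha>\<close> with natural numbers \<open>c \<alpha>\<close>, of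
  \<open>t\<close> to the power \<open>\<Sum>\<alpha>. c \<alpha>\<close>.
\<close>

definition root_decompositions :: "nat \<Rightarrow> weight \<Rightarrow> (weight \<Rightarrow> nat) set" where
  "root_decompositions m \<beta> =
     {c. (\<forall>\<alpha>. \<alpha> \<notin> pos_roots m \<longrightarrow> c \<alpha> = 0) \<and>
         (\<forall>k. (\<Sum>\<alpha>\<in>pos_roots m. of_nat (c \<alpha>) * \<alpha> k) = \<beta> k)}"

definition kostant_partition :: "nat \<Rightarrow> weight \<Rightarrow> int poly" where
  "kostant_partition m \<beta> =
     (\<Sum>c\<in>root_decompositions m \<beta>. monom 1 (\<Sum>\<alpha>\<in>pos_roots m. c \<alpha>))"

definition partition_at_most :: "nat \<Rightarrow> (nat \<Rightarrow> nat) \<Rightarrow> bool" where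
  "partition_at_most m lam \<longleftrightarrow> antimono lam \<and> (\<forall>i\<ge>m. lam i = 0)"

definition partition_weight :: "(nat \<Rightarrow> nat) \<Rightarrow> weight" where
  "partition_weight lam = (\<lambda>i. of_nat (lam i))"

definition gen_exponent_C :: "nat \<Rightarrow> (nat \<Rightarrow> nat) \<Rightarrow> int poly" where
  "gen_exponent_C m lam =
     (\<Sum>w\<in>weyl_group m.
        (-1) ^ weyl_length m w *
        kostant_partition m (w (partition_weight lam + half_sum m) - half_sum m))"

text \<open>
  Both index sets above are finite, so neither sum takes the default value 0 of an infinite sum.
\<close>

lemma pos_roots_cases:
  assumes "\<alpha> \<in> pos_roots m"
  obtains (minus) i j where "i < j" "j < m" "\<alpha> = eps i - eps j"
  | (plus) i j where "i < j" "j < m" "\<alpha> = eps i + eps j"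
  | (long) i where "i < m" "\<alpha> = eps i + eps i"
  using assms unfolding pos_roots_def by blast

lemma finite_pos_roots: "finite (pos_roots m)"
proof (rule finite_subset)
  let ?I = "{..<m} \<times> {..<m}"
  show "pos_roots m \<subseteq> (\<lambda>(i, j). eps i - eps j) ` ?I \<union> (\<lambda>(i, j). eps i + eps j) ` ?I"
  proof
    fix \<alpha> assume "\<alpha> \<in> pos_roots m"
    then show "\<alpha> \<in> (\<lambda>(i, j). eps i - eps j) ` ?I \<union> (\<lambda>(i, j). eps i + eps j) ` ?I"
      by (cases rule: pos_roots_cases) force+
  qed
qed auto

lemma sum_eps: "i < m \<Longrightarrow> (\<Sum>k<m. f k * eps i k) = f i"
  by (simp add: eps_def if_distrib sum.delta cong: if_cong)

lemma finite_root_decompositions: "finite (root_decompositions m \<beta>)"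
proof -
  define h :: "weight \<Rightarrow> real" where "h v = (\<Sum>k<m. (real m - real k) * v k)" for v
  have h_eps: "h (eps i) = real m - real i" if "i < m" for i
    using that by (simp add: h_def sum_eps)
  have h_add: "h (u + v) = h u + h v" and h_diff: "h (u - v) = h u - h v" for u v
    by (simp_all add: h_def algebra_simps sum.distrib sum_subtractf)
  have h_root: "h \<alpha> \<ge> 1" if "\<alpha> \<in> pos_roots m" for \<alpha>
    using that by (cases rule: pos_roots_cases) (simp_all only: h_add h_diff, auto simp: h_eps)
  have bound: "c \<alpha> \<le> nat \<lceil>h \<beta>\<rceil>" if c: "c \<in> root_decompositions m \<beta>" and \<alpha>: "\<alpha> \<in> pos_roots m" for c \<alpha>
  proof -
    have "h \<beta> = (\<Sum>k<m. (real m - real k) * (\<Sum>\<alpha>\<in>pos_roots m. of_nat (c \<alpha>) * \<alpha> k))"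
      using c by (simp add: h_def root_decompositions_def)
    also have "\<dots> = (\<Sum>\<alpha>\<in>pos_roots m. of_nat (c \<alpha>) * h \<alpha>)"
      unfolding h_def sum_distrib_left
      by (subst sum.swap) (simp add: ac_simps)
    finally have eq: "h \<beta> = (\<Sum>\<alpha>\<in>pos_roots m. of_nat (c \<alpha>) * h \<alpha>)" .
    have "real (c \<alpha>) \<le> real (c \<alpha>) * h \<alpha>"
      using h_root[OF \<alpha>] by (simp add: mult_le_cancel_left1)
    also have "\<dots> \<le> h \<beta>"
      unfolding eq
    proof (rule member_le_sum[OF \<alpha> _ finite_pos_roots])
      fix x assume "x \<in> pos_roots m - {\<alpha>}"
      then have "h x \<ge> 1" using h_root by blast
      then show "0 \<le> real (c x) * h x" by simp
    qed
    finally show ?thesis by linarith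
  qed
  have "root_decompositions m \<beta> \<subseteq>
      {c. \<forall>\<alpha>. (\<alpha> \<in> pos_roots m \<longrightarrow> c \<alpha> \<in> {..nat \<lceil>h \<beta>\<rceil>}) \<and> (\<alpha> \<notin> pos_roots m \<longrightarrow> c \<alpha> = 0)}"
    using bound by (auto simp: root_decompositions_def)
  then show ?thesis
    by (rule finite_subset) (intro finite_set_of_finite_funs finite_pos_roots finite_atMost)
qed

lemma inner_prod_eps:
  assumes "i < m"
  shows "inner_prod m v (eps i) = v i"
  using assms by (simp add: inner_prod_def sum_eps)

lemma inner_prod_add: "inner_prod m v (u + u') = inner_prod m v u + inner_prod m v u'"
  and inner_prod_diff: "inner_prod m v (u - u') = inner_prod m v u - inner_prod m v u'"
  by (simp_all add: inner_prod_def algebra_simps sum.distrib sum_subtractf)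

lemma finite_weyl_group: "finite (weyl_group m)"
proof -
  define S where "S = {s. \<forall>k. (k \<in> {..<m} \<longrightarrow> s k \<in> {-1, 1 :: real}) \<and> (k \<notin> {..<m} \<longrightarrow> s k = 1)}"
  define Q where "Q = {p. \<forall>k. (k \<in> {..<m} \<longrightarrow> p k \<in> {..<m}) \<and> (k \<notin> {..<m} \<longrightarrow> p k = (0::nat))}"
  define act where "act = (\<lambda>(s, p) (v::weight) k. if k < m then s k * v (p k) else v k :: real)"
  have fin: "finite (act ` (S \<times> Q))"
    unfolding S_def Q_def
    by (intro finite_imageI finite_cartesian_product finite_set_of_finite_funs finite_lessThan
        finite.intros)
  have step: "reflection m \<alpha> \<circ> w \<in> act ` (S \<times> Q)"
    if \<alpha>: "\<alpha> \<in> pos_roots m" and w: "w \<in> act ` (S \<times> Q)" for \<alpha> w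
  proof -
    from w obtain s p where s: "s \<in> S" and p: "p \<in> Q" and weq: "w = act (s, p)" by auto
    from \<alpha> show ?thesis
    proof (cases rule: pos_roots_cases)
      case (minus i j)
      have *: "inner_prod m v \<alpha> = v i - v j" for v
        using minus by (simp add: inner_prod_diff inner_prod_eps)
      have **: "\<alpha> k = (if k = i then 1 else if k = j then -1 else 0)" for k
        using minus by (simp add: eps_def)
      have reflect: "reflection m \<alpha> v k = v k - (v i - v j) * (if k = i then 1 else if k = j then -1 else 0)" for v k
        using minus(1) by (simp add: reflection_def * **)
      have "reflection m \<alpha> \<circ> w = act (s(i := s j, j := s i), p(i := p j, j := p i))"
        using minus(1,2) by (simp add: fun_eq_iff reflect weq act_def)
      moreover have "s(i := s j, j := s i) \<in> S" "p(i := p j, j := p i) \<in> Q"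
        using s p minus by (auto simp: S_def Q_def)
      ultimately show ?thesis by blast
    next
      case (plus i j)
      have *: "inner_prod m v \<alpha> = v i + v j" for v
        using plus by (simp add: inner_prod_add inner_prod_eps)
      have **: "\<alpha> k = (if k = i then 1 else if k = j then 1 else 0)" for k
        using plus by (simp add: eps_def)
      have reflect: "reflection m \<alpha> v k = v k - (v i + v j) * (if k = i then 1 else if k = j then 1 else 0)" for v k
        using plus(1) by (simp add: reflection_def * **)
      have "reflection m \<alpha> \<circ> w = act (s(i := - s j, j := - s i), p(i := p j, j := p i))"
        using plus(1,2) by (simp add: fun_eq_iff reflect weq act_def)
      moreover have "s(i := - s j, j := - s i) \<in> S" "p(i := p j, j := p i) \<in> Q"
        using s p plus by (auto simp: S_def Q_def)
      ultimately show ?thesis by blast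
    next
      case (long i)
      have *: "inner_prod m v \<alpha> = 2 * v i" for v
        using long(1) unfolding long(2) inner_prod_add by (simp add: inner_prod_eps)
      have **: "\<alpha> k = (if k = i then 2 else 0)" for k
        unfolding long(2) plus_fun_def by (simp add: eps_def)
      have reflect: "reflection m \<alpha> v k = v k - v i * (if k = i then 2 else 0)" for v k
        using long(1) by (simp add: reflection_def * **)
      have "reflection m \<alpha> \<circ> w = act (s(i := - s i), p)"
        using long(1) by (simp add: fun_eq_iff reflect weq act_def)
      moreover have "s(i := - s i) \<in> S"
        using s long by (auto simp: S_def)
      ultimately show ?thesis using p by blast
    qed
  qed
  have "w \<in> act ` (S \<times> Q)" if "w \<in> weyl_group m" for w
    using that
  proof induction
    case one
    have "id = act (\<lambda>_. 1, \<lambda>k. if k < m then k else 0)"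
      by (auto simp: act_def fun_eq_iff)
    moreover have "(\<lambda>_. 1) \<in> S" "(\<lambda>k. if k < m then k else 0) \<in> Q"
      by (auto simp: S_def Q_def)
    ultimately show ?case by blast
  next
    case (mult \<alpha> w)
    then show ?case using step by blast
  qed
  then show ?thesis using fin by (meson finite_subset subsetI)
qed

end

theory Submission
  imports Defs "Jordan_Normal_Form.Determinant" "HOL-Library.Poly_Mapping" "HOL-Computational_Algebra.Formal_Power_Series"
begin

text \<open>
  Write \<open>a\<^sub>v\<close> for the alternating sum of the Weyl group orbit of \<open>e\<^sup>v\<close>. Up to a factor that does
  not depend on \<open>\<lambda>\<close>, the generalized exponent is the constant term of
  \<open>a\<^sub>\<lambda>\<^sub>+\<^sub>\<rho> a\<^sub>\<rho>\<close> divided by the product of all \<open>1 - t e\<^sup>\<alpha>\<close>, \<open>\<alpha>\<close> a positive or negative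
  root. In the \<open>2n\<close> variables \<open>x\<^sub>i\<close> and their inverses, Littlewood's identity writes the inverse of that
  product, up to a power of \<open>1 - t\<close>, as the generating function of the Schur functions of the partitions
  \<open>\<nu>\<close> with even parts, and the dual Jacobi--Trudi identity expresses \<open>a\<^sub>\<lambda>\<^sub>+\<^sub>\<rho>\<close> as
  \<open>a\<^sub>\<rho>\<close> times a determinant of differences of elementary symmetric functions. By Pieri's rule the constant term becomes a signed count of chains of
  vertical strips that lead from a partition whose rows are equal in pairs down to \<open>\<nu>\<close>. A
  sign-reversing involution of Bender--Knuth type leaves the chains all of whose truncations satisfy
  lattice conditions. The unknown factor is read off from \<open>\<lambda> = 0\<close>: it is the product of the
  \<open>1 - t\<^sup>2\<^sup>i\<close>, and multiplication by \<open>1 - t\<^sup>2\<^sup>i\<close> discards the chains in which 2 can be subtracted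
  from the first \<open>2i\<close> rows of every member. So the generalized exponent is the generating function of
  the minimal chains, and a minimal chain for \<open>n\<close>, padded with two zero rows, is one for \<open>n + 1\<close>.
\<close>

section \<open>Determinants and the Weyl denominator\<close>

text \<open>The alternants of rank \<open>n\<close> meet the Schur functions in \<open>2n\<close>
  variables through a factorization: \<open>a_\<rho>\<close> squared is, up to sign, the Vandermonde
  determinant of the \<open>2n\<close> variables times the product of the
  \<open>x_i - 1/x_i\<close>. The Vandermonde factor turns the Schur functions of Littlewood's
  identity into alternants, so that Pieri's rule is a statement on determinants and nothing is
  divided; the other product kills the constant term of an alternant unless its rows are equal in
  pairs. The numbers \<open>\<lambda>_j + n - 1 - j\<close> and those they miss form one
  permutation, and the missed ones, given by the conjugate partition, label the rows of the
  Jacobi--Trudi determinant. Hence the strip sizes of a surviving chain are the columns of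
  \<open>\<lambda>\<close> for every \<open>n\<close>, which makes different \<open>n\<close>
  comparable. Antisymmetrizing in two weights costs a factor \<open>|W|\<close>, and the constant
  terms bring in a further integer. Both occur for \<open>\<lambda> = 0\<close> as well, so it
  suffices to know \<open>|W| \<noteq> 0\<close>. A sign \<open>(-1)^|\<lambda>|\<close> remains,
  but by parity no chain survives when \<open>|\<lambda>|\<close> is odd.\<close>

definition dt :: "nat \<Rightarrow> (nat \<Rightarrow> nat \<Rightarrow> 'a::comm_ring_1) \<Rightarrow> 'a" where
  "dt n f = det (mat n n (\<lambda>(i, j). f i j))"

definition skip :: "nat \<Rightarrow> nat \<Rightarrow> nat" where
  "skip k i = (if i < k then i else Suc i)"

lemma dt_cong:
  assumes "\<And>i j. i < n \<Longrightarrow> j < n \<Longrightarrow> f i j = g i j"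
  shows "dt n f = dt n g"
  unfolding dt_def by (rule arg_cong[where f = det]) (auto simp: assms)

lemma dt_leibniz:
  "dt n f = (\<Sum>p | p permutes {..<n}. of_int (sign p) * (\<Prod>i<n. f i (p i)))"
proof -
  have "det (mat n n (\<lambda>(i, j). f i j)) =
      (\<Sum>p | p permutes {0..<n}. signof p * (\<Prod>i = 0..<n. mat n n (\<lambda>(i, j). f i j) $$ (i, p i)))"
    by (rule det_def') simp
  also have "\<dots> = (\<Sum>p | p permutes {0..<n}. of_int (sign p) * (\<Prod>i = 0..<n. f i (p i)))"
  proof (rule sum.cong[OF refl])
    fix p assume "p \<in> {p. p permutes {0..<n}}"
    then have "p i < n" if "i < n" for i
      using that permutes_in_image[of p "{0..<n}" i] by simp
    then show "signof p * (\<Prod>i = 0..<n. mat n n (\<lambda>(i, j). f i j) $$ (i, p i)) =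
        of_int (sign p) * (\<Prod>i = 0..<n. f i (p i))"
      by (intro arg_cong2[where f = "(*)"] prod.cong) auto
  qed
  finally show ?thesis by (simp add: dt_def atLeast0LessThan)
qed

lemma dt_transpose: "dt n (\<lambda>i j. f j i) = dt n f"
proof -
  have "mat n n (\<lambda>(i, j). f j i) = transpose_mat (mat n n (\<lambda>(i, j). f i j))"
    by (rule eq_matI) auto
  then show ?thesis unfolding dt_def by (metis det_transpose mat_carrier)
qed

lemma dt_leibniz':
  "dt n f = (\<Sum>p | p permutes {..<n}. of_int (sign p) * (\<Prod>j<n. f (p j) j))"
  by (subst dt_transpose[symmetric]) (rule dt_leibniz)

lemma dt_mult: "dt n f * dt n g = dt n (\<lambda>i j. \<Sum>k<n. f i k * g k j)"
proof -
  have "mat n n (\<lambda>(i, j). \<Sum>k<n. f i k * g k j) = mat n n (\<lambda>(i, j). f i j) * mat n n (\<lambda>(i, j). g i j)"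
    by (rule eq_matI) (auto simp: scalar_prod_def atLeast0LessThan intro!: sum.cong)
  then show ?thesis unfolding dt_def
    by (metis det_mult mat_carrier)
qed

lemma dt_laplace:
  "dt (Suc n) f = (\<Sum>k\<le>n. (-1) ^ (k + n) * f k n * dt n (\<lambda>i j. f (skip k i) j))"
proof -
  let ?A = "mat (Suc n) (Suc n) (\<lambda>(i, j). f i j)"
  have "det ?A = (\<Sum>i<Suc n. ?A $$ (i, n) * cofactor ?A i n)"
    by (rule laplace_expansion_column) auto
  also have "\<dots> = (\<Sum>k\<le>n. (-1) ^ (k + n) * f k n * dt n (\<lambda>i j. f (skip k i) j))"
    unfolding lessThan_Suc_atMost
  proof (rule sum.cong[OF refl])
    fix k assume "k \<in> {..n}"
    moreover have "mat_delete ?A k n = mat n n (\<lambda>(i, j). f (skip k i) j)"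
      by (rule eq_matI) (auto simp: mat_delete_def skip_def)
    ultimately show "?A $$ (k, n) * cofactor ?A k n = (-1) ^ (k + n) * f k n * dt n (\<lambda>i j. f (skip k i) j)"
      by (simp add: cofactor_def dt_def)
  qed
  finally show ?thesis by (simp add: dt_def)
qed

lemma dt_0 [simp]: "dt 0 f = 1"
  by (simp add: dt_leibniz)

lemma dt_equal_columns:
  assumes "a < n" "b < n" "a \<noteq> b" "\<And>i. i < n \<Longrightarrow> f i a = f i b"
  shows "dt n f = 0"
  unfolding dt_def
  by (rule det_identical_columns[of _ n a b]) (use assms in \<open>auto intro!: eq_vecI\<close>)

lemma dt_permute_rows:
  assumes "p permutes {..<n}"
  shows "dt n (\<lambda>i j. f (p i) j) = of_int (sign p) * dt n f"
proof -
  let ?A = "mat n n (\<lambda>(i, j). f i j)"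
  have eq: "mat n n (\<lambda>(i, j). f (p i) j) = mat n n (\<lambda>(i, j). ?A $$ (p i, j))"
    using permutes_in_image[OF assms] by (intro eq_matI) auto
  show ?thesis unfolding dt_def eq
    by (rule det_permute_rows) (use assms in \<open>auto simp: atLeast0LessThan\<close>)
qed

lemma dt_permute_columns:
  assumes "p permutes {..<n}"
  shows "dt n (\<lambda>i j. f i (p j)) = of_int (sign p) * dt n f"
  using dt_permute_rows[OF assms, of "\<lambda>i j. f j i"] 
  by (simp only: dt_transpose[of n f] dt_transpose[of n "\<lambda>i j. f i (p j)"])

lemma dt_scale_rows: "dt n (\<lambda>i j. c i * f i j) = (\<Prod>i<n. c i) * dt n f"
  by (simp add: dt_leibniz prod.distrib sum_distrib_left mult_ac)

text \<open>Multilinearity in the columns; \<open>S\<close> records the columns that take their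
  entries from \<open>g\<close>. Pieri's rule comes out of this expansion.\<close>

lemma dt_add_columns:
  "dt n (\<lambda>i j. f i j + g i j) = (\<Sum>S\<in>Pow {..<n}. dt n (\<lambda>i j. if j \<in> S then g i j else f i j))"
proof -
  have *: "(\<Prod>j<n. f (p j) j + g (p j) j) = (\<Sum>S\<in>Pow {..<n}. \<Prod>j<n. if j \<in> S then g (p j) j else f (p j) j)" for p
  proof -
    have "(\<Prod>j<n. f (p j) j + g (p j) j) = (\<Prod>j<n. g (p j) j + f (p j) j)"
      by (simp add: add.commute)
    also have "\<dots> = (\<Sum>S\<in>Pow {..<n}. (\<Prod>j\<in>S. g (p j) j) * (\<Prod>j\<in>{..<n}-S. f (p j) j))"
      by (rule prod_add) simp
    also have "\<dots> = (\<Sum>S\<in>Pow {..<n}. \<Prod>j<n. if j \<in> S then g (p j) j else f (p j) j)"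
    proof (rule sum.cong[OF refl])
      fix S assume S: "S \<in> Pow {..<n}"
      then have "{..<n} \<inter> {j. j \<in> S} = S" "{..<n} \<inter> - {j. j \<in> S} = {..<n} - S" by auto
      then show "(\<Prod>j\<in>S. g (p j) j) * (\<Prod>j\<in>{..<n}-S. f (p j) j) = (\<Prod>j<n. if j \<in> S then g (p j) j else f (p j) j)"
        using S by (subst prod.If_cases) auto
    qed
    finally show ?thesis .
  qed
  show ?thesis
    unfolding dt_leibniz' * sum_distrib_left by (rule sum.swap)
qed

lemma dt_upper_triangular:
  assumes "\<And>i j. j < i \<Longrightarrow> i < n \<Longrightarrow> f i j = 0"
  shows "dt n f = (\<Prod>i<n. f i i)"
proof -
  have "det (mat n n (\<lambda>(i, j). f i j)) = prod_list (diag_mat (mat n n (\<lambda>(i, j). f i j)))"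
    by (rule det_upper_triangular[of _ n]) (use assms in auto)
  then show ?thesis by (simp add: dt_def prod_list_diag_prod atLeast0LessThan)
qed

lemma dt_block:
  assumes "\<And>i j. i < n \<Longrightarrow> n \<le> j \<Longrightarrow> j < n + m \<Longrightarrow> f i j = 0"
  shows "dt (n + m) f = dt n f * dt m (\<lambda>i j. f (n + i) (n + j))"
  using assms
proof (induction m arbitrary: f)
  case 0
  then show ?case by simp
next
  case (Suc m)
  let ?t = "\<lambda>k. (-1) ^ (k + (n + m)) * f k (n + m) * dt (n + m) (\<lambda>i j. f (skip k i) j)"
  have "dt (n + Suc m) f = (\<Sum>k\<le>n + m. ?t k)"
    by (simp add: dt_laplace)
  \<comment> \<open>The last column vanishes in the first \<open>n\<close> rows, so only rows of the
    lower block get deleted.\<close>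
  also have "\<dots> = (\<Sum>k\<in>{n..n + m}. ?t k)"
    by (rule sum.mono_neutral_right) (use Suc.prems in auto)
  also have "\<dots> = (\<Sum>k\<le>m. ?t (n + k))"
    by (rule sum.reindex_bij_witness[of _ "\<lambda>k. n + k" "\<lambda>k. k - n"]) auto
  also have "\<dots> = (\<Sum>k\<le>m. dt n f * ((-1) ^ (k + m) * f (n + k) (n + m) * dt m (\<lambda>i j. f (n + skip k i) (n + j))))"
  proof (rule sum.cong[OF refl])
    fix k
    have "dt (n + m) (\<lambda>i j. f (skip (n + k) i) j) =
        dt n (\<lambda>i j. f (skip (n + k) i) j) * dt m (\<lambda>i j. f (skip (n + k) (n + i)) (n + j))"
      by (rule Suc.IH) (use Suc.prems in \<open>auto simp: skip_def\<close>)
    moreover have "dt n (\<lambda>i j. f (skip (n + k) i) j) = dt n f"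
      by (rule dt_cong) (auto simp: skip_def)
    moreover have "skip (n + k) (n + i) = n + skip k i" for i
      by (auto simp: skip_def)
    moreover have "(-1 :: 'a) ^ (n + k + (n + m)) = (-1) ^ (k + m)"
    proof -
      have "n + k + (n + m) = 2 * n + (k + m)" by simp
      then show ?thesis by (simp only: power_add power_mult) simp
    qed
    ultimately show "?t (n + k) = dt n f * ((-1) ^ (k + m) * f (n + k) (n + m) * dt m (\<lambda>i j. f (n + skip k i) (n + j)))"
      by (simp add: mult_ac)
  qed
  also have "\<dots> = dt n f * dt (Suc m) (\<lambda>i j. f (n + i) (n + j))"
    by (simp add: dt_laplace sum_distrib_left)
  finally show ?case .
qed

section \<open>Polynomial functions, the Vandermonde determinant and Chebyshev polynomials\<close>

definition lowdeg :: "nat \<Rightarrow> ('a::comm_ring_1 \<Rightarrow> 'a) \<Rightarrow> bool" where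
  "lowdeg m g \<longleftrightarrow> (\<exists>c. \<forall>x. g x = (\<Sum>k<m. c k * x ^ k))"

lemma lowdeg_add: "lowdeg m f \<Longrightarrow> lowdeg m g \<Longrightarrow> lowdeg m (\<lambda>x. f x + g x)"
proof -
  assume "lowdeg m f" "lowdeg m g"
  then obtain c d where "\<forall>x. f x = (\<Sum>k<m. c k * x ^ k)" "\<forall>x. g x = (\<Sum>k<m. d k * x ^ k)"
    unfolding lowdeg_def by blast
  then show ?thesis
    unfolding lowdeg_def by (intro exI[of _ "\<lambda>k. c k + d k"]) (simp add: sum.distrib distrib_right)
qed

lemma lowdeg_scale: "lowdeg m f \<Longrightarrow> lowdeg m (\<lambda>x. a * f x)"
proof -
  assume "lowdeg m f"
  then obtain c where "\<forall>x. f x = (\<Sum>k<m. c k * x ^ k)"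
    unfolding lowdeg_def by blast
  then show ?thesis
    unfolding lowdeg_def by (intro exI[of _ "\<lambda>k. a * c k"]) (simp add: sum_distrib_left mult_ac)
qed

lemma lowdeg_mult_x: "lowdeg m f \<Longrightarrow> lowdeg (Suc m) (\<lambda>x. x * f x)"
proof -
  assume "lowdeg m f"
  then obtain c where "\<forall>x. f x = (\<Sum>k<m. c k * x ^ k)"
    unfolding lowdeg_def by blast
  then show ?thesis
    unfolding lowdeg_def
    by (intro exI[of _ "\<lambda>k. case k of 0 \<Rightarrow> 0 | Suc l \<Rightarrow> c l"])
       (simp add: sum.lessThan_Suc_shift sum_distrib_left mult_ac del: sum.lessThan_Suc)
qed

lemma lowdeg_power: "k < m \<Longrightarrow> lowdeg m (\<lambda>x. x ^ k)"
  unfolding lowdeg_def by (rule exI[of _ "\<lambda>l. of_bool (l = k)"]) (simp add: of_bool_def if_distrib if_distribR cong: if_cong)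

lemma lowdeg_mono: "lowdeg m f \<Longrightarrow> m \<le> k \<Longrightarrow> lowdeg k f"
proof -
  assume "lowdeg m f" and mk: "m \<le> k"
  then obtain c where c: "\<forall>x. f x = (\<Sum>l<m. c l * x ^ l)"
    unfolding lowdeg_def by blast
  have "(\<Sum>l<m. c l * x ^ l) = (\<Sum>l<k. (if l < m then c l else 0) * x ^ l)" for x
    by (rule sum.mono_neutral_cong_left) (use mk in auto)
  then show ?thesis
    unfolding lowdeg_def using c by (intro exI[of _ "\<lambda>l. if l < m then c l else 0"]) simp
qed

text \<open>Polynomials appear as functions on the ring, with no claim that coefficients are unique:
  the change of basis in \<open>dt_monic\<close> works with any family of coefficients, over any
  commutative ring.\<close>

definition monic_fun :: "nat \<Rightarrow> ('a::comm_ring_1 \<Rightarrow> 'a) \<Rightarrow> bool" where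
  "monic_fun m f \<longleftrightarrow> lowdeg m (\<lambda>x. f x - x ^ m)"

lemma monic_fun_lowdeg: "monic_fun m f \<Longrightarrow> lowdeg (Suc m) f"
  using lowdeg_add[OF lowdeg_mono[of m "\<lambda>x. f x - x ^ m" "Suc m"] lowdeg_power[of m "Suc m"]]
  by (simp add: monic_fun_def)

lemma monic_fun_1: "monic_fun 0 (\<lambda>x. 1)"
  by (simp add: monic_fun_def lowdeg_def)

lemma monic_fun_Suc:
  assumes "monic_fun m f" "lowdeg (Suc m) g"
  shows "monic_fun (Suc m) (\<lambda>x. x * f x + g x)"
proof -
  have "lowdeg (Suc m) (\<lambda>x. x * (f x - x ^ m) + g x)"
    by (intro lowdeg_add lowdeg_mult_x) (use assms in \<open>auto simp: monic_fun_def\<close>)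
  then show ?thesis by (simp add: monic_fun_def algebra_simps)
qed

text \<open>The matrix is the Vandermonde matrix times the matrix of coefficients, and the latter is
  unitriangular.\<close>

lemma dt_monic:
  assumes "\<And>j. j < N \<Longrightarrow> monic_fun j (f j)"
  shows "dt N (\<lambda>i j. f j (z i)) = dt N (\<lambda>i j. z i ^ j)"
proof -
  have "\<exists>c. \<forall>x. f j x = x ^ j + (\<Sum>k<j. c k * x ^ k)" if "j < N" for j
    using assms[OF that] unfolding monic_fun_def lowdeg_def by (metis add.commute diff_add_cancel)
  then obtain c where c: "\<And>j x. j < N \<Longrightarrow> f j x = x ^ j + (\<Sum>k<j. c j k * x ^ k)"
    by metis
  define C where "C = (\<lambda>k j. if k = j then 1 else if k < j then c j k else 0)"
  have f: "f j x = (\<Sum>k<N. x ^ k * C k j)" if "j < N" for j x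
  proof -
    have "(\<Sum>k<N. x ^ k * C k j) = (\<Sum>k<Suc j. x ^ k * C k j)"
      by (rule sum.mono_neutral_right) (use that in \<open>auto simp: C_def\<close>)
    then show ?thesis by (simp add: c[OF that] C_def mult.commute add.commute)
  qed
  have "dt N (\<lambda>i j. f j (z i)) = dt N (\<lambda>i j. z i ^ j) * dt N C"
    unfolding dt_mult by (rule dt_cong) (simp add: f)
  also have "dt N C = 1"
    by (subst dt_upper_triangular) (auto simp: C_def)
  finally show ?thesis by simp
qed

text \<open>The monic family is chosen so that its \<open>j\<close>-th member vanishes at
  \<open>z i\<close> for all \<open>i < j\<close>, which makes the matrix triangular.\<close>

lemma vandermonde: "dt N (\<lambda>i j. z i ^ j) = (\<Prod>j<N. \<Prod>i<j. z j - z i)"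
proof -
  have "monic_fun j (\<lambda>x. \<Prod>i<j. x - z i)" for j
  proof (induction j)
    case 0
    then show ?case by (simp add: monic_fun_1)
  next
    case (Suc j)
    then have "monic_fun (Suc j) (\<lambda>x. x * (\<Prod>i<j. x - z i) + (- z j) * (\<Prod>i<j. x - z i))"
      by (intro monic_fun_Suc lowdeg_scale monic_fun_lowdeg)
    then show ?case by (simp add: algebra_simps)
  qed
  then have "dt N (\<lambda>i j. z i ^ j) = dt N (\<lambda>i j. \<Prod>k<j. z i - z k)"
    by (intro dt_monic[symmetric])
  also have "\<dots> = dt N (\<lambda>i j. \<Prod>k<i. z j - z k)"
    by (rule dt_transpose[symmetric])
  also have "\<dots> = (\<Prod>j<N. \<Prod>i<j. z j - z i)"
    by (subst dt_upper_triangular) (auto intro!: prod_zero)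
  finally show ?thesis .
qed

text \<open>Chebyshev polynomials of the second kind in the normalization \<open>U_j(y / 2)\<close>,
  that is, the characters of SL(2) as polynomials in the trace.\<close>

fun chebU :: "nat \<Rightarrow> 'a::comm_ring_1 \<Rightarrow> 'a" where
  "chebU 0 y = 1"
| "chebU (Suc 0) y = y"
| "chebU (Suc (Suc j)) y = y * chebU (Suc j) y - chebU j y"

lemma monic_chebU: "monic_fun j (chebU j :: 'a::comm_ring_1 \<Rightarrow> 'a)"
proof (induction j rule: less_induct)
  case (less j)
  consider "j = 0" | "j = 1" | k where "j = Suc (Suc k)" by (metis One_nat_def not0_implies_Suc)
  then show ?case
  proof cases
    case 1
    then show ?thesis by (simp add: monic_fun_1)
  next
    case 2
    then show ?thesis by (simp add: monic_fun_def lowdeg_def) (rule exI[of _ "\<lambda>_. 0"], simp)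
  next
    case 3
    have "lowdeg (Suc (Suc k)) (\<lambda>x::'a. (- 1) * chebU k x)"
      using less[of k] 3 by (intro lowdeg_scale lowdeg_mono[OF monic_fun_lowdeg[of k]]) auto
    then have "monic_fun (Suc (Suc k)) (\<lambda>x::'a. x * chebU (Suc k) x + (- 1) * chebU k x)"
      using less[of "Suc k"] 3 by (intro monic_fun_Suc) auto
    then show ?thesis by (simp add: 3)
  qed
qed

lemma chebU_diff:
  assumes "x * x' = 1"
  shows "x ^ Suc j - x' ^ Suc j = (x - x') * chebU j (x + x')"
proof (induction j rule: less_induct)
  case (less j)
  consider "j = 0" | "j = 1" | k where "j = Suc (Suc k)" by (metis One_nat_def not0_implies_Suc)
  then show ?case
  proof cases
    case 3
    have a: "x ^ Suc (Suc k) - x' ^ Suc (Suc k) = (x - x') * chebU (Suc k) (x + x')"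
      and b: "x ^ Suc k - x' ^ Suc k = (x - x') * chebU k (x + x')"
      using less[of "Suc k"] less[of k] 3 by auto
    have "(x - x') * chebU j (x + x') =
        (x + x') * (x ^ Suc (Suc k) - x' ^ Suc (Suc k)) - (x ^ Suc k - x' ^ Suc k)"
      unfolding a b 3 by (simp add: algebra_simps)
    also have "\<dots> = x ^ Suc j - x' ^ Suc j + (x * x' - 1) * (x ^ Suc k - x' ^ Suc k)"
      by (simp add: 3 algebra_simps)
    finally show ?thesis using assms by simp
  qed (auto simp: algebra_simps)
qed

text \<open>Once \<open>x i - x' i\<close> is taken out of each row, the columns are monic
  polynomials in \<open>x i + x' i\<close>.\<close>

lemma weyl_denominator_C:
  assumes "\<And>i. i < n \<Longrightarrow> x i * x' i = 1"
  shows "dt n (\<lambda>i j. x i ^ Suc j - x' i ^ Suc j) =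
    (\<Prod>i<n. x i - x' i) * (\<Prod>j<n. \<Prod>i<j. (x j + x' j) - (x i + x' i))"
proof -
  have "dt n (\<lambda>i j. x i ^ Suc j - x' i ^ Suc j) =
      dt n (\<lambda>i j. (x i - x' i) * chebU j (x i + x' i))"
    by (rule dt_cong) (rule chebU_diff[OF assms])
  also have "\<dots> = (\<Prod>i<n. x i - x' i) * dt n (\<lambda>i j. (x i + x' i) ^ j)"
    unfolding dt_scale_rows
    by (rule arg_cong2[where f = "(*)"], rule refl) (rule dt_monic[OF monic_chebU])
  finally show ?thesis by (simp add: vandermonde)
qed

section \<open>The squared denominator and the Vandermonde determinant in \<open>2n\<close>
  variables\<close>

definition interleave :: "(nat \<Rightarrow> 'a) \<Rightarrow> (nat \<Rightarrow> 'a) \<Rightarrow> nat \<Rightarrow> 'a" where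
  "interleave x x' k = (if even k then x (k div 2) else x' (k div 2))"

lemma interleave_simps [simp]:
  "interleave x x' (2 * i) = x i" "interleave x x' (Suc (2 * i)) = x' i"
  "interleave x x' (i * 2) = x i" "interleave x x' (Suc (i * 2)) = x' i"
  by (simp_all add: interleave_def)

lemma prod_lessThan_double:
  fixes f :: "nat \<Rightarrow> 'a::comm_monoid_mult"
  shows "(\<Prod>k<2 * n. f k) = (\<Prod>i<n. f (2 * i) * f (Suc (2 * i)))"
  by (induction n) (auto simp: mult_ac)

text \<open>The four differences between the variables of two pairs multiply to the squared
  difference of the sums \<open>x i + x' i\<close>, because the monomials that split off on the way,
  \<open>x i\<close> and \<open>x' i\<close>, cancel. The one difference inside a pair supplies a
  single factor \<open>x i - x' i\<close>, where the squared denominator has two.\<close>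

lemma weyl_denominator_C_squared:
  assumes inv: "\<And>i. i < n \<Longrightarrow> x i * x' i = 1"
  shows "dt n (\<lambda>i j. x i ^ Suc j - x' i ^ Suc j) ^ 2 =
    (- 1) ^ n * dt (2 * n) (\<lambda>i j. interleave x x' i ^ j) * (\<Prod>i<n. x i - x' i)"
proof -
  let ?z = "interleave x x'" and ?y = "\<lambda>i. x i + x' i"
  have "(\<Prod>j<2 * n. \<Prod>i<j. ?z j - ?z i) =
      (- 1) ^ n * (\<Prod>i<n. x i - x' i) * (\<Prod>j<n. \<Prod>i<j. ?y j - ?y i) ^ 2"
    using inv
  proof (induction n)
    case 0
    then show ?case by simp
  next
    case (Suc n)
    have *: "(x n - x i) * (x' n - x i) * ((x n - x' i) * (x' n - x' i)) = (?y n - ?y i) ^ 2"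
      if "i < n" for i
    proof -
      have 1: "x n * x' n = 1" and 2: "x i * x' i = 1" using Suc.prems that by auto
      have "(x n - x i) * (x' n - x i) = x i * (?y i - ?y n)"
      proof -
        have "(x n - x i) * (x' n - x i) = x n * x' n - x i * x n - x i * x' n + x i * x i"
          by (simp add: algebra_simps)
        also have "\<dots> = x i * x' i - x i * x n - x i * x' n + x i * x i" by (simp only: 1 2)
        finally show ?thesis by (simp add: algebra_simps)
      qed
      moreover have "(x n - x' i) * (x' n - x' i) = x' i * (?y i - ?y n)"
      proof -
        have "(x n - x' i) * (x' n - x' i) = x n * x' n - x' i * x n - x' i * x' n + x' i * x' i"
          by (simp add: algebra_simps)
        also have "\<dots> = x i * x' i - x' i * x n - x' i * x' n + x' i * x' i" by (simp only: 1 2)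
        finally show ?thesis by (simp add: algebra_simps)
      qed
      ultimately have "(x n - x i) * (x' n - x i) * ((x n - x' i) * (x' n - x' i)) =
          (x i * x' i) * (?y i - ?y n) ^ 2" by (simp add: power2_eq_square mult_ac)
      then show ?thesis using 2 by (simp add: power2_commute)
    qed
    have "(\<Prod>j<2 * Suc n. \<Prod>i<j. ?z j - ?z i) = (\<Prod>j<2 * n. \<Prod>i<j. ?z j - ?z i) *
        ((\<Prod>i<2 * n. x n - ?z i) * ((\<Prod>i<2 * n. x' n - ?z i) * (x' n - x n)))"
      by (simp add: mult_ac)
    also have "(\<Prod>i<2 * n. x n - ?z i) * ((\<Prod>i<2 * n. x' n - ?z i) * (x' n - x n)) =
        (x' n - x n) * (\<Prod>i<n. (x n - x i) * (x' n - x i) * ((x n - x' i) * (x' n - x' i)))"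
      unfolding prod_lessThan_double by (simp add: prod.distrib mult_ac)
    also have "(\<Prod>i<n. (x n - x i) * (x' n - x i) * ((x n - x' i) * (x' n - x' i))) =
        (\<Prod>i<n. ?y n - ?y i) ^ 2"
      unfolding prod_power_distrib by (rule prod.cong) (use * in auto)
    finally show ?case using Suc by (simp add: power_mult_distrib mult_ac) (simp add: algebra_simps)
  qed
  then have "(- 1) ^ n * dt (2 * n) (\<lambda>i j. ?z i ^ j) * (\<Prod>i<n. x i - x' i) =
      ((- 1) ^ n * (- 1) ^ n) * ((\<Prod>i<n. x i - x' i) * (\<Prod>j<n. \<Prod>i<j. ?y j - ?y i)) ^ 2"
    unfolding vandermonde by (simp add: power2_eq_square mult_ac)
  moreover have "dt n (\<lambda>i j. x i ^ Suc j - x' i ^ Suc j) =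
      (\<Prod>i<n. x i - x' i) * (\<Prod>j<n. \<Prod>i<j. ?y j - ?y i)"
    by (rule weyl_denominator_C) (rule inv)
  ultimately show ?thesis
    by (simp only: power_mult_distrib[symmetric]) simp
qed

section \<open>Littlewood's identity for partitions with even parts\<close>

fun cycle_perm :: "nat \<Rightarrow> nat \<Rightarrow> nat" where
  "cycle_perm N 0 = N"
| "cycle_perm N (Suc j) = (if j < N then j else Suc j)"

lemma cycle_perm:
  shows "cycle_perm N permutes {..<Suc N} \<and> sign (cycle_perm N) = (- 1) ^ N"
proof (induction N)
  case 0
  have "cycle_perm 0 = id"
    by (rule ext) (case_tac x, auto)
  then show ?case by (metis permutes_id sign_id power_0)
next
  case (Suc N)
  have eq: "cycle_perm (Suc N) = Transposition.transpose N (Suc N) \<circ> cycle_perm N"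
    by (rule ext) (case_tac x, auto simp: Transposition.transpose_def)
  have t: "Transposition.transpose N (Suc N) permutes {..<Suc (Suc N)}"
    by (rule permutes_swap_id) auto
  have c: "cycle_perm N permutes {..<Suc (Suc N)}"
    using Suc by (auto intro: permutes_subset)
  have "sign (Transposition.transpose N (Suc N) \<circ> cycle_perm N) = sign (Transposition.transpose N (Suc N)) * sign (cycle_perm N)"
    using t c by (intro sign_compose) (auto intro: permutes_imp_permutation[of "{..<Suc (Suc N)}"])
  also have "\<dots> = (- 1) ^ Suc N"
    using Suc by (simp add: sign_swap_id)
  finally show ?case
    unfolding eq using permutes_compose[OF c t] by blast
qed

lemma dt_move_last_column:
  "dt (Suc N) (\<lambda>i j. case j of 0 \<Rightarrow> f i N | Suc j' \<Rightarrow> f i j') = (- 1) ^ N * dt (Suc N) f"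
proof -
  have "dt (Suc N) (\<lambda>i j. case j of 0 \<Rightarrow> f i N | Suc j' \<Rightarrow> f i j') = dt (Suc N) (\<lambda>i j. f i (cycle_perm N j))"
    by (rule dt_cong) (auto split: nat.splits)
  also have "\<dots> = of_int (sign (cycle_perm N)) * dt (Suc N) f"
    by (rule dt_permute_columns) (use cycle_perm in blast)
  finally show ?thesis using cycle_perm[of N] by simp
qed

definition esym :: "nat \<Rightarrow> (nat \<Rightarrow> 'a::comm_ring_1) \<Rightarrow> nat \<Rightarrow> 'a" where
  "esym M z r = (\<Sum>S | S \<subseteq> {..<M} \<and> card S = r. \<Prod>i\<in>S. z i)"

lemma prod_one_plus_esym:
  "(\<Prod>j<M. 1 + z j * w) = (\<Sum>r\<le>M. esym M z r * w ^ r)"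
proof -
  have "(\<Prod>j<M. 1 + z j * w) = (\<Prod>j<M. z j * w + 1)"
    by (simp add: add.commute)
  also have "\<dots> = (\<Sum>S\<in>Pow {..<M}. (\<Prod>i\<in>S. z i) * w ^ card S)"
    by (subst prod_add) (simp_all add: prod.distrib)
  also have "\<dots> = (\<Sum>r\<le>M. \<Sum>S | S \<in> Pow {..<M} \<and> card S = r. (\<Prod>i\<in>S. z i) * w ^ card S)"
  proof (rule sum.group[symmetric])
    show "card ` Pow {..<M} \<subseteq> {..M}"
    proof
      fix r assume "r \<in> card ` Pow {..<M}"
      then obtain S where "S \<subseteq> {..<M}" "r = card S" by auto
      then show "r \<in> {..M}" using card_mono[of "{..<M}" S] by simp
    qed
  qed auto
  also have "\<dots> = (\<Sum>r\<le>M. esym M z r * w ^ r)"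
    by (simp add: esym_def sum_distrib_right)
  finally show ?thesis .
qed

lemma esym_0: "esym M z 0 = 1"
proof -
  have "{S. S \<subseteq> {..<M} \<and> card S = 0} = {{}}"
    by (auto dest: finite_subset)
  then show ?thesis by (simp add: esym_def)
qed

lemma esym_top: "esym M z M = (\<Prod>i<M. z i)"
proof -
  have "S = {..<M}" if "S \<subseteq> {..<M}" "card S = M" for S
    using card_subset_eq[of "{..<M}" S] that by simp
  then have "{S. S \<subseteq> {..<M} \<and> card S = M} = {{..<M}}" by auto
  then show ?thesis by (simp add: esym_def)
qed

definition even_parts :: "nat \<Rightarrow> nat \<Rightarrow> (nat \<Rightarrow> nat) set" where
  "even_parts N d = {\<nu>. (\<forall>i. even (\<nu> i)) \<and> (\<forall>i. \<nu> (Suc i) \<le> \<nu> i) \<and> (\<forall>i\<ge>N. \<nu> i = 0) \<and> (\<Sum>i<N. \<nu> i) = 2 * d}"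

lemma finite_even_parts: "finite (even_parts N d)"
proof -
  have "even_parts N d \<subseteq> {f. \<forall>i. (i \<in> {..<N} \<longrightarrow> f i \<in> {..2 * d}) \<and> (i \<notin> {..<N} \<longrightarrow> f i = 0)}"
  proof
    fix \<nu> assume \<nu>: "\<nu> \<in> even_parts N d"
    have "\<nu> i \<le> 2 * d" if "i < N" for i
      using \<nu> member_le_sum[of i "{..<N}" \<nu>] that by (auto simp: even_parts_def)
    then show "\<nu> \<in> {f. \<forall>i. (i \<in> {..<N} \<longrightarrow> f i \<in> {..2 * d}) \<and> (i \<notin> {..<N} \<longrightarrow> f i = 0)}"
      using \<nu> by (auto simp: even_parts_def)
  qed
  then show ?thesis
    by (rule finite_subset) (intro finite_set_of_finite_funs; simp)
qed

text \<open>Littlewood's sum of Schur functions times the Vandermonde determinant, which avoids a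
  division. The exponent \<open>d\<close> is half the size of the partition, since a factor of
  \<open>lw_prod\<close> attaches one \<open>X\<close> to two variables.\<close>

definition lw_sum :: "nat \<Rightarrow> (nat \<Rightarrow> 'a::comm_ring_1) \<Rightarrow> 'a fps" where
  "lw_sum N z = Abs_fps (\<lambda>d. \<Sum>\<nu>\<in>even_parts N d. dt N (\<lambda>i j. z i ^ (\<nu> j + (N - 1 - j))))"

definition lw_prod :: "nat \<Rightarrow> (nat \<Rightarrow> 'a::comm_ring_1) \<Rightarrow> 'a fps" where
  "lw_prod N z = (\<Prod>(i, j)\<in>{(i, j). i \<le> j \<and> j < N}. 1 - fps_const (z i * z j) * fps_X)"

text \<open>The pairs \<open>i \<le> j\<close> are sorted by whether they contain \<open>k\<close>.
  Those that do are parametrized by their other member, with \<open>j = k\<close> for the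
  square.\<close>

lemma lw_prod_Suc:
  assumes "k \<le> N"
  shows "lw_prod (Suc N) z =
    lw_prod N (\<lambda>i. z (skip k i)) * (\<Prod>j<Suc N. 1 - fps_const (z k * z j) * fps_X)"
proof -
  let ?g = "\<lambda>(i, j). 1 - fps_const (z i * z j) * fps_X"
  let ?T = "\<lambda>N. {(i, j). i \<le> j \<and> j < (N::nat)}"
  let ?h = "\<lambda>(i, j). (skip k i, skip k j)"
  let ?q = "\<lambda>j. (min k j, max k j)"
  have sk_inj: "inj (skip k)" by (auto simp: inj_def skip_def split: if_splits)
  have sk_ne: "skip k i \<noteq> k" for i by (auto simp: skip_def)
  have sk_le: "skip k i \<le> skip k j \<longleftrightarrow> i \<le> j" for i j by (auto simp: skip_def)
  have sk_ex: "\<exists>i. j = skip k i" if "j \<noteq> k" for j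
    using that by (intro exI[of _ "if j < k then j else j - 1"]) (auto simp: skip_def)
  have sk_lt: "skip k j < Suc N \<longleftrightarrow> j < N" for j using assms by (auto simp: skip_def)
  have fin: "finite (?T N)" for N
    by (rule finite_subset[of _ "{..<N} \<times> {..<N}"]) auto
  have mem: "((a, b) \<in> ?T (Suc N)) = ((a, b) \<in> ?h ` ?T N \<union> ?q ` {..<Suc N})" for a b :: nat
    proof (cases "a = k \<or> b = k")
      case True
      then have "(a, b) \<notin> ?h ` ?T N" using sk_ne by force
      moreover have "(a, b) \<in> ?T (Suc N) \<longleftrightarrow> (a, b) \<in> ?q ` {..<Suc N}"
      proof
        assume ab: "(a, b) \<in> ?T (Suc N)"
        have "(a, b) = ?q (if a = k then b else a)" "(if a = k then b else a) \<in> {..<Suc N}"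
          using True ab by (auto simp: min_def max_def)
        then show "(a, b) \<in> ?q ` {..<Suc N}" by (rule image_eqI)
      qed (use assms in \<open>auto simp: min_def max_def\<close>)
      ultimately show ?thesis by blast
    next
      case False
      then obtain i j where ij: "a = skip k i" "b = skip k j" using sk_ex by blast
      have "(a, b) \<notin> ?q ` {..<Suc N}" using False by (auto simp: min_def max_def split: if_splits)
      moreover have "(a, b) \<in> ?h ` ?T N \<longleftrightarrow> (i, j) \<in> ?T N"
        using sk_inj by (auto simp: ij image_iff inj_eq)
      ultimately show ?thesis by (simp add: ij sk_le sk_lt)
    qed
  have eq: "?T (Suc N) = ?h ` ?T N \<union> ?q ` {..<Suc N}"
  proof (rule Set.set_eqI)
    fix x show "(x \<in> ?T (Suc N)) = (x \<in> ?h ` ?T N \<union> ?q ` {..<Suc N})"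
      using mem[of "fst x" "snd x"] by (simp only: prod.collapse)
  qed
  have disj: "?h ` ?T N \<inter> ?q ` {..<Suc N} = {}"
  proof -
    have "fst p \<noteq> k \<and> snd p \<noteq> k" if "p \<in> ?h ` ?T N" for p using that sk_ne by auto
    moreover have "fst p = k \<or> snd p = k" if "p \<in> ?q ` {..<Suc N}" for p
      using that by (auto simp: min_def max_def split: if_splits)
    ultimately show ?thesis by blast
  qed
  have "lw_prod (Suc N) z = prod ?g (?h ` ?T N) * prod ?g (?q ` {..<Suc N})"
    unfolding lw_prod_def eq by (rule prod.union_disjoint) (use fin disj in auto)
  also have "prod ?g (?h ` ?T N) = lw_prod N (\<lambda>i. z (skip k i))"
  proof -
    have "inj_on ?h (?T N)"
      by (rule inj_onI) (use sk_inj in \<open>simp add: split_beta prod_eq_iff inj_eq\<close>)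
    then have "prod ?g (?h ` ?T N) = prod (?g \<circ> ?h) (?T N)"
      by (rule prod.reindex)
    also have "?g \<circ> ?h = (\<lambda>(i, j). 1 - fps_const (z (skip k i) * z (skip k j)) * fps_X)"
      by (simp add: fun_eq_iff)
    finally show ?thesis unfolding lw_prod_def .
  qed
  also have "prod ?g (?q ` {..<Suc N}) = (\<Prod>j<Suc N. 1 - fps_const (z k * z j) * fps_X)"
  proof -
    have "prod ?g (?q ` {..<Suc N}) = prod (?g \<circ> ?q) {..<Suc N}"
      by (rule prod.reindex) (auto simp: inj_on_def min_def max_def split: if_splits)
    also have "\<dots> = (\<Prod>j<Suc N. 1 - fps_const (z k * z j) * fps_X)"
      by (rule prod.cong) (auto simp: min_def max_def mult.commute)
    finally show ?thesis .
  qed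
  finally show ?thesis .
qed

lemma even_parts_Suc_0:
  "even_parts (Suc N) d \<inter> {\<nu>. \<nu> N = 0} = even_parts N d"
proof -
  have "(\<forall>i\<ge>N. \<nu> i = 0) \<longleftrightarrow> \<nu> N = 0 \<and> (\<forall>i\<ge>Suc N. \<nu> i = 0)" for \<nu> :: "nat \<Rightarrow> nat"
    by (metis Suc_leD Suc_leI order_le_less order_refl)
  then show ?thesis by (auto simp: even_parts_def)
qed

text \<open>Subtracting 2 from all \<open>Suc N\<close> rows is a bijection from the partitions with
  nonzero last part onto all partitions with \<open>d\<close> lowered by \<open>Suc N\<close>, and
  it takes the square of the product of the variables out of the alternant. What the factor leaves
  are the partitions with vanishing last part.\<close>

lemma lw_sum_Suc:
  "(1 - fps_const ((\<Prod>i<Suc N. z i) ^ 2) * fps_X ^ Suc N) * lw_sum (Suc N) z =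
    Abs_fps (\<lambda>d. \<Sum>\<nu>\<in>even_parts N d. dt (Suc N) (\<lambda>i j. z i ^ (\<nu> j + (N - j))))"
proof (rule fps_ext)
  fix d
  let ?D = "\<lambda>\<nu>. dt (Suc N) (\<lambda>i j. z i ^ (\<nu> j + (N - j)))"
  let ?Z = "\<Prod>i<Suc N. z i"
  let ?up = "\<lambda>\<nu> i. if i \<le> N then \<nu> i + 2 else \<nu> i :: nat"
  have shift: "?D (?up \<nu>) = ?Z ^ 2 * ?D \<nu>" for \<nu>
  proof -
    have "?D (?up \<nu>) = dt (Suc N) (\<lambda>i j. z i ^ 2 * z i ^ (\<nu> j + (N - j)))"
      by (rule dt_cong) (simp add: power_add power2_eq_square mult_ac)
    then show ?thesis by (simp only: dt_scale_rows prod_power_distrib)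
  qed
  have pos: "(\<Sum>\<nu>\<in>even_parts (Suc N) d \<inter> {\<nu>. \<nu> N \<noteq> 0}. ?D \<nu>) =
      (if Suc N \<le> d then \<Sum>\<nu>\<in>even_parts (Suc N) (d - Suc N). ?Z ^ 2 * ?D \<nu> else 0)"
  proof (cases "Suc N \<le> d")
    case False
    have "\<nu> \<notin> even_parts (Suc N) d" if "\<nu> N \<noteq> 0" for \<nu>
    proof
      assume \<nu>: "\<nu> \<in> even_parts (Suc N) d"
      then have "even (\<nu> N)" by (auto simp: even_parts_def)
      with that have "2 \<le> \<nu> N" by (auto intro: dvd_imp_le)
      moreover have "antimono \<nu>" using \<nu> by (intro decseq_SucI) (auto simp: even_parts_def)
      ultimately have "2 \<le> \<nu> i" if "i < Suc N" for i
        using that decseqD[of \<nu> i N] by simp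
      then have "(\<Sum>i<Suc N. 2) \<le> (\<Sum>i<Suc N. \<nu> i)" by (intro sum_mono) auto
      with \<nu> False show False by (simp add: even_parts_def)
    qed
    then have "even_parts (Suc N) d \<inter> {\<nu>. \<nu> N \<noteq> 0} = {}" by auto
    then show ?thesis using False by simp
  next
    case True
    have "(\<Sum>\<nu>\<in>even_parts (Suc N) d \<inter> {\<nu>. \<nu> N \<noteq> 0}. ?D \<nu>) = (\<Sum>\<nu>\<in>even_parts (Suc N) (d - Suc N). ?D (?up \<nu>))"
    proof (rule sum.reindex_bij_witness[of _ ?up "\<lambda>\<nu> i. \<nu> i - 2"])
      fix \<nu> assume "\<nu> \<in> even_parts (Suc N) d \<inter> {\<nu>. \<nu> N \<noteq> 0}"
      then have \<nu>: "\<nu> \<in> even_parts (Suc N) d" and ne: "\<nu> N \<noteq> 0" by auto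
      then have "even (\<nu> N)" by (auto simp: even_parts_def)
      with ne have "2 \<le> \<nu> N" by (auto intro: dvd_imp_le)
      moreover have anti: "antimono \<nu>" using \<nu> by (intro decseq_SucI) (auto simp: even_parts_def)
      ultimately have ge: "2 \<le> \<nu> i" if "i \<le> N" for i
        using that decseqD[of \<nu> i N] by simp
      have up: "(if i \<le> N then \<nu> i - 2 + 2 else \<nu> i - 2) = \<nu> i" for i
        using ge[of i] \<nu> by (cases "i \<le> N") (simp_all add: even_parts_def)
      then show "?up (\<lambda>i. \<nu> i - 2) = \<nu>" by blast
      show "?D (?up (\<lambda>i. \<nu> i - 2)) = ?D \<nu>" by (rule dt_cong) (simp only: up)
      have sum\<nu>: "(\<Sum>i<Suc N. \<nu> i) = 2 * d"
        using \<nu> by (simp only: even_parts_def mem_Collect_eq)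
      have "(\<Sum>i<Suc N. \<nu> i) = (\<Sum>i<Suc N. (\<nu> i - 2) + 2)"
      proof (rule sum.cong)
        fix i assume "i \<in> {..<Suc N}"
        then show "\<nu> i = \<nu> i - 2 + 2" using ge[of i] by simp
      qed simp
      then have "2 * d = (\<Sum>i<Suc N. \<nu> i - 2) + 2 * Suc N"
        unfolding sum\<nu> by (simp only: sum.distrib sum_constant card_lessThan) simp
      then have "(\<Sum>i<Suc N. \<nu> i - 2) = 2 * (d - Suc N)"
        using True by arith
      then show "(\<lambda>i. \<nu> i - 2) \<in> even_parts (Suc N) (d - Suc N)"
        using \<nu> by (auto simp: even_parts_def intro: diff_le_mono)
    next
      fix \<nu> assume \<nu>: "\<nu> \<in> even_parts (Suc N) (d - Suc N)"
      show "(\<lambda>i. ?up \<nu> i - 2) = \<nu>"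
        using \<nu> by (auto simp: even_parts_def fun_eq_iff)
      have sum\<nu>: "(\<Sum>i<Suc N. \<nu> i) = 2 * (d - Suc N)"
        using \<nu> by (simp only: even_parts_def mem_Collect_eq)
      have "(\<Sum>i<Suc N. ?up \<nu> i) = (\<Sum>i<Suc N. \<nu> i + 2)"
        by (rule sum.cong) auto
      also have "\<dots> = (\<Sum>i<Suc N. \<nu> i) + 2 * Suc N"
        by (simp only: sum.distrib sum_constant card_lessThan) simp
      finally have "(\<Sum>i<Suc N. ?up \<nu> i) = 2 * d"
        unfolding sum\<nu> using True by arith
      then show "?up \<nu> \<in> even_parts (Suc N) d \<inter> {\<nu>. \<nu> N \<noteq> 0}"
        using \<nu> by (auto simp: even_parts_def)
    qed
    then show ?thesis using True by (simp add: shift)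
  qed
  have "(\<Sum>\<nu>\<in>even_parts (Suc N) d. ?D \<nu>) =
      (\<Sum>\<nu>\<in>even_parts (Suc N) d \<inter> {\<nu>. \<nu> N = 0}. ?D \<nu>) + (\<Sum>\<nu>\<in>even_parts (Suc N) d \<inter> {\<nu>. \<nu> N \<noteq> 0}. ?D \<nu>)"
    by (subst sum.union_disjoint[symmetric]) (auto simp: finite_even_parts intro!: sum.cong)
  also have "\<dots> = (\<Sum>\<nu>\<in>even_parts N d. ?D \<nu>) + 
      (if Suc N \<le> d then \<Sum>\<nu>\<in>even_parts (Suc N) (d - Suc N). ?Z ^ 2 * ?D \<nu> else 0)"
    by (simp only: even_parts_Suc_0 pos)
  finally have main: "(\<Sum>\<nu>\<in>even_parts (Suc N) d. ?D \<nu>) = (\<Sum>\<nu>\<in>even_parts N d. ?D \<nu>) + 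
      (if Suc N \<le> d then \<Sum>\<nu>\<in>even_parts (Suc N) (d - Suc N). ?Z ^ 2 * ?D \<nu> else 0)" .
  have "fps_nth ((1 - fps_const (?Z ^ 2) * fps_X ^ Suc N) * lw_sum (Suc N) z) d =
      fps_nth (lw_sum (Suc N) z) d - ?Z ^ 2 * fps_nth (fps_X ^ Suc N * lw_sum (Suc N) z) d"
    by (simp only: left_diff_distrib mult.assoc fps_sub_nth fps_mult_left_const_nth mult_1_left)
  also have "\<dots> = (\<Sum>\<nu>\<in>even_parts (Suc N) d. ?D \<nu>) -
      (if Suc N \<le> d then \<Sum>\<nu>\<in>even_parts (Suc N) (d - Suc N). ?Z ^ 2 * ?D \<nu> else 0)"
    unfolding fps_X_power_mult_nth by (auto simp: lw_sum_def sum_distrib_left not_less not_le)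
  finally show "fps_nth ((1 - fps_const (?Z ^ 2) * fps_X ^ Suc N) * lw_sum (Suc N) z) d =
      fps_nth (Abs_fps (\<lambda>d. \<Sum>\<nu>\<in>even_parts N d. ?D \<nu>)) d"
    using main by simp
qed

text \<open>The factor has constant coefficient 1, so the coefficients of the cofactor are
  determined recursively, whether or not the ring has zero divisors.\<close>

lemma fps_one_minus_cancel:
  fixes f g :: "'a::comm_ring_1 fps"
  assumes "(1 - fps_const a * fps_X ^ Suc M) * f = (1 - fps_const a * fps_X ^ Suc M) * g"
  shows "f = g"
proof -
  let ?h = "f - g"
  have "(1 - fps_const a * fps_X ^ Suc M) * ?h = 0" using assms by (simp add: right_diff_distrib)
  have h: "fps_nth ?h d = a * fps_nth (fps_X ^ Suc M * ?h) d" for d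
  proof -
    have "0 = fps_nth ((1 - fps_const a * fps_X ^ Suc M) * ?h) d"
      using \<open>(1 - fps_const a * fps_X ^ Suc M) * ?h = 0\<close> by (simp only: fps_zero_nth)
    also have "\<dots> = fps_nth ?h d - a * fps_nth (fps_X ^ Suc M * ?h) d"
      by (simp only: left_diff_distrib mult.assoc fps_sub_nth fps_mult_left_const_nth mult_1_left)
    finally show ?thesis by simp
  qed
  have "fps_nth ?h d = 0" for d
    by (induction d rule: less_induct) (subst h, simp only: fps_X_power_mult_nth, auto)
  then show ?thesis by (simp add: fps_eq_iff)
qed

text \<open>
  Laplace expansion along the last column reduces the number of variables by one.
\<close>

theorem littlewood_even:
  "lw_prod N z * lw_sum N z = fps_const (dt N (\<lambda>i j. z i ^ (N - 1 - j)))"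
proof (induction N arbitrary: z)
  case 0
  have "even_parts 0 d = (if d = 0 then {\<lambda>_. 0} else {})" for d
    by (auto simp: even_parts_def fun_eq_iff)
  then show ?case
    by (auto simp: lw_prod_def lw_sum_def fps_eq_iff)
next
  case (Suc N)
  let ?Z = "\<Prod>i<Suc N. z i"
  let ?V = "dt (Suc N) (\<lambda>i j. z i ^ (N - j))"
  let ?zz = "\<lambda>k i. z (skip k i)"
  let ?c = "\<lambda>k. (- 1) ^ (k + N) * (\<Prod>i<N. ?zz k i) :: 'a"
  \<comment> \<open>Multiplying by the new factors of \<open>lw_prod\<close> and summing over the
    deleted row \<open>k\<close> reassembles determinants whose last column has exponent
    \<open>r\<close>. For \<open>0 < r \<le> N\<close> this exponent repeats that of column
    \<open>N - r\<close>, so only \<open>r = 0\<close> and \<open>r = Suc N\<close> survive.\<close>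
  let ?R = "\<lambda>r. dt (Suc N) (\<lambda>i j. z i ^ (if j = N then r else N - j))"
  have laplace: "dt (Suc N) (\<lambda>i j. z i ^ (if j = N then r else \<nu> j + (N - j))) =
      (\<Sum>k\<le>N. ?c k * z k ^ r * dt N (\<lambda>i j. ?zz k i ^ (\<nu> j + (N - 1 - j))))" for r \<nu>
  proof -
    have "dt N (\<lambda>i j. z (skip k i) ^ (if j = N then r else \<nu> j + (N - j))) =
        (\<Prod>i<N. ?zz k i) * dt N (\<lambda>i j. ?zz k i ^ (\<nu> j + (N - 1 - j)))" for k
    proof -
      have "dt N (\<lambda>i j. z (skip k i) ^ (if j = N then r else \<nu> j + (N - j))) =
          dt N (\<lambda>i j. ?zz k i * ?zz k i ^ (\<nu> j + (N - 1 - j)))"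
      proof (rule dt_cong)
        fix i j assume "i < N" "j < N"
        then have "\<nu> j + (N - j) = Suc (\<nu> j + (N - 1 - j))" by simp
        with \<open>j < N\<close> show "z (skip k i) ^ (if j = N then r else \<nu> j + (N - j)) = ?zz k i * ?zz k i ^ (\<nu> j + (N - 1 - j))"
          by (simp only: power_Suc) simp
      qed
      then show ?thesis by (simp only: dt_scale_rows)
    qed
    then show ?thesis by (simp add: dt_laplace mult_ac)
  qed
  have S: "Abs_fps (\<lambda>d. \<Sum>\<nu>\<in>even_parts N d. dt (Suc N) (\<lambda>i j. z i ^ (\<nu> j + (N - j)))) =
      (\<Sum>k\<le>N. fps_const (?c k) * lw_sum N (?zz k))"
  proof (rule fps_ext)
    fix d
    have "dt (Suc N) (\<lambda>i j. z i ^ (\<nu> j + (N - j))) =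
        (\<Sum>k\<le>N. ?c k * dt N (\<lambda>i j. ?zz k i ^ (\<nu> j + (N - 1 - j))))" if "\<nu> \<in> even_parts N d" for \<nu>
    proof -
      have "dt (Suc N) (\<lambda>i j. z i ^ (\<nu> j + (N - j))) = dt (Suc N) (\<lambda>i j. z i ^ (if j = N then 0 else \<nu> j + (N - j)))"
        using that by (intro dt_cong) (auto simp: even_parts_def)
      then show ?thesis by (simp only: laplace) simp
    qed
    then show "fps_nth (Abs_fps (\<lambda>d. \<Sum>\<nu>\<in>even_parts N d. dt (Suc N) (\<lambda>i j. z i ^ (\<nu> j + (N - j))))) d =
        fps_nth (\<Sum>k\<le>N. fps_const (?c k) * lw_sum N (?zz k)) d"
      by (simp add: fps_sum_nth lw_sum_def sum_distrib_left sum.swap[of _ "{..N}"])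
  qed
  have R0: "?R 0 = ?V" by (intro dt_cong) auto
  have Rmid: "?R r = 0" if "0 < r" "r \<le> N" for r
    by (rule dt_equal_columns[of N _ "N - r"]) (use that in auto)
  \<comment> \<open>With the last column moved to the front the exponents are
    \<open>N + 1, N, ..., 1\<close>, and one factor \<open>z i\<close> splits off from each
    row.\<close>
  have Rtop: "?R (Suc N) = (- 1) ^ N * (?Z * ?V)"
  proof -
    have "(- 1) ^ N * ?R (Suc N) =
        dt (Suc N) (\<lambda>i j. case j of 0 \<Rightarrow> z i ^ Suc N | Suc j' \<Rightarrow> z i ^ (if j' = N then Suc N else N - j'))"
      by (subst dt_move_last_column[symmetric]) simp
    also have "\<dots> = dt (Suc N) (\<lambda>i j. z i * z i ^ (N - j))"
      by (rule dt_cong) (auto split: nat.splits simp: Suc_diff_Suc simp flip: power_Suc)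
    also have "\<dots> = ?Z * ?V" by (rule dt_scale_rows)
    finally have "(- 1) ^ N * ((- 1) ^ N * ?R (Suc N)) = (- 1) ^ N * (?Z * ?V)" by simp
    then show ?thesis by (simp add: mult.assoc[symmetric] power_add[symmetric] mult_2[symmetric])
  qed
  have "lw_prod (Suc N) z * Abs_fps (\<lambda>d. \<Sum>\<nu>\<in>even_parts N d. dt (Suc N) (\<lambda>i j. z i ^ (\<nu> j + (N - j)))) =
      (\<Sum>k\<le>N. fps_const (?c k) * (lw_prod (Suc N) z * lw_sum N (?zz k)))"
    unfolding S by (simp add: sum_distrib_left mult_ac)
  also have "\<dots> = (\<Sum>k\<le>N. \<Sum>r\<le>Suc N. (fps_const (esym (Suc N) z r) * (- fps_X) ^ r) *
      fps_const (?c k * z k ^ r * dt N (\<lambda>i j. ?zz k i ^ (N - 1 - j))))"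
  proof (rule sum.cong[OF refl])
    fix k assume k: "k \<in> {..N}"
    have "(\<Prod>j<Suc N. 1 - fps_const (z k * z j) * fps_X) =
        (\<Prod>j<Suc N. 1 + fps_const (z j) * (fps_const (z k) * (- fps_X)))"
      by (rule prod.cong) (auto simp: fps_const_mult[symmetric] mult_ac simp del: fps_const_mult)
    also have "\<dots> = (\<Sum>r\<le>Suc N. esym (Suc N) (\<lambda>j. fps_const (z j)) r * (fps_const (z k) * (- fps_X)) ^ r)"
      by (rule prod_one_plus_esym)
    also have "\<dots> = (\<Sum>r\<le>Suc N. fps_const (esym (Suc N) z r * z k ^ r) * (- fps_X) ^ r)"
    proof (rule sum.cong[OF refl])
      fix r
      have p: "(\<Prod>i\<in>S. fps_const (z i)) = fps_const (\<Prod>i\<in>S. z i)" for S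
        by (induction S rule: infinite_finite_induct) auto
      have s: "(\<Sum>S\<in>A. fps_const (\<Prod>i\<in>S. z i)) = fps_const (\<Sum>S\<in>A. \<Prod>i\<in>S. z i)" for A
        by (induction A rule: infinite_finite_induct) auto
      show "esym (Suc N) (\<lambda>j. fps_const (z j)) r * (fps_const (z k) * (- fps_X)) ^ r =
          fps_const (esym (Suc N) z r * z k ^ r) * (- fps_X) ^ r"
        unfolding esym_def p s power_mult_distrib fps_const_power fps_const_mult[symmetric] by (simp only: mult_ac)
    qed
    finally have pr: "(\<Prod>j<Suc N. 1 - fps_const (z k * z j) * fps_X) =
        (\<Sum>r\<le>Suc N. fps_const (esym (Suc N) z r * z k ^ r) * (- fps_X) ^ r)" .
    have "lw_prod (Suc N) z * lw_sum N (?zz k) =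
        (\<Prod>j<Suc N. 1 - fps_const (z k * z j) * fps_X) * (lw_prod N (?zz k) * lw_sum N (?zz k))"
      using k by (subst lw_prod_Suc[of k]) (simp_all only: atMost_iff mult_ac)
    also have "\<dots> = (\<Sum>r\<le>Suc N. fps_const (esym (Suc N) z r * z k ^ r) * (- fps_X) ^ r) *
        fps_const (dt N (\<lambda>i j. ?zz k i ^ (N - 1 - j)))"
      by (simp only: pr Suc.IH)
    finally show "fps_const (?c k) * (lw_prod (Suc N) z * lw_sum N (?zz k)) = 
        (\<Sum>r\<le>Suc N. (fps_const (esym (Suc N) z r) * (- fps_X) ^ r) *
          fps_const (?c k * z k ^ r * dt N (\<lambda>i j. ?zz k i ^ (N - 1 - j))))"
      by (simp only: sum_distrib_left sum_distrib_right fps_const_mult[symmetric] mult_ac)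
  qed
  also have "\<dots> = (\<Sum>r\<le>Suc N. (fps_const (esym (Suc N) z r) * (- fps_X) ^ r) * fps_const (?R r))"
  proof -
    have "?R r = (\<Sum>k\<le>N. ?c k * z k ^ r * dt N (\<lambda>i j. ?zz k i ^ (N - 1 - j)))" for r
      using laplace[of r "\<lambda>_. 0", unfolded add_0] .
    moreover have "fps_const (\<Sum>k\<le>N. g k) = (\<Sum>k\<le>N. fps_const (g k))" for g :: "nat \<Rightarrow> 'a"
      by (simp add: fps_eq_iff fps_sum_nth)
    ultimately show ?thesis
      by (subst sum.swap) (simp only: sum_distrib_left)
  qed
  also have "\<dots> = fps_const ?V + fps_const ?Z * (- fps_X) ^ Suc N * fps_const (?R (Suc N))"
  proof -
    have "(\<Sum>r\<le>N. (fps_const (esym (Suc N) z r) * (- fps_X) ^ r) * fps_const (?R r)) =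
        (\<Sum>r\<in>{0}. (fps_const (esym (Suc N) z r) * (- fps_X) ^ r) * fps_const (?R r))"
      by (rule sum.mono_neutral_right) (auto simp: Rmid)
    also have "\<dots> = fps_const ?V" using R0 by (simp add: esym_0)
    finally show ?thesis
      by (simp only: sum.atMost_Suc esym_top)
  qed
  also have "\<dots> = (1 - fps_const (?Z ^ 2) * fps_X ^ Suc N) * fps_const ?V"
  proof -
    have "(- fps_X) ^ Suc N = (- 1 :: 'a fps) ^ Suc N * fps_X ^ Suc N"
      by (simp only: power_mult_distrib[symmetric]) simp
    moreover have "fps_const (?R (Suc N)) = (- 1) ^ N * (fps_const ?Z * fps_const ?V)"
    proof -
      have "fps_const ((- 1 :: 'a) ^ N) = (- 1) ^ N"
        by (simp only: fps_const_power[symmetric] fps_const_neg[symmetric] fps_const_1_eq_1)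
      then show ?thesis unfolding Rtop by (simp only: fps_const_mult[symmetric])
    qed
    moreover have "(- 1 :: 'a fps) ^ N * (- 1) ^ N = 1"
      by (simp only: power_mult_distrib[symmetric]) simp
    moreover have "v + a * ((- 1) * e * x) * (e * (a * v)) = (1 - a * a * x) * v"
      if "e * e = 1" for a e x v :: "'a fps"
    proof -
      have "a * ((- 1) * e * x) * (e * (a * v)) = - (e * e) * (a * a * x * v)"
        by (simp add: mult_ac)
      then show ?thesis unfolding that by (simp add: algebra_simps)
    qed
    ultimately show ?thesis
      by (simp only: power2_eq_square fps_const_mult[symmetric] power_Suc[of "- 1"])
  qed
  finally have "(1 - fps_const (?Z ^ 2) * fps_X ^ Suc N) * (lw_prod (Suc N) z * lw_sum (Suc N) z) =
      (1 - fps_const (?Z ^ 2) * fps_X ^ Suc N) * fps_const ?V"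
    unfolding lw_sum_Suc[symmetric] by (simp only: mult_ac)
  from fps_one_minus_cancel[OF this] show ?case by simp
qed

section \<open>The symplectic dual Jacobi--Trudi identity\<close>

lemma dt_block':
  assumes "\<And>i j. j < n \<Longrightarrow> n \<le> i \<Longrightarrow> i < n + m \<Longrightarrow> f i j = 0"
  shows "dt (n + m) f = dt n f * dt m (\<lambda>i j. f (n + i) (n + j))"
proof -
  have "dt (n + m) (\<lambda>i j. f j i) = dt n (\<lambda>i j. f j i) * dt m (\<lambda>i j. f (n + j) (n + i))"
    by (rule dt_block) (use assms in auto)
  then show ?thesis by (simp only: dt_transpose[of _ f] dt_transpose[of m "\<lambda>i j. f (n + i) (n + j)"])
qed

lemma prod_interleave:
  assumes "\<And>i. i < n \<Longrightarrow> x i * x' i = 1"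
  shows "(\<Prod>k<2 * n. interleave x x' k) = (1 :: 'a::comm_ring_1)"
  unfolding prod_lessThan_double using assms by simp

text \<open>The set of variables is closed under inversion and their product is 1. \<open>?B\<close>
  takes the complement of \<open>S\<close> and then exchanges every variable with its inverse; this
  preserves the monomial and turns size \<open>r\<close> into \<open>2 * n - r\<close>.\<close>

lemma esym_interleave:
  assumes inv: "\<And>i. i < n \<Longrightarrow> x i * x' i = (1 :: 'a::comm_ring_1)" and r: "r \<le> 2 * n"
  shows "esym (2 * n) (interleave x x') (2 * n - r) = esym (2 * n) (interleave x x') r"
proof -
  let ?z = "interleave x x'" and ?w = "interleave x' x" and ?U = "{..<2 * n}"
  define t where "t = (\<lambda>j::nat. if even j then Suc j else j - 1)"
  let ?B = "\<lambda>S. t ` (?U - S)"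
  have tt: "t (t j) = j" for j by (auto simp: t_def)
  have t_lt: "t j < 2 * n \<longleftrightarrow> j < 2 * n" for j by (auto simp: t_def elim!: evenE oddE)
  have inj: "inj_on t S" for S by (rule inj_on_inverseI[of _ t]) (rule tt)
  have zt: "?z (t j) = ?w j" for j
    by (auto simp: t_def interleave_def elim!: evenE oddE)
  have zw: "?z j * ?w j = 1" if "j < 2 * n" for j
    using inv[of "j div 2"] that by (auto simp: interleave_def mult.commute)
  have BB: "?B (?B S) = S" if "S \<subseteq> ?U" for S
  proof -
    have tU: "t ` ?U = ?U"
    proof
      show "t ` ?U \<subseteq> ?U" using t_lt by auto
      show "?U \<subseteq> t ` ?U"
      proof
        fix j assume "j \<in> ?U"
        then have "t j \<in> ?U" using t_lt[of j] by simp
        then show "j \<in> t ` ?U" by (metis tt image_eqI)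
      qed
    qed
    have "?B (?B S) = t ` (?U - (t ` ?U - t ` S))"
      by (simp only: image_set_diff[OF inj[of UNIV]])
    also have "\<dots> = t ` ?U - (t ` t ` ?U - t ` t ` S)"
      by (simp only: image_set_diff[OF inj[of UNIV]])
    also have "t ` t ` A = A" for A by (simp only: image_image tt image_ident)
    finally show ?thesis using that by (simp only: tU) blast
  qed
  have sub: "?B S \<subseteq> ?U" for S using t_lt by auto
  have card: "card (?B S) = 2 * n - card S" if "S \<subseteq> ?U" for S
    using that by (simp add: card_image inj card_Diff_subset finite_subset)
  have prodB: "(\<Prod>i\<in>?B S. ?z i) = (\<Prod>i\<in>S. ?z i)" if S: "S \<subseteq> ?U" for S
  proof -
    have "(\<Prod>i\<in>?B S. ?z i) = (\<Prod>i\<in>?U - S. ?w i)"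
      by (subst prod.reindex[OF inj]) (simp add: o_def zt)
    also have "\<dots> = (\<Prod>i\<in>?U - S. ?w i) * (\<Prod>k<2 * n. ?z k)"
      using prod_interleave[OF inv] by simp
    also have "(\<Prod>k<2 * n. ?z k) = (\<Prod>i\<in>?U - S. ?z i) * (\<Prod>i\<in>S. ?z i)"
      by (rule prod.subset_diff[OF S]) simp
    also have "(\<Prod>i\<in>?U - S. ?w i) * ((\<Prod>i\<in>?U - S. ?z i) * (\<Prod>i\<in>S. ?z i)) =
        (\<Prod>i\<in>?U - S. ?z i * ?w i) * (\<Prod>i\<in>S. ?z i)"
      by (simp add: prod.distrib mult_ac)
    also have "(\<Prod>i\<in>?U - S. ?z i * ?w i) = 1"
      by (rule prod.neutral) (use zw in auto)
    finally show ?thesis by simp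
  qed
  show ?thesis
    unfolding esym_def
  proof (rule sum.reindex_bij_witness[of _ ?B ?B])
    fix S assume "S \<in> {S. S \<subseteq> ?U \<and> card S = 2 * n - r}"
    then have S: "S \<subseteq> ?U" "card S = 2 * n - r" by auto
    show "?B (?B S) = S" by (rule BB[OF S(1)])
    show "?B S \<in> {S. S \<subseteq> ?U \<and> card S = r}" using sub card[OF S(1)] S r by simp
    show "(\<Prod>i\<in>?B S. ?z i) = (\<Prod>i\<in>S. ?z i)" by (rule prodB[OF S(1)])
  next
    fix S assume "S \<in> {S. S \<subseteq> ?U \<and> card S = r}"
    then have S: "S \<subseteq> ?U" "card S = r" by auto
    show "?B (?B S) = S" by (rule BB[OF S(1)])
    show "?B S \<in> {S. S \<subseteq> ?U \<and> card S = 2 * n - r}" using sub card[OF S(1)] S r by simp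
  qed
qed

text \<open>Coefficients of the product of all \<open>1 - z i * w\<close>, continued by 0 to all
  integers so that the indices of the Jacobi--Trudi determinant need no case distinction.\<close>

definition sesym :: "nat \<Rightarrow> (nat \<Rightarrow> 'a::comm_ring_1) \<Rightarrow> int \<Rightarrow> 'a" where
  "sesym M z k = (if 0 \<le> k \<and> k \<le> int M then (- 1) ^ nat k * esym M z (nat k) else 0)"

lemma sesym_interleave:
  assumes inv: "\<And>i. i < n \<Longrightarrow> x i * x' i = (1 :: 'a::comm_ring_1)"
  shows "sesym (2 * n) (interleave x x') (2 * int n - k) = sesym (2 * n) (interleave x x') k"
proof (cases "0 \<le> k \<and> k \<le> 2 * int n")
  case True
  then obtain r where r: "k = int r" "r \<le> 2 * n"
    by (metis nat_0_le of_nat_le_iff of_nat_mult of_nat_numeral)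
  have "(- 1 :: 'a) ^ (2 * n - r) = (- 1) ^ r"
    using r(2) by (intro minus_one_power_iff[THEN trans] ) (auto simp: minus_one_power_iff)
  moreover have "nat (2 * int n - k) = 2 * n - r" using r by simp
  moreover have "0 \<le> 2 * int n - k \<and> 2 * int n - k \<le> int (2 * n)" using r by simp
  ultimately show ?thesis
    using esym_interleave[OF inv, of n "\<lambda>_. _" r] esym_interleave[of n x x' r, OF inv r(2)] r
    by (simp add: sesym_def)
qed (auto simp: sesym_def)

text \<open>The sum is the value at \<open>w = x i\<close> of the product of all
  \<open>1 - z j * w\<close>, and the factor of the variable \<open>x' i\<close> vanishes
  there.\<close>

lemma sum_sesym_zero:
  assumes inv: "\<And>i. i < n \<Longrightarrow> x i * x' i = (1 :: 'a::comm_ring_1)" and "i < n"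
  shows "(\<Sum>r\<le>2 * n. (- 1) ^ r * esym (2 * n) (interleave x x') r * x i ^ r) = 0"
proof -
  have "(\<Sum>r\<le>2 * n. (- 1) ^ r * esym (2 * n) (interleave x x') r * x i ^ r) =
      (\<Prod>j<2 * n. 1 + interleave x x' j * (- x i))"
    unfolding prod_one_plus_esym
    by (rule sum.cong) (auto simp: power_minus[of "x i"] mult_ac)
  also have "\<dots> = 0"
    by (rule prod_zero) (use assms in \<open>auto intro!: bexI[of _ "Suc (2 * i)"] simp: mult.commute\<close>)
  finally show ?thesis .
qed

definition ipow :: "'a::comm_ring_1 \<Rightarrow> 'a \<Rightarrow> int \<Rightarrow> 'a" where
  "ipow x x' a = (if 0 \<le> a then x ^ nat a else x' ^ nat (- a))"

lemma ipow_add_nat: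
  assumes "x * x' = (1 :: 'a::comm_ring_1)"
  shows "ipow x x' (a + int k) = ipow x x' a * x ^ k"
proof (induction k)
  case 0
  then show ?case by simp
next
  case (Suc k)
  have "ipow x x' (b + 1) = ipow x x' b * x" for b
  proof (cases "0 \<le> b")
    case True
    then show ?thesis by (simp add: ipow_def nat_add_distrib)
  next
    case False
    then have "nat (- b) = Suc (nat (- b - 1))" by simp
    then have "x' ^ nat (- b) = x' * x' ^ nat (- b - 1)" by simp
    then have "x' ^ nat (- b) * x = (x * x') * x' ^ nat (- b - 1)" by (simp add: mult_ac)
    moreover have "b + 1 \<ge> 0 \<Longrightarrow> nat (- b - 1) = 0 \<and> nat (b + 1) = 0" using False by simp
    moreover have "- (b + 1) = - b - 1" by simp
    ultimately show ?thesis using False assms by (auto simp: ipow_def)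
  qed
  from this[of "a + int k"] Suc show ?case by (simp add: add.assoc mult_ac) (simp add: add.commute)
qed

lemma sum_symmetric_int:
  fixes f :: "int \<Rightarrow> 'a::comm_ring_1"
  shows "(\<Sum>a\<in>{- int M..int M}. f a) = f 0 + (\<Sum>a<M. f (int (Suc a)) + f (- int (Suc a)))"
proof (induction M)
  case 0
  then show ?case by simp
next
  case (Suc M)
  have "{- int (Suc M)..int (Suc M)} = insert (int (Suc M)) (insert (- int (Suc M)) {- int M..int M})"
    by auto
  then have "(\<Sum>a\<in>{- int (Suc M)..int (Suc M)}. f a) =
      f (int (Suc M)) + (f (- int (Suc M)) + (\<Sum>a\<in>{- int M..int M}. f a))"
    by (simp only:) (subst sum.insert; auto)+
  then show ?case unfolding Suc by (simp add: algebra_simps)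
qed

lemma jacobi_trudi_column_zero:
  assumes inv: "\<And>i. i < n \<Longrightarrow> x i * x' i = (1 :: 'a::comm_ring_1)" and i: "i < n" and b: "b < m"
  defines "g \<equiv> sesym (2 * n) (interleave x x')"
  shows "(\<Sum>a<n + m. (x i ^ Suc a - x' i ^ Suc a) *
    (g (int n + int (Suc a) - int (Suc b)) - g (int n + int (Suc a) + int (Suc b)))) = 0"
proof -
  let ?M = "n + m" and ?p = "ipow (x i) (x' i)"
  define c where "c = (\<lambda>a. g (int n + a + - int (Suc b)) - g (int n + a + int (Suc b)))"
  have gsym: "g (2 * int n - k) = g k" for k
    unfolding g_def by (rule sesym_interleave) (rule inv)
  have c_anti: "c (- a) = - c a" for a
    using gsym[of "int n + a + int (Suc b)"] gsym[of "int n + a - int (Suc b)"]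
    by (simp add: c_def algebra_simps)
  have c0: "c 0 = 0" using gsym[of "int n + int (Suc b)"] by (simp add: c_def algebra_simps)
  \<comment> \<open>Nonzero summands have \<open>a = r - n - s\<close> with
    \<open>r \<le> 2 * n\<close>; the bounds on \<open>s\<close> place all of these inside the
    window.\<close>
  have window: "(\<Sum>a\<in>{- int ?M..int ?M}. ?p a * g (int n + a + s)) = 0" if s: "- int m \<le> s" "s \<le> int m" for s
  proof -
    have "(\<Sum>a\<in>{- int ?M..int ?M}. ?p a * g (int n + a + s)) =
        (\<Sum>a\<in>(\<lambda>r. int r - int n - s) ` {..2 * n}. ?p a * g (int n + a + s))"
    proof (rule sum.mono_neutral_right)
      show "\<forall>a\<in>{- int ?M..int ?M} - (\<lambda>r. int r - int n - s) ` {..2 * n}. ?p a * g (int n + a + s) = 0"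
      proof
        fix a assume a: "a \<in> {- int ?M..int ?M} - (\<lambda>r. int r - int n - s) ` {..2 * n}"
        have "\<not> (0 \<le> int n + a + s \<and> int n + a + s \<le> int (2 * n))"
        proof
          assume "0 \<le> int n + a + s \<and> int n + a + s \<le> int (2 * n)"
          then have "a = int (nat (int n + a + s)) - int n - s" "nat (int n + a + s) \<in> {..2 * n}" by auto
          then show False using a by blast
        qed
        then show "?p a * g (int n + a + s) = 0" by (auto simp: g_def sesym_def)
      qed
    qed (use s in auto)
    also have "\<dots> = (\<Sum>r\<le>2 * n. ?p (int r - int n - s) * g (int r))"
      by (subst sum.reindex) (auto simp: inj_on_def algebra_simps)
    also have "\<dots> = (\<Sum>r\<le>2 * n. ?p (- int n - s) * ((- 1) ^ r * esym (2 * n) (interleave x x') r * x i ^ r))"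
    proof (rule sum.cong[OF refl])
      fix r assume "r \<in> {..2 * n}"
      moreover have "?p (int r - int n - s) = ?p (- int n - s) * x i ^ r"
        using ipow_add_nat[OF inv[OF i], of "- int n - s" r] by (simp add: algebra_simps)
      ultimately show "?p (int r - int n - s) * g (int r) =
          ?p (- int n - s) * ((- 1) ^ r * esym (2 * n) (interleave x x') r * x i ^ r)"
        by (simp add: g_def sesym_def mult_ac)
    qed
    also have "\<dots> = 0"
      unfolding sum_distrib_left[symmetric] using sum_sesym_zero[of n x x' i, OF inv i] by simp
    finally show ?thesis .
  qed
  have sb: "- int m \<le> - int (Suc b)" "- int (Suc b) \<le> int m" "- int m \<le> int (Suc b)" "int (Suc b) \<le> int m"
    using b by auto
  have "(\<Sum>a\<in>{- int ?M..int ?M}. ?p a * c a) = 0"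
    unfolding c_def right_diff_distrib sum_subtractf
    by (simp only: window[OF sb(1,2)] window[OF sb(3,4)] diff_zero)
  then have "0 = (\<Sum>a\<in>{- int ?M..int ?M}. ?p a * c a)" ..
  also have "\<dots> = (\<Sum>a<?M. ?p (int (Suc a)) * c (int (Suc a)) + ?p (- int (Suc a)) * c (- int (Suc a)))"
    unfolding sum_symmetric_int c0 by simp
  also have "\<dots> = (\<Sum>a<?M. (x i ^ Suc a - x' i ^ Suc a) * c (int (Suc a)))"
    by (rule sum.cong[OF refl]) (simp only: c_anti, simp add: ipow_def left_diff_distrib nat_add_distrib)
  finally show ?thesis by (simp only: c_def) simp
qed

text \<open>A minor of a product with a unitriangular matrix is traded for the complementary minor.
  The first \<open>n\<close> values of \<open>p\<close> are the exponents of the alternant, the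
  remaining \<open>m\<close> values label the rows of the dual determinant.\<close>

theorem symplectic_jacobi_trudi:
  assumes inv: "\<And>i. i < n \<Longrightarrow> x i * x' i = (1 :: 'a::comm_ring_1)" and p: "p permutes {..<n + m}"
  defines "g \<equiv> sesym (2 * n) (interleave x x')"
  shows "of_int (sign p) * dt n (\<lambda>i j. x i ^ Suc (p j) - x' i ^ Suc (p j)) =
    dt n (\<lambda>i j. x i ^ Suc j - x' i ^ Suc j) *
    dt m (\<lambda>k b. g (int n + int (Suc b) - int (Suc (p (n + k)))) - g (int n + int (Suc b) + int (Suc (p (n + k)))))"
proof -
  \<comment> \<open>\<open>P\<close> carries the alternant rows on top and unit vectors at the
    complementary columns below. \<open>C\<close> is unitriangular, and its columns from
    \<open>n\<close> on annihilate the alternant rows by \<open>jacobi_trudi_column_zero\<close>, so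
    that the product is block triangular.\<close>
  define P where "P = (\<lambda>i a. if i < n then x i ^ Suc a - x' i ^ Suc a else of_bool (a = p i))"
  define C where "C = (\<lambda>a j. if j < n then of_bool (a = j)
    else g (int n + int (Suc a) - int (Suc (j - n))) - g (int n + int (Suc a) + int (Suc (j - n))))"
  have gsym: "g (2 * int n - k) = g k" for k
    unfolding g_def by (rule sesym_interleave) (rule inv)
  have p_lt: "p j < n + m" if "j < n + m" for j
    using permutes_in_image[OF p, of j] that by simp
  have p_inj: "p i = p j \<longleftrightarrow> i = j" for i j
    using permutes_inj[OF p] by (auto simp: inj_def)
  have "of_int (sign p) * dt (n + m) P = dt (n + m) (\<lambda>i j. P i (p j))"
    by (rule dt_permute_columns[OF p, symmetric])
  also have "\<dots> = dt n (\<lambda>i j. P i (p j)) * dt m (\<lambda>i j. P (n + i) (p (n + j)))"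
    by (rule dt_block') (auto simp: P_def p_inj)
  also have "dt n (\<lambda>i j. P i (p j)) = dt n (\<lambda>i j. x i ^ Suc (p j) - x' i ^ Suc (p j))"
    by (rule dt_cong) (simp add: P_def)
  also have "dt m (\<lambda>i j. P (n + i) (p (n + j))) = 1"
    by (subst dt_upper_triangular) (auto simp: P_def p_inj)
  finally have P: "of_int (sign p) * dt (n + m) P = dt n (\<lambda>i j. x i ^ Suc (p j) - x' i ^ Suc (p j))"
    by simp
  have C: "dt (n + m) C = 1"
  proof (subst dt_upper_triangular)
    fix a j assume "j < a" "a < n + m"
    then show "C a j = 0" by (auto simp: C_def g_def sesym_def)
  next
    \<comment> \<open>For \<open>a \<ge> n\<close> the first term is \<open>g (2 * int n)\<close>,
      the product of all variables, and the index of the second exceeds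
      \<open>2 * n\<close>.\<close>
    have "C a a = 1" for a
      using prod_interleave[OF inv] by (auto simp: C_def g_def sesym_def esym_top nat_mult_distrib)
    then show "(\<Prod>i<n + m. C i i) = 1" by simp
  qed
  have "dt (n + m) P * dt (n + m) C = dt (n + m) (\<lambda>i j. \<Sum>a<n + m. P i a * C a j)"
    by (rule dt_mult)
  also have "\<dots> = dt n (\<lambda>i j. \<Sum>a<n + m. P i a * C a j) * dt m (\<lambda>k b. \<Sum>a<n + m. P (n + k) a * C a (n + b))"
  proof (rule dt_block)
    fix i j assume "i < n" "n \<le> j" "j < n + m"
    then have "(\<Sum>a<n + m. P i a * C a j) = (\<Sum>a<n + m. (x i ^ Suc a - x' i ^ Suc a) *
        (g (int n + int (Suc a) - int (Suc (j - n))) - g (int n + int (Suc a) + int (Suc (j - n)))))"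
      by (intro sum.cong) (auto simp: P_def C_def)
    also have "\<dots> = 0"
      unfolding g_def
      by (rule jacobi_trudi_column_zero) (use inv \<open>i < n\<close> \<open>n \<le> j\<close> \<open>j < n + m\<close> in auto)
    finally show "(\<Sum>a<n + m. P i a * C a j) = 0" .
  qed
  also have "dt n (\<lambda>i j. \<Sum>a<n + m. P i a * C a j) = dt n (\<lambda>i j. x i ^ Suc j - x' i ^ Suc j)"
  proof (rule dt_cong)
    fix i j assume "i < n" "j < n"
    have "(\<Sum>a<n + m. P i a * C a j) = (\<Sum>a<n + m. if a = j then P i a else 0)"
      by (rule sum.cong) (use \<open>j < n\<close> in \<open>auto simp: C_def\<close>)
    then show "(\<Sum>a<n + m. P i a * C a j) = x i ^ Suc j - x' i ^ Suc j"
      using \<open>i < n\<close> \<open>j < n\<close> by (simp add: P_def)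
  qed
  also have "dt m (\<lambda>k b. \<Sum>a<n + m. P (n + k) a * C a (n + b)) =
      dt m (\<lambda>k b. g (int n + int (Suc b) - int (Suc (p (n + k)))) - g (int n + int (Suc b) + int (Suc (p (n + k)))))"
  proof (rule dt_cong)
    fix k b assume "k < m" "b < m"
    have "(\<Sum>a<n + m. P (n + k) a * C a (n + b)) = (\<Sum>a<n + m. if a = p (n + k) then C a (n + b) else 0)"
      by (rule sum.cong) (auto simp: P_def)
    also have "\<dots> = C (p (n + k)) (n + b)" using p_lt[of "n + k"] \<open>k < m\<close> by simp
    also have "\<dots> = g (int n + int (Suc b) - int (Suc (p (n + k)))) - g (int n + int (Suc b) + int (Suc (p (n + k))))"
      using gsym[of "int n + int (Suc b) - int (Suc (p (n + k)))"] by (simp add: C_def algebra_simps)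
    finally show "(\<Sum>a<n + m. P (n + k) a * C a (n + b)) =
      g (int n + int (Suc b) - int (Suc (p (n + k)))) - g (int n + int (Suc b) + int (Suc (p (n + k))))" .
  qed
  finally have M: "dt (n + m) P = dt n (\<lambda>i j. x i ^ Suc j - x' i ^ Suc j) *
    dt m (\<lambda>k b. g (int n + int (Suc b) - int (Suc (p (n + k)))) - g (int n + int (Suc b) + int (Suc (p (n + k)))))"
    by (simp add: C)
  have "dt (n + m) P = of_int (sign p * sign p) * dt (n + m) P"
    by (simp only: sign_idempotent) simp
  also have "\<dots> = of_int (sign p) * (of_int (sign p) * dt (n + m) P)"
    by (simp only: of_int_mult mult.assoc)
  finally have "dt (n + m) P = of_int (sign p) * dt n (\<lambda>i j. x i ^ Suc (p j) - x' i ^ Suc (p j))"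
    unfolding P .
  with M show ?thesis by simp
qed

section \<open>Chains of vertical strips\<close>

lemma fps_const_sum: "fps_const (\<Sum>i\<in>A. f i) = (\<Sum>i\<in>A. fps_const (f i))"
  by (simp add: fps_eq_iff fps_sum_nth)

lemma fps_const_prod: "fps_const (\<Prod>i\<in>A. f i :: 'a::comm_ring_1) = (\<Prod>i\<in>A. fps_const (f i))"
  by (induction A rule: infinite_finite_induct) (auto simp: fps_const_mult[symmetric] simp del: fps_const_mult)

lemma fps_const_of_int: "fps_const (of_int k :: 'a::comm_ring_1) = of_int k"
  by (simp add: fps_of_int)

lemma dt_fps_const: "dt n (\<lambda>i j. fps_const (f i j)) = fps_const (dt n f)"
  by (simp add: dt_leibniz fps_const_sum fps_const_prod fps_const_of_int fps_const_mult[symmetric] del: fps_const_mult)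

lemma dt_scale_columns: "dt n (\<lambda>i j. c j * f i j) = (\<Prod>j<n. c j) * dt n f"
  by (simp add: dt_leibniz' prod.distrib sum_distrib_left mult_ac)

text \<open>Pieri's rule before partitions are singled out: row \<open>i\<close> is multiplied by
  \<open>1 + z i * X\<close>, every column splits in two, and the coefficients of
  \<open>X ^ k\<close> are compared.\<close>

lemma esym_mult_alternant:
  "esym N z k * dt N (\<lambda>i j. z i ^ l j) =
    (\<Sum>S | S \<subseteq> {..<N} \<and> card S = k. dt N (\<lambda>i j. z i ^ (l j + of_bool (j \<in> S))))"
proof -
  let ?D = "\<lambda>S. dt N (\<lambda>i j. z i ^ (l j + of_bool (j \<in> S)))"
  let ?c = "\<lambda>i. fps_const (z i)"
  have "(\<Sum>r\<le>N. fps_const (esym N z r) * fps_X ^ r) * fps_const (dt N (\<lambda>i j. z i ^ l j)) =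
      (\<Prod>i<N. 1 + ?c i * fps_X) * dt N (\<lambda>i j. ?c i ^ l j)"
  proof -
    have "esym N ?c r = fps_const (esym N z r)" for r
      by (simp add: esym_def fps_const_sum fps_const_prod)
    then show ?thesis
      unfolding prod_one_plus_esym by (simp add: dt_fps_const fps_const_power)
  qed
  also have "\<dots> = dt N (\<lambda>i j. ?c i ^ l j + fps_X * ?c i ^ Suc (l j))"
    unfolding dt_scale_rows[symmetric] by (rule dt_cong) (simp add: algebra_simps)
  also have "\<dots> = (\<Sum>S\<in>Pow {..<N}. fps_X ^ card S * fps_const (?D S))"
    unfolding dt_add_columns
  proof (rule sum.cong[OF refl])
    fix S assume S: "S \<in> Pow {..<N}"
    have "dt N (\<lambda>i j. if j \<in> S then fps_X * ?c i ^ Suc (l j) else ?c i ^ l j) =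
        dt N (\<lambda>i j. (if j \<in> S then fps_X else 1) * fps_const (z i ^ (l j + of_bool (j \<in> S))))"
      by (rule dt_cong) (simp add: fps_const_power)
    also have "\<dots> = (\<Prod>j<N. if j \<in> S then fps_X else 1) * fps_const (?D S)"
      unfolding dt_scale_columns dt_fps_const ..
    also have "(\<Prod>j<N. if j \<in> S then fps_X else 1) = (\<Prod>j\<in>S. fps_X :: 'a fps)"
      by (rule prod.mono_neutral_cong_right) (use S in auto)
    finally show "dt N (\<lambda>i j. if j \<in> S then fps_X * ?c i ^ Suc (l j) else ?c i ^ l j) =
        fps_X ^ card S * fps_const (?D S)" by simp
  qed
  finally have "fps_nth ((\<Sum>r\<le>N. fps_const (esym N z r) * fps_X ^ r) * fps_const (dt N (\<lambda>i j. z i ^ l j))) k =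
      fps_nth (\<Sum>S\<in>Pow {..<N}. fps_X ^ card S * fps_const (?D S)) k" by simp
  also have "fps_nth (\<Sum>S\<in>Pow {..<N}. fps_X ^ card S * fps_const (?D S)) k =
      (\<Sum>S\<in>Pow {..<N}. if card S = k then ?D S else 0)"
    by (simp only: fps_sum_nth fps_mult_right_const_nth fps_X_power_nth) (rule sum.cong; auto)
  also have "\<dots> = (\<Sum>S | S \<subseteq> {..<N} \<and> card S = k. ?D S)"
    by (rule sum.mono_neutral_cong_right) auto
  also have "fps_nth ((\<Sum>r\<le>N. fps_const (esym N z r) * fps_X ^ r) * fps_const (dt N (\<lambda>i j. z i ^ l j))) k =
      (\<Sum>r\<le>N. if r = k then esym N z r else 0) * dt N (\<lambda>i j. z i ^ l j)"
    by (simp only: fps_mult_right_const_nth fps_sum_nth fps_mult_left_const_nth fps_X_power_nth)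
       (rule arg_cong2[where f = "(*)"]; (rule sum.cong)?; auto)
  also have "(\<Sum>r\<le>N. if r = k then esym N z r else 0) = esym N z k"
  proof (cases "k \<le> N")
    case False
    have "card S \<le> N" if "S \<subseteq> {..<N}" for S
      using card_mono[of "{..<N}" S] that by simp
    then have e: "{S. S \<subseteq> {..<N} \<and> card S = k} = {}" using False by auto
    have "esym N z k = 0" unfolding esym_def e by simp
    then show ?thesis using False by simp
  qed simp
  finally show ?thesis .
qed

definition parts :: "nat \<Rightarrow> (nat \<Rightarrow> nat) \<Rightarrow> bool" where
  "parts N \<nu> \<longleftrightarrow> (\<forall>i. \<nu> (Suc i) \<le> \<nu> i) \<and> (\<forall>i\<ge>N. \<nu> i = 0)"

text \<open>\<open>\<mu>\<close> arises from \<open>\<nu>\<close> by adding a vertical strip. Only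
  \<open>\<mu>\<close> is required to be a partition; in a chain the smaller member gets this
  property from the next step, the last one by hypothesis.\<close>

definition vstep :: "nat \<Rightarrow> (nat \<Rightarrow> nat) \<Rightarrow> (nat \<Rightarrow> nat) \<Rightarrow> bool" where
  "vstep N \<mu> \<nu> \<longleftrightarrow> parts N \<mu> \<and> (\<forall>r. \<nu> r \<le> \<mu> r \<and> \<mu> r \<le> Suc (\<nu> r))"

text \<open>The numerator of the bialternant formula for the Schur function of
  \<open>\<nu>\<close>.\<close>

definition alt :: "nat \<Rightarrow> (nat \<Rightarrow> 'a::comm_ring_1) \<Rightarrow> (nat \<Rightarrow> nat) \<Rightarrow> 'a" where
  "alt N z \<nu> = dt N (\<lambda>i j. z i ^ (\<nu> j + (N - 1 - j)))"

definition strip_size :: "nat \<Rightarrow> (nat \<Rightarrow> nat) \<Rightarrow> (nat \<Rightarrow> nat) \<Rightarrow> nat" where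
  "strip_size N \<mu> \<nu> = (\<Sum>r<N. \<mu> r - \<nu> r)"

lemma finite_vstep: "finite {\<mu>. vstep N \<mu> \<nu>}"
proof -
  have "{\<mu>. vstep N \<mu> \<nu>} \<subseteq> {f. \<forall>i. (i \<in> {..<N} \<longrightarrow> f i \<in> {..Max (\<nu> ` {..<N}) + 1}) \<and> (i \<notin> {..<N} \<longrightarrow> f i = 0)}"
  proof
    fix \<mu> assume "\<mu> \<in> {\<mu>. vstep N \<mu> \<nu>}"
    then have \<mu>: "vstep N \<mu> \<nu>" by simp
    have "\<mu> i \<le> Max (\<nu> ` {..<N}) + 1" if "i < N" for i
    proof -
      have "\<nu> i \<le> Max (\<nu> ` {..<N})" using that by (intro Max_ge) auto
      moreover have "\<mu> i \<le> Suc (\<nu> i)" using \<mu> by (auto simp: vstep_def)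
      ultimately show ?thesis by simp
    qed
    then show "\<mu> \<in> {f. \<forall>i. (i \<in> {..<N} \<longrightarrow> f i \<in> {..Max (\<nu> ` {..<N}) + 1}) \<and> (i \<notin> {..<N} \<longrightarrow> f i = 0)}"
      using \<mu> by (auto simp: vstep_def parts_def)
  qed
  then show ?thesis by (rule finite_subset) (intro finite_set_of_finite_funs; simp)
qed

lemma strip_size_le: "vstep N \<mu> \<nu> \<Longrightarrow> strip_size N \<mu> \<nu> \<le> N"
proof -
  assume v: "vstep N \<mu> \<nu>"
  have "strip_size N \<mu> \<nu> \<le> (\<Sum>r<N. 1)"
    unfolding strip_size_def by (rule sum_mono) (use v in \<open>auto simp: vstep_def le_diff_conv\<close>)
  then show ?thesis by simp
qed

lemma esym_mult_alt:
  assumes "parts N \<nu>"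
  shows "esym N z k * alt N z \<nu> = (\<Sum>\<mu> | vstep N \<mu> \<nu> \<and> strip_size N \<mu> \<nu> = k. alt N z \<mu>)"
proof -
  let ?f = "\<lambda>S j. \<nu> j + of_bool (j \<in> S)" and ?S = "{S. S \<subseteq> {..<N} \<and> card S = k}"
  have fin: "finite ?S" by (rule finite_subset[of _ "Pow {..<N}"]) auto
  have "esym N z k * alt N z \<nu> = (\<Sum>S\<in>?S. alt N z (?f S))"
    unfolding alt_def by (simp add: esym_mult_alternant add_ac)
  also have "\<dots> = (\<Sum>S\<in>{S\<in>?S. parts N (?f S)}. alt N z (?f S))"
  proof (rule sum.mono_neutral_right)
    show "\<forall>S\<in>?S - {S\<in>?S. parts N (?f S)}. alt N z (?f S) = 0"
    proof
      fix S assume S: "S \<in> ?S - {S\<in>?S. parts N (?f S)}"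
      then have np: "\<not> parts N (?f S)" and SN: "S \<subseteq> {..<N}" by auto
      have "\<forall>i\<ge>N. ?f S i = 0" using assms SN by (auto simp: parts_def)
      \<comment> \<open>If the result is no partition, some row overtakes the one above it by
        exactly one, and then two exponents of the alternant coincide.\<close>
      with np obtain i where i: "?f S i < ?f S (Suc i)" by (auto simp: parts_def not_le)
      have "\<nu> (Suc i) \<le> \<nu> i" using assms by (simp add: parts_def)
      with i have e: "?f S (Suc i) = Suc (?f S i)" "Suc i \<in> S" by (auto split: if_splits simp: of_bool_def)
      then have "Suc i < N" using SN by auto
      with e(1) have "?f S i + (N - 1 - i) = ?f S (Suc i) + (N - 1 - Suc i)" by linarith
      then have "z j ^ (?f S i + (N - 1 - i)) = z j ^ (?f S (Suc i) + (N - 1 - Suc i))" for j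
        by (simp only:)
      then show "alt N z (?f S) = 0"
        unfolding alt_def using \<open>Suc i < N\<close> by (intro dt_equal_columns[of i _ "Suc i"]) simp_all
    qed
  qed (use fin in auto)
  also have "\<dots> = (\<Sum>\<mu> | vstep N \<mu> \<nu> \<and> strip_size N \<mu> \<nu> = k. alt N z \<mu>)"
  proof (rule sum.reindex_bij_witness[of _ "\<lambda>\<mu>. {r. \<mu> r \<noteq> \<nu> r}" ?f])
    fix S assume S: "S \<in> {S\<in>?S. parts N (?f S)}"
    show "{r. ?f S r \<noteq> \<nu> r} = S" by auto
    have "strip_size N (?f S) \<nu> = (\<Sum>r\<in>S. 1)"
      unfolding strip_size_def by (rule sum.mono_neutral_cong_right) (use S in auto)
    then show "?f S \<in> {\<mu>. vstep N \<mu> \<nu> \<and> strip_size N \<mu> \<nu> = k}"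
      using S by (auto simp: vstep_def)
  next
    fix \<mu> assume \<mu>: "\<mu> \<in> {\<mu>. vstep N \<mu> \<nu> \<and> strip_size N \<mu> \<nu> = k}"
    then have b: "\<nu> r \<le> \<mu> r" "\<mu> r \<le> Suc (\<nu> r)" for r by (auto simp: vstep_def)
    show eq: "?f {r. \<mu> r \<noteq> \<nu> r} = \<mu>"
    proof
      fix r show "?f {r. \<mu> r \<noteq> \<nu> r} r = \<mu> r" using b[of r] by auto
    qed
    have sub: "{r. \<mu> r \<noteq> \<nu> r} \<subseteq> {..<N}"
      using \<mu> assms by (auto simp: vstep_def parts_def) (metis not_le)
    have "strip_size N \<mu> \<nu> = (\<Sum>r\<in>{r. \<mu> r \<noteq> \<nu> r}. 1)"
      unfolding strip_size_def
    proof (rule sum.mono_neutral_cong_right)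
      fix r assume "r \<in> {r. \<mu> r \<noteq> \<nu> r}"
      then show "\<mu> r - \<nu> r = 1" using b[of r] by auto
    qed (use sub in auto)
    then show "{r. \<mu> r \<noteq> \<nu> r} \<in> {S\<in>?S. parts N (?f S)}"
      using sub \<mu> eq by (auto simp: vstep_def)
  qed (rule refl)
  finally show ?thesis .
qed

text \<open>
  The members after the last one are set to zero, so that a chain is determined by its first \<open>m + 1\<close> members.
\<close>

definition chains :: "nat \<Rightarrow> nat \<Rightarrow> (nat \<Rightarrow> nat) \<Rightarrow> (nat \<Rightarrow> nat \<Rightarrow> nat) set" where
  "chains N m \<nu> = {c. c m = \<nu> \<and> (\<forall>b<m. vstep N (c b) (c (Suc b))) \<and> (\<forall>b>m. c b = (\<lambda>_. 0))}"

lemma chains_0: "chains N 0 \<nu> = {(\<lambda>_ _. 0)(0 := \<nu>)}"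
  by (auto simp: chains_def fun_eq_iff)

lemma chains_Suc_bij:
  "bij_betw (\<lambda>(\<mu>, c). c(Suc m := \<nu>)) (SIGMA \<mu>:{\<mu>. vstep N \<mu> \<nu>}. chains N m \<mu>) (chains N (Suc m) \<nu>)"
proof (rule bij_betwI[of _ _ _ "\<lambda>c. (c m, c(Suc m := (\<lambda>_. 0)))"])
  show "(\<lambda>(\<mu>, c). c(Suc m := \<nu>)) \<in> (SIGMA \<mu>:{\<mu>. vstep N \<mu> \<nu>}. chains N m \<mu>) \<rightarrow> chains N (Suc m) \<nu>"
    by (auto simp: chains_def less_Suc_eq)
  show "(\<lambda>c. (c m, c(Suc m := (\<lambda>_. 0)))) \<in> chains N (Suc m) \<nu> \<rightarrow> (SIGMA \<mu>:{\<mu>. vstep N \<mu> \<nu>}. chains N m \<mu>)"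
  proof
    fix c assume c: "c \<in> chains N (Suc m) \<nu>"
    have "vstep N (c m) \<nu>" using c by (auto simp: chains_def)
    moreover have "c(Suc m := (\<lambda>_. 0)) \<in> chains N m (c m)"
      using c by (auto simp: chains_def)
    ultimately show "(c m, c(Suc m := (\<lambda>_. 0))) \<in> (SIGMA \<mu>:{\<mu>. vstep N \<mu> \<nu>}. chains N m \<mu>)" by simp
  qed
qed (auto simp: chains_def fun_eq_iff)

lemma finite_chains: "finite (chains N m \<nu>)"
proof (induction m arbitrary: \<nu>)
  case 0
  then show ?case by (simp add: chains_0)
next
  case (Suc m)
  then show ?case
    using bij_betw_finite[OF chains_Suc_bij[of m \<nu> N]] finite_vstep[of N \<nu>] by auto
qed

text \<open>Iterated Pieri rule. Chains grow from \<open>c m = \<nu>\<close> to the largest member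
  \<open>c 0\<close>, so the last factor is the first to act.\<close>

lemma prod_esym_mult_alt:
  assumes "parts N \<nu>"
  shows "(\<Prod>b<m. esym N z (\<kappa> b)) * alt N z \<nu> =
    (\<Sum>c | c \<in> chains N m \<nu> \<and> (\<forall>b<m. strip_size N (c b) (c (Suc b)) = \<kappa> b). alt N z (c 0))"
  using assms
proof (induction m arbitrary: \<nu>)
  case 0
  have "{c. c \<in> chains N 0 \<nu>} = {(\<lambda>_ _. 0)(0 := \<nu>)}" by (simp add: chains_0)
  then show ?case by simp
next
  case (Suc m)
  let ?ok = "\<lambda>m c. \<forall>b<m. strip_size N (c b) (c (Suc b)) = \<kappa> b"
  let ?A = "\<lambda>\<mu>. {c. c \<in> chains N m \<mu> \<and> ?ok m c}"
  let ?V = "{\<mu>. vstep N \<mu> \<nu> \<and> strip_size N \<mu> \<nu> = \<kappa> m}"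
  have "(\<Prod>b<Suc m. esym N z (\<kappa> b)) * alt N z \<nu> =
      (\<Prod>b<m. esym N z (\<kappa> b)) * (esym N z (\<kappa> m) * alt N z \<nu>)"
    by (simp add: mult_ac)
  also have "\<dots> = (\<Sum>\<mu>\<in>?V. (\<Prod>b<m. esym N z (\<kappa> b)) * alt N z \<mu>)"
    unfolding esym_mult_alt[OF Suc.prems] sum_distrib_left ..
  also have "\<dots> = (\<Sum>\<mu>\<in>?V. \<Sum>c\<in>?A \<mu>. alt N z (c 0))"
    by (rule sum.cong) (use Suc.IH in \<open>auto simp: vstep_def\<close>)
  also have "\<dots> = (\<Sum>(\<mu>, c)\<in>Sigma ?V ?A. alt N z (c 0))"
    by (rule sum.Sigma) (auto intro: finite_subset[OF _ finite_vstep[of N \<nu>]] finite_subset[OF _ finite_chains])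
  also have "\<dots> = (\<Sum>c | c \<in> chains N (Suc m) \<nu> \<and> ?ok (Suc m) c. alt N z (c 0))"
  proof -
    have "bij_betw (\<lambda>(\<mu>, c). c(Suc m := \<nu>)) (Sigma ?V ?A) {c. c \<in> chains N (Suc m) \<nu> \<and> ?ok (Suc m) c}"
    proof (rule bij_betw_subset[OF chains_Suc_bij])
      show "Sigma ?V ?A \<subseteq> (SIGMA \<mu>:{\<mu>. vstep N \<mu> \<nu>}. chains N m \<mu>)" by auto
      show "(\<lambda>(\<mu>, c). c(Suc m := \<nu>)) ` Sigma ?V ?A = {c. c \<in> chains N (Suc m) \<nu> \<and> ?ok (Suc m) c}"
      proof
        show "(\<lambda>(\<mu>, c). c(Suc m := \<nu>)) ` Sigma ?V ?A \<subseteq> {c. c \<in> chains N (Suc m) \<nu> \<and> ?ok (Suc m) c}"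
          by (auto simp: chains_def less_Suc_eq)
        show "{c. c \<in> chains N (Suc m) \<nu> \<and> ?ok (Suc m) c} \<subseteq> (\<lambda>(\<mu>, c). c(Suc m := \<nu>)) ` Sigma ?V ?A"
        proof
          fix c assume c: "c \<in> {c. c \<in> chains N (Suc m) \<nu> \<and> ?ok (Suc m) c}"
          have "c(Suc m := (\<lambda>_. 0)) \<in> chains N m (c m)"
            using c by (auto simp: chains_def)
          then have "(c m, c(Suc m := (\<lambda>_. 0))) \<in> Sigma ?V ?A"
            using c by (auto simp: chains_def)
          moreover have "c = (\<lambda>(\<mu>, c). c(Suc m := \<nu>)) (c m, c(Suc m := (\<lambda>_. 0)))"
            using c by (auto simp: chains_def)
          ultimately show "c \<in> (\<lambda>(\<mu>, c). c(Suc m := \<nu>)) ` Sigma ?V ?A" by (rule rev_image_eqI)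
        qed
      qed
    qed
    from sum.reindex_bij_betw[OF this, of "\<lambda>c. alt N z (c 0)"] show ?thesis
      by (simp add: split_beta)
  qed
  finally show ?case .
qed

section \<open>Conjugate partitions and interlacing\<close>

definition part :: "(nat \<Rightarrow> nat) \<Rightarrow> bool" where
  "part p \<longleftrightarrow> antimono p \<and> (\<exists>N. \<forall>i\<ge>N. p i = 0)"

definition conjugate :: "(nat \<Rightarrow> nat) \<Rightarrow> nat \<Rightarrow> nat" where
  "conjugate p v = card {r. v < p r}"

text \<open>Both sides say that the box in row \<open>r\<close> and column \<open>v\<close> lies in
  the diagram. The later facts on conjugates are read off from this symmetry.\<close>

lemma less_conj_iff:
  assumes "part p"
  shows "r < conjugate p v \<longleftrightarrow> v < p r"
proof -
  obtain N where N: "\<forall>i\<ge>N. p i = 0" and anti: "antimono p" using assms by (auto simp: part_def)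
  define k where "k = (LEAST i. p i \<le> v)"
  have ex: "p N \<le> v" using N by simp
  have k: "p k \<le> v" unfolding k_def by (rule LeastI[of _ N]) (rule ex)
  have "{r. v < p r} = {..<k}"
  proof (rule Set.set_eqI)
    fix r
    have "r < k \<Longrightarrow> v < p r" unfolding k_def using not_less_Least by (metis not_le)
    moreover have "k \<le> r \<Longrightarrow> p r \<le> v" using k decseqD[OF anti, of k r] by simp
    ultimately show "r \<in> {r. v < p r} \<longleftrightarrow> r \<in> {..<k}" by (auto simp: not_le[symmetric])
  qed
  then have "conjugate p v = k" and "v < p r \<longleftrightarrow> r < k" by (auto simp: conjugate_def)
  then show ?thesis by simp
qed

lemma le_conj_iff: "part p \<Longrightarrow> k \<le> conjugate p v \<longleftrightarrow> (\<forall>r<k. v < p r)"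
  by (metis less_conj_iff not_le order_less_irrefl order_less_le_trans)

lemma part_conj:
  assumes "part p"
  shows "part (conjugate p)"
proof -
  have "antimono (conjugate p)"
  proof (rule antimonoI)
    fix v w :: nat assume "v \<le> w"
    show "conjugate p w \<le> conjugate p v"
      using assms \<open>v \<le> w\<close> by (simp add: le_conj_iff) (metis less_conj_iff order_le_less_trans)
  qed
  moreover have "conjugate p v = 0" if "v \<ge> p 0" for v
    using less_conj_iff[OF assms, of 0 v] that by simp
  ultimately show ?thesis unfolding part_def by blast
qed

lemma conj_conj:
  assumes "part p"
  shows "conjugate (conjugate p) = p"
proof
  fix r
  have "v < conjugate (conjugate p) r \<longleftrightarrow> v < p r" for v
    using less_conj_iff[OF part_conj[OF assms]] less_conj_iff[OF assms] by simp
  then show "conjugate (conjugate p) r = p r" by (metis linorder_neqE_nat order_less_irrefl)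
qed

lemma parts_imp_part: "parts N p \<Longrightarrow> part p"
  unfolding parts_def part_def by (metis decseq_SucI)

lemma parts_iff: "parts N p \<longleftrightarrow> part p \<and> (\<forall>i\<ge>N. p i = 0)"
  unfolding parts_def part_def by (metis decseq_SucI decseq_SucD)

lemma parts_conj_le: 
  assumes "part p"
  shows "parts N p \<longleftrightarrow> (\<forall>v. conjugate p v \<le> N)"
proof -
  have "(\<forall>i\<ge>N. p i = 0) \<longleftrightarrow> (\<forall>v. conjugate p v \<le> N)"
  proof
    assume a: "\<forall>i\<ge>N. p i = 0"
    show "\<forall>v. conjugate p v \<le> N"
      using less_conj_iff[OF assms, of N] a by (metis not_le not_less0 order_refl)
  next
    assume a: "\<forall>v. conjugate p v \<le> N"
    show "\<forall>i\<ge>N. p i = 0"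
      using less_conj_iff[OF assms, of _ 0] a by (metis gr0I le_trans not_le)
  qed
  then show ?thesis using assms by (simp add: parts_iff)
qed

text \<open>In terms of columns a vertical strip is an interlacing condition, as between two rows of
  a Gelfand--Tsetlin pattern. The toggles work in this form.\<close>

lemma vstep_conj:
  assumes "part \<mu>" "part \<nu>"
  shows "(\<forall>r. \<nu> r \<le> \<mu> r \<and> \<mu> r \<le> Suc (\<nu> r)) \<longleftrightarrow> (\<forall>v. conjugate \<nu> v \<le> conjugate \<mu> v \<and> conjugate \<mu> (Suc v) \<le> conjugate \<nu> v)"
proof -
  have le: "a \<le> b \<longleftrightarrow> (\<forall>x. x < a \<longrightarrow> x < b)" for a b :: nat
    by (metis not_le order_less_irrefl order_less_le_trans)
  have le_Suc: "a \<le> Suc b \<longleftrightarrow> (\<forall>x. Suc x < a \<longrightarrow> x < b)" for a b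
  proof (cases a)
    case (Suc c)
    then show ?thesis using le[of c b] by simp
  qed simp
  have 1: "(\<forall>r. \<nu> r \<le> \<mu> r) \<longleftrightarrow> (\<forall>v. conjugate \<nu> v \<le> conjugate \<mu> v)"
    unfolding le less_conj_iff[OF assms(1)] less_conj_iff[OF assms(2)] by blast
  have 2: "(\<forall>r. \<mu> r \<le> Suc (\<nu> r)) \<longleftrightarrow> (\<forall>v. conjugate \<mu> (Suc v) \<le> conjugate \<nu> v)"
    unfolding le_Suc unfolding le less_conj_iff[OF assms(1)] less_conj_iff[OF assms(2)] by blast
  show ?thesis using 1 2 by blast
qed

definition paired :: "(nat \<Rightarrow> nat) \<Rightarrow> bool" where
  "paired p \<longleftrightarrow> (\<forall>i. p (2 * i) = p (Suc (2 * i)))"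

lemma paired_conj:
  assumes "part p"
  shows "paired p \<longleftrightarrow> (\<forall>v. even (conjugate p v))"
proof
  assume p: "paired p"
  show "\<forall>v. even (conjugate p v)"
  proof (rule allI, rule ccontr)
    fix v assume "odd (conjugate p v)"
    then obtain i where i: "conjugate p v = Suc (2 * i)" by (auto elim: oddE)
    then have "v < p (2 * i)" "\<not> v < p (Suc (2 * i))"
      using less_conj_iff[OF assms, of "2 * i" v] less_conj_iff[OF assms, of "Suc (2 * i)" v] by auto
    then show False using p by (simp add: paired_def)
  qed
next
  assume e: "\<forall>v. even (conjugate p v)"
  show "paired p"
    unfolding paired_def
  proof (rule allI, rule ccontr)
    fix i assume ne: "p (2 * i) \<noteq> p (Suc (2 * i))"
    have "p (Suc (2 * i)) \<le> p (2 * i)"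
      using assms decseqD[of p "2 * i" "Suc (2 * i)"] by (simp add: part_def)
    with ne have "p (Suc (2 * i)) < p (2 * i)" by simp
    then have "2 * i < conjugate p (p (Suc (2 * i)))" "\<not> Suc (2 * i) < conjugate p (p (Suc (2 * i)))"
      using less_conj_iff[OF assms] by auto
    then have "conjugate p (p (Suc (2 * i))) = Suc (2 * i)" by simp
    then show False using e[rule_format, of "p (Suc (2 * i))"] by simp
  qed
qed

lemma sum_rows_conj:
  assumes "part p" "p 0 \<le> V"
  shows "(\<Sum>i<r. p i) = (\<Sum>v<V. min (conjugate p v) r)"
proof (induction r)
  case 0
  then show ?case by simp
next
  case (Suc r)
  have "p r \<le> V" using assms decseqD[of p 0 r] by (auto simp: part_def)
  have "(\<Sum>v<V. min (conjugate p v) (Suc r)) = (\<Sum>v<V. min (conjugate p v) r + of_bool (v < p r))"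
  proof (rule sum.cong[OF refl])
    fix v
    show "min (conjugate p v) (Suc r) = min (conjugate p v) r + of_bool (v < p r)"
      using less_conj_iff[OF assms(1), of r v] by (cases "v < p r") simp_all
  qed
  also have "\<dots> = (\<Sum>v<V. min (conjugate p v) r) + (\<Sum>v<V. of_bool (v < p r))"
    by (rule sum.distrib)
  also have "(\<Sum>v<V. of_bool (v < p r)) = (\<Sum>v\<in>{..<p r}. 1 :: nat)"
    by (rule sum.mono_neutral_cong_right) (use \<open>p r \<le> V\<close> in auto)
  finally show ?case using Suc by simp
qed

text \<open>The rows from \<open>r\<close> on contain the excess over \<open>r\<close> of each
  column length. The summand \<open>V * r\<close> replaces truncated differences by maxima.\<close>

lemma sum_rows_tail_conj:
  assumes "parts N p" "p 0 \<le> V" "r \<le> N"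
  shows "(\<Sum>i\<in>{r..<N}. p i) + V * r = (\<Sum>v<V. max (conjugate p v) r)"
proof -
  have p: "part p" using assms(1) by (rule parts_imp_part)
  have "(\<Sum>i<N. p i) = (\<Sum>v<V. conjugate p v)"
    unfolding sum_rows_conj[OF p assms(2)]
    by (rule sum.cong) (use parts_conj_le[OF p, of N] assms(1) in \<open>auto simp: min_def\<close>)
  moreover have "(\<Sum>i<N. p i) = (\<Sum>i<r. p i) + (\<Sum>i\<in>{r..<N}. p i)"
    using assms(3) by (metis atLeast0LessThan le0 sum.atLeastLessThan_concat)
  moreover have "(\<Sum>v<V. max (conjugate p v) r) + (\<Sum>v<V. min (conjugate p v) r) = (\<Sum>v<V. conjugate p v) + V * r"
  proof -
    have "(\<Sum>v<V. max (conjugate p v) r) + (\<Sum>v<V. min (conjugate p v) r) = (\<Sum>v<V. conjugate p v + r)"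
      unfolding sum.distrib[symmetric] by (rule sum.cong) (auto simp: max_def min_def)
    then show ?thesis by (simp only: sum.distrib) simp
  qed
  ultimately show ?thesis using sum_rows_conj[OF p assms(2), of r] by linarith
qed

section \<open>Toggling one member of a chain\<close>

lemma min_add_max_nat: "min x y + max x y = x + (y :: nat)"
  by (simp add: min_def max_def)

text \<open>Bender--Knuth toggle of the middle partition of a chain of two strips, in conjugate coordinates and
  restricted to the rows from \<open>r\<close> on.\<close>

definition toggle_up :: "(nat \<Rightarrow> nat) \<Rightarrow> (nat \<Rightarrow> nat) \<Rightarrow> nat \<Rightarrow> nat" where
  "toggle_up A B v = (case v of 0 \<Rightarrow> A 0 | Suc w \<Rightarrow> min (A v) (B w))"

definition toggle_low :: "nat \<Rightarrow> (nat \<Rightarrow> nat) \<Rightarrow> (nat \<Rightarrow> nat) \<Rightarrow> nat \<Rightarrow> nat" where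
  "toggle_low r A B v = max (max (A (Suc v)) (B v)) r"

definition toggle :: "nat \<Rightarrow> (nat \<Rightarrow> nat) \<Rightarrow> (nat \<Rightarrow> nat) \<Rightarrow> (nat \<Rightarrow> nat) \<Rightarrow> nat \<Rightarrow> nat" where
  "toggle r A M B v = (if r \<le> M v then toggle_up A B v + toggle_low r A B v - M v else M v)"

context
  fixes r :: nat and A M B :: "nat \<Rightarrow> nat"
  assumes AM: "\<And>v. M v \<le> A v" "\<And>v. A (Suc v) \<le> M v" and MB: "\<And>v. B v \<le> M v" "\<And>v. M (Suc v) \<le> B v"
begin

text \<open>Interlacing with both neighbours confines \<open>M v\<close> to the interval between
  \<open>toggle_low\<close> and \<open>toggle_up\<close>, in which \<open>toggle\<close> reflects
  it. These bounds make the truncated subtraction exact, and so the reflection an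
  involution.\<close>

lemma toggle_bounds:
  shows "M v \<le> toggle_up A B v" "r \<le> M v \<Longrightarrow> toggle_low r A B v \<le> M v"
proof -
  show "M v \<le> toggle_up A B v"
    using AM(1)[of v] MB(2) by (cases v) (simp_all add: toggle_up_def AM)
  show "toggle_low r A B v \<le> M v" if "r \<le> M v"
    using that AM(2)[of v] MB(1)[of v] by (simp add: toggle_low_def)
qed

lemma toggle_ge_iff: "r \<le> toggle r A M B v \<longleftrightarrow> r \<le> M v"
proof -
  have "r \<le> toggle_low r A B v" by (simp add: toggle_low_def)
  then show ?thesis using toggle_bounds[of v] by (cases "r \<le> M v") (simp_all add: toggle_def)
qed

lemma toggle_toggle: "toggle r A (toggle r A M B) B = M"
proof
  fix v
  have "toggle_up A B v + toggle_low r A B v - (toggle_up A B v + toggle_low r A B v - M v) = M v"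
    using toggle_bounds(1)[of v] by simp
  then show "toggle r A (toggle r A M B) B v = M v"
    using toggle_ge_iff[of v] by (cases "r \<le> M v") (simp_all add: toggle_def)
qed

lemma toggle_interlace:
  "toggle r A M B v \<le> A v" "A (Suc v) \<le> toggle r A M B v"
  "B v \<le> toggle r A M B v" "toggle r A M B (Suc v) \<le> B v"
proof -
  have up: "toggle_up A B w \<le> A w" "toggle_up A B (Suc w) \<le> B w" for w
    by (cases w; simp add: toggle_up_def)+
  have low: "A (Suc w) \<le> toggle_low r A B w" "B w \<le> toggle_low r A B w" for w
    by (simp_all add: toggle_low_def)
  show "toggle r A M B v \<le> A v"
    using toggle_bounds[of v] AM(1)[of v] up(1)[of v] by (cases "r \<le> M v") (simp_all add: toggle_def)
  show "A (Suc v) \<le> toggle r A M B v"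
    using toggle_bounds[of v] AM(2)[of v] low(1)[of v] by (cases "r \<le> M v") (simp_all add: toggle_def)
  show "B v \<le> toggle r A M B v"
    using toggle_bounds[of v] MB(1)[of v] low(2)[of v] by (cases "r \<le> M v") (simp_all add: toggle_def)
  show "toggle r A M B (Suc v) \<le> B v"
    using toggle_bounds[of "Suc v"] MB(2)[of v] up(2)[of v] by (cases "r \<le> M (Suc v)") (simp_all add: toggle_def)
qed

text \<open>\<open>M v\<close> and its reflection add up to the two interval ends. The upper end at
  \<open>Suc v\<close> and the lower end at \<open>v\<close> are the minimum and the maximum of the
  same two numbers, so the ends regroup into the values of \<open>A\<close> and \<open>B\<close>.
  The hypothesis \<open>G\<close> says that the strip between \<open>A\<close> and \<open>M\<close>
  has no box in row \<open>r - 1\<close>.\<close>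

lemma toggle_sum:
  assumes G: "\<And>v. M v < r \<Longrightarrow> A v < r" and V: "A V = 0"
  shows "(\<Sum>v<V. max (toggle r A M B v) r) + (\<Sum>v<V. max (M v) r) = (\<Sum>v<V. max (A v) r) + (\<Sum>v<V. max (B v) r)"
proof -
  define u where "u = (\<lambda>v. case v of 0 \<Rightarrow> max (A 0) r | Suc w \<Rightarrow> min (max (A v) r) (max (B w) r))"
  define l where "l = (\<lambda>v. max (max (A (Suc v)) r) (max (B v) r))"
  have eq: "max (toggle r A M B v) r + max (M v) r = u v + l v" for v
  proof (cases "r \<le> M v")
    case True
    have "r \<le> A v" using AM(1)[of v] True by simp
    moreover have "r \<le> B w" if "v = Suc w" for w using MB(2)[of w] True that by simp
    ultimately have "u v = toggle_up A B v"
      by (cases v) (simp_all add: u_def toggle_up_def)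
    moreover have "l v = toggle_low r A B v" by (simp add: l_def toggle_low_def)
    moreover have "max (toggle r A M B v) r = toggle r A M B v" using toggle_ge_iff[of v] True by simp
    moreover have "max (M v) r = M v" using True by simp
    moreover have "toggle r A M B v + M v = toggle_up A B v + toggle_low r A B v"
      using toggle_bounds[of v] True by (cases "r \<le> M v") (simp_all add: toggle_def)
    ultimately show ?thesis by simp
  next
    case False
    then have "A v < r" using G by simp
    moreover have "A (Suc v) < r" "B v < r" using AM(2)[of v] MB(1)[of v] False by simp_all
    moreover have "u v = r"
      using \<open>A v < r\<close> by (cases v) (simp_all add: u_def min_absorb1)
    ultimately have "u v = r" "l v = r" by (simp_all add: l_def)
    moreover have "toggle r A M B v = M v" using False by (simp add: toggle_def)
    ultimately show ?thesis using False by simp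
  qed
  have S: "(\<Sum>v<k. u v + l v) + u k = (\<Sum>v<Suc k. max (A v) r) + (\<Sum>v<k. max (B v) r)" for k
  proof (induction k)
    case 0
    then show ?case by (simp add: u_def)
  next
    case (Suc k)
    have "u (Suc k) + l k = max (A (Suc k)) r + max (B k) r"
      unfolding u_def l_def by (simp add: min_add_max_nat)
    then show ?case using Suc by simp
  qed
  have "u V = r" using V by (cases V) (simp_all add: u_def)
  moreover have "max (A V) r = r" using V by simp
  ultimately show ?thesis
    using S[of V] by (simp add: sum.distrib[symmetric] eq)
qed

end

text \<open>The paired end of a chain has only one neighbour. An even column length there is bounded
  above by \<open>2 * n\<close>, the number of rows, or by the preceding value of \<open>M\<close>
  rounded down to an even number, and below by the current value rounded up.\<close>

definition toggle_even_up :: "nat \<Rightarrow> (nat \<Rightarrow> nat) \<Rightarrow> nat \<Rightarrow> nat" where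
  "toggle_even_up n M v = (case v of 0 \<Rightarrow> 2 * n | Suc w \<Rightarrow> 2 * (M w div 2))"

definition toggle_even_low :: "nat \<Rightarrow> (nat \<Rightarrow> nat) \<Rightarrow> nat \<Rightarrow> nat" where
  "toggle_even_low r M v = max (2 * (Suc (M v) div 2)) r"

definition toggle_even :: "nat \<Rightarrow> nat \<Rightarrow> (nat \<Rightarrow> nat) \<Rightarrow> (nat \<Rightarrow> nat) \<Rightarrow> nat \<Rightarrow> nat" where
  "toggle_even n r A M v =
    (if r \<le> A v then toggle_even_up n M v + toggle_even_low r M v - A v else A v)"

context
  fixes n r :: nat and A M :: "nat \<Rightarrow> nat"
  assumes AM: "\<And>v. M v \<le> A v" "\<And>v. A (Suc v) \<le> M v" and A_even: "\<And>v. even (A v)"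
    and A_le: "A 0 \<le> 2 * n" and r_even: "even r"
begin

lemma toggle_even_bounds:
  shows "A v \<le> toggle_even_up n M v" "r \<le> A v \<Longrightarrow> toggle_even_low r M v \<le> A v"
proof -
  obtain a where a: "A v = 2 * a" using A_even[of v] by (auto elim: evenE)
  show "A v \<le> toggle_even_up n M v"
  proof (cases v)
    case 0
    then show ?thesis using A_le by (simp add: toggle_even_up_def)
  next
    case (Suc w)
    then have "2 * a \<le> M w" using AM(2)[of w] a by simp
    then have "a \<le> M w div 2" by simp
    then show ?thesis using a Suc by (simp add: toggle_even_up_def)
  qed
  have "Suc (M v) div 2 \<le> a" using AM(1)[of v] a by simp
  then show "toggle_even_low r M v \<le> A v" if "r \<le> A v"
    using that a by (simp add: toggle_even_low_def)
qed

lemma toggle_even_ge_iff: "r \<le> toggle_even n r A M v \<longleftrightarrow> r \<le> A v"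
proof -
  have "r \<le> toggle_even_low r M v" by (simp add: toggle_even_low_def)
  then show ?thesis using toggle_even_bounds[of v] by (cases "r \<le> A v") (simp_all add: toggle_even_def)
qed

lemma toggle_even_toggle_even: "toggle_even n r (toggle_even n r A M) M = A"
proof
  fix v
  have "toggle_even_up n M v + toggle_even_low r M v -
      (toggle_even_up n M v + toggle_even_low r M v - A v) = A v"
    using toggle_even_bounds(1)[of v] by simp
  then show "toggle_even n r (toggle_even n r A M) M v = A v"
    using toggle_even_ge_iff[of v] by (cases "r \<le> A v") (simp_all add: toggle_even_def)
qed

lemma toggle_even_interlace:
  "M v \<le> toggle_even n r A M v" "toggle_even n r A M (Suc v) \<le> M v"
  "even (toggle_even n r A M v)" "toggle_even n r A M 0 \<le> 2 * n"
proof -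
  have "M v \<le> toggle_even_low r M v" by (simp add: toggle_even_low_def)
  then show "M v \<le> toggle_even n r A M v"
    using toggle_even_bounds[of v] AM(1)[of v] by (cases "r \<le> A v") (simp_all add: toggle_even_def)
  have "toggle_even_up n M (Suc v) \<le> M v" by (simp add: toggle_even_up_def)
  then show "toggle_even n r A M (Suc v) \<le> M v"
    using toggle_even_bounds[of "Suc v"] AM(2)[of v] by (cases "r \<le> A (Suc v)") (simp_all add: toggle_even_def)
  have "even (toggle_even_up n M v)" by (cases v) (simp_all add: toggle_even_up_def)
  moreover have "even (toggle_even_low r M v)"
    using r_even by (simp add: toggle_even_low_def max_def)
  ultimately show "even (toggle_even n r A M v)"
    using A_even[of v] by (cases "r \<le> A v") (simp_all add: toggle_even_def)
  have "toggle_even_up n M 0 = 2 * n" by (simp add: toggle_even_up_def)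
  then show "toggle_even n r A M 0 \<le> 2 * n"
    using toggle_even_bounds[of 0] A_le by (cases "r \<le> A 0") (simp_all add: toggle_even_def)
qed

text \<open>As in \<open>toggle_sum\<close>, but now the two roundings of one value of
  \<open>M\<close> add up to twice that value, and \<open>2 * n - r\<close> stems from the upper end
  of column 0. \<open>G0\<close> and \<open>G\<close> together say that the strip has a box in row
  \<open>r - 1\<close>.\<close>

lemma toggle_even_sum:
  assumes G0: "r \<le> A 0" and G: "\<And>v. A (Suc v) < r \<Longrightarrow> M v < r" and V: "M V = 0"
  shows "(\<Sum>v<Suc V. max (toggle_even n r A M v) r) + (\<Sum>v<Suc V. max (A v) r) =
    (2 * n - r) + 2 * (\<Sum>v<Suc V. max (M v) r)"
proof -
  define u where "u = (\<lambda>v. case v of 0 \<Rightarrow> 2 * n | Suc w \<Rightarrow> max (2 * (M w div 2)) r)"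
  define l where "l = (\<lambda>v. max (2 * (Suc (M v) div 2)) r)"
  have rn: "r \<le> 2 * n" using G0 A_le by simp
  have eq: "max (toggle_even n r A M v) r + max (A v) r = u v + l v" for v
  proof (cases "r \<le> A v")
    case True
    have "r \<le> toggle_even_up n M v" using toggle_even_bounds(1)[of v] True by simp
    then have "u v = toggle_even_up n M v"
      by (cases v) (simp_all add: u_def toggle_even_up_def)
    moreover have "l v = toggle_even_low r M v" by (simp add: l_def toggle_even_low_def)
    moreover have "max (toggle_even n r A M v) r = toggle_even n r A M v" using toggle_even_ge_iff[of v] True by simp
    moreover have "max (A v) r = A v" using True by simp
    moreover have "toggle_even n r A M v + A v = toggle_even_up n M v + toggle_even_low r M v"
      using toggle_even_bounds[of v] True by (cases "r \<le> A v") (simp_all add: toggle_even_def)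
    ultimately show ?thesis by simp
  next
    case False
    then obtain w where w: "v = Suc w" using G0 by (cases v) auto
    then have "M w < r" using G False by simp
    then have "2 * (M w div 2) \<le> r" by simp
    then have "u v = r" by (simp add: u_def w)
    moreover have "l v = r"
    proof -
      obtain b where b: "r = 2 * b" using r_even by (auto elim: evenE)
      have "M v < 2 * b" using AM(1)[of v] False b by simp
      then have "Suc (M v) div 2 \<le> b" by simp
      then show ?thesis by (simp add: l_def b)
    qed
    moreover have "toggle_even n r A M v = A v" using False by (simp add: toggle_even_def)
    ultimately show ?thesis using False by simp
  qed
  have ul: "u (Suc v) + l v = 2 * max (M v) r" for v
  proof (cases "even (M v)")
    case False
    then obtain a where "M v = Suc (2 * a)" by (auto elim: oddE)
    moreover obtain b where "r = 2 * b" using r_even by (auto elim: evenE)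
    ultimately show ?thesis by (cases "a < b") (simp_all add: u_def l_def max_def)
  next
    case True
    then obtain a where "M v = 2 * a" by (auto elim: evenE)
    then show ?thesis by (simp add: u_def l_def)
  qed
  have S: "(\<Sum>v<k. u v + l v) + u k = 2 * n + 2 * (\<Sum>v<k. max (M v) r)" for k
  proof (induction k)
    case 0
    then show ?case by (simp add: u_def)
  next
    case (Suc k)
    then show ?case using ul[of k] by simp
  qed
  have "u (Suc V) = r" using V by (simp add: u_def)
  then show ?thesis
    using S[of "Suc V"] rn unfolding sum.distrib[symmetric] eq by linarith
qed

end

section \<open>The toggles as operations on partitions\<close>

lemma vstepD:
  assumes "vstep N \<mu> \<nu>"
  shows "parts N \<mu>" "\<nu> r \<le> \<mu> r" "\<mu> r \<le> Suc (\<nu> r)"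
  using assms by (auto simp: vstep_def)

lemma vstep_interlace:
  assumes "vstep N \<mu> \<nu>" "parts N \<nu>"
  shows "conjugate \<nu> v \<le> conjugate \<mu> v" "conjugate \<mu> (Suc v) \<le> conjugate \<nu> v"
  using vstep_conj[OF parts_imp_part[OF vstepD(1)[OF assms(1)]] parts_imp_part[OF assms(2)]] assms(1)
  by (auto simp: vstep_def)

lemma vstepI:
  assumes "parts N \<mu>" "part \<nu>" "\<And>v. conjugate \<nu> v \<le> conjugate \<mu> v" "\<And>v. conjugate \<mu> (Suc v) \<le> conjugate \<nu> v"
  shows "vstep N \<mu> \<nu>"
  using vstep_conj[OF parts_imp_part[OF assms(1)] assms(2)] assms by (auto simp: vstep_def)

lemma part_interlace:
  assumes "\<And>v. T (Suc v) \<le> M v" "\<And>v. M v \<le> T v" "part M"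
  shows "part T"
proof -
  obtain N where N: "\<forall>i\<ge>N. M i = 0" using assms(3) by (auto simp: part_def)
  have "T i = 0" if "i \<ge> Suc N" for i
    using N assms(1)[of "i - 1"] that by (cases i) auto
  moreover have "antimono T"
    by (rule decseq_SucI) (rule order_trans[OF assms(1,2)])
  ultimately show ?thesis unfolding part_def by blast
qed

text \<open>Only columns with a box in row \<open>R\<close> change, and they keep that box; hence
  the rows up to \<open>R\<close> stay as they are. By the last equation the two strips exchange
  their numbers of boxes below row \<open>R\<close>.\<close>

lemma toggle_rows:
  assumes \<alpha>: "vstep N \<alpha> \<mu>" and \<mu>: "vstep N \<mu> \<beta>" and \<beta>: "parts N \<beta>" and r: "R < N"
    and gap: "\<alpha> R = \<mu> R"
  defines "\<mu>' \<equiv> conjugate (toggle (Suc R) (conjugate \<alpha>) (conjugate \<mu>) (conjugate \<beta>))"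
  shows "vstep N \<alpha> \<mu>'" "vstep N \<mu>' \<beta>" "\<And>i. i \<le> R \<Longrightarrow> \<mu>' i = \<mu> i"
    "conjugate (toggle (Suc R) (conjugate \<alpha>) (conjugate \<mu>') (conjugate \<beta>)) = \<mu>"
    "(\<Sum>i\<in>{Suc R..<N}. \<mu>' i) + (\<Sum>i\<in>{Suc R..<N}. \<mu> i) = (\<Sum>i\<in>{Suc R..<N}. \<alpha> i) + (\<Sum>i\<in>{Suc R..<N}. \<beta> i)"
proof -
  let ?A = "conjugate \<alpha>" and ?M = "conjugate \<mu>" and ?B = "conjugate \<beta>"
  let ?T = "toggle (Suc R) ?A ?M ?B"
  have pA: "parts N \<alpha>" and pM: "parts N \<mu>" using vstepD(1) \<alpha> \<mu> by auto
  note part = parts_imp_part[OF pA] parts_imp_part[OF pM] parts_imp_part[OF \<beta>]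
  note i1 = vstep_interlace[OF \<alpha> pM] and i2 = vstep_interlace[OF \<mu> \<beta>]
  note ti = toggle_interlace[where M = ?M and A = ?A and B = ?B and r = "Suc R", OF i1 i2]
  note tg = toggle_ge_iff[where M = ?M and A = ?A and B = ?B and r = "Suc R", OF i1 i2]
  have pT: "part ?T" by (rule part_interlace[where M = ?B]) (rule ti part_conj[OF part(3)])+
  have pm': "part \<mu>'" unfolding \<mu>'_def by (rule part_conj[OF pT])
  have conj': "conjugate \<mu>' = ?T" unfolding \<mu>'_def by (rule conj_conj[OF pT])
  have "?T v \<le> N" for v
    using ti(1)[of v] pA parts_conj_le[OF part(1), of N] by (meson le_trans)
  then have Nm': "parts N \<mu>'" using parts_conj_le[OF pm', of N] conj' by simp
  show v1: "vstep N \<alpha> \<mu>'"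
    by (rule vstepI[OF pA pm']) (simp_all add: conj' ti)
  show v2: "vstep N \<mu>' \<beta>"
    by (rule vstepI[OF Nm' part(3)]) (simp_all add: conj' ti)
  show rows: "\<mu>' i = \<mu> i" if "i \<le> R" for i
  proof -
    have "v < \<mu>' i \<longleftrightarrow> v < \<mu> i" for v
    proof -
      have "i < ?T v \<longleftrightarrow> i < ?M v"
        using tg[of v] that by (cases "Suc R \<le> ?M v") (auto simp: toggle_def)
      then show ?thesis using less_conj_iff[OF pm', of i v] less_conj_iff[OF part(2), of i v] conj' by simp
    qed
    then show ?thesis by (metis linorder_neqE_nat order_less_irrefl)
  qed
  show "conjugate (toggle (Suc R) ?A (conjugate \<mu>') ?B) = \<mu>"
    unfolding conj' toggle_toggle[where M = ?M and A = ?A and B = ?B and r = "Suc R", OF i1 i2] by (rule conj_conj[OF part(2)])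
  define V where "V = \<alpha> 0"
  have V: "?A V = 0" using less_conj_iff[OF part(1), of 0 V] by (simp add: V_def)
  have G: "?A v < Suc R" if "?M v < Suc R" for v
    using that less_conj_iff[OF part(1), of R v] less_conj_iff[OF part(2), of R v] gap by (simp add: not_less_eq[symmetric])
  have le: "\<alpha> 0 \<le> V" "\<mu> 0 \<le> V" "\<beta> 0 \<le> V" "\<mu>' 0 \<le> V"
    using vstepD(2)[OF \<alpha>, of 0] vstepD(2)[OF \<mu>, of 0] vstepD(2)[OF v1, of 0] by (auto simp: V_def)
  have rN: "Suc R \<le> N" using r by simp
  have "(\<Sum>v<V. max (?T v) (Suc R)) + (\<Sum>v<V. max (?M v) (Suc R)) = (\<Sum>v<V. max (?A v) (Suc R)) + (\<Sum>v<V. max (?B v) (Suc R))"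
    by (rule toggle_sum[OF i1 i2 G V])
  then show "(\<Sum>i\<in>{Suc R..<N}. \<mu>' i) + (\<Sum>i\<in>{Suc R..<N}. \<mu> i) = (\<Sum>i\<in>{Suc R..<N}. \<alpha> i) + (\<Sum>i\<in>{Suc R..<N}. \<beta> i)"
    using sum_rows_tail_conj[OF pA le(1) rN] sum_rows_tail_conj[OF pM le(2) rN] sum_rows_tail_conj[OF \<beta> le(3) rN]
      sum_rows_tail_conj[OF Nm' le(4) rN] unfolding conj' by linarith
qed

text \<open>Below row \<open>R\<close> the old and the new strip have together as many boxes as
  there are rows left. As \<open>R\<close> is odd, the cut does not separate a pair of rows.\<close>

lemma toggle_even_rows:
  assumes \<alpha>: "vstep (2 * n) \<alpha> \<mu>" and \<mu>: "parts (2 * n) \<mu>" and pr: "paired \<alpha>" and r: "R < 2 * n" "odd R"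
    and gap: "\<alpha> R = Suc (\<mu> R)"
  defines "\<alpha>' \<equiv> conjugate (toggle_even n (Suc R) (conjugate \<alpha>) (conjugate \<mu>))"
  shows "vstep (2 * n) \<alpha>' \<mu>" "paired \<alpha>'" "\<And>i. i \<le> R \<Longrightarrow> \<alpha>' i = \<alpha> i"
    "conjugate (toggle_even n (Suc R) (conjugate \<alpha>') (conjugate \<mu>)) = \<alpha>"
    "(\<Sum>i\<in>{Suc R..<2 * n}. \<alpha>' i) + (\<Sum>i\<in>{Suc R..<2 * n}. \<alpha> i) = (2 * n - Suc R) + 2 * (\<Sum>i\<in>{Suc R..<2 * n}. \<mu> i)"
proof -
  let ?A = "conjugate \<alpha>" and ?M = "conjugate \<mu>" and ?N = "2 * n"
  let ?T = "toggle_even n (Suc R) ?A ?M"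
  have pA: "parts ?N \<alpha>" using vstepD(1) \<alpha> by auto
  note part = parts_imp_part[OF pA] parts_imp_part[OF \<mu>]
  note i1 = vstep_interlace[OF \<alpha> \<mu>]
  have ev: "even (?A v)" for v using pr paired_conj[OF part(1)] by simp
  have le0: "?A 0 \<le> 2 * n" using parts_conj_le[OF part(1), of ?N] pA by blast
  have evR: "even (Suc R)" using r by simp
  note ctx = i1 ev le0 evR
  note ti = toggle_even_interlace[where M = ?M and A = ?A and n = n and r = "Suc R", OF ctx]
  note tg = toggle_even_ge_iff[where M = ?M and A = ?A and n = n and r = "Suc R", OF ctx]
  have pT: "part ?T" by (rule part_interlace[where M = ?M]) (rule ti part_conj[OF part(2)])+
  have pm': "part \<alpha>'" unfolding \<alpha>'_def by (rule part_conj[OF pT])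
  have conj': "conjugate \<alpha>' = ?T" unfolding \<alpha>'_def by (rule conj_conj[OF pT])
  have "?T v \<le> ?N" for v
    using ti(4) pT decseqD[of ?T 0 v] by (auto simp: part_def)
  then have Nm': "parts ?N \<alpha>'" using parts_conj_le[OF pm', of ?N] conj' by simp
  show v1: "vstep ?N \<alpha>' \<mu>"
    by (rule vstepI[OF Nm' part(2)]) (simp_all add: conj' ti)
  show "paired \<alpha>'" using paired_conj[OF pm'] ti(3) conj' by simp
  show rows: "\<alpha>' i = \<alpha> i" if "i \<le> R" for i
  proof -
    have "v < \<alpha>' i \<longleftrightarrow> v < \<alpha> i" for v
    proof -
      have "i < ?T v \<longleftrightarrow> i < ?A v"
        using tg[of v] that by (cases "Suc R \<le> ?A v") (auto simp: toggle_even_def)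
      then show ?thesis using less_conj_iff[OF pm', of i v] less_conj_iff[OF part(1), of i v] conj' by simp
    qed
    then show ?thesis by (metis linorder_neqE_nat order_less_irrefl)
  qed
  show "conjugate (toggle_even n (Suc R) (conjugate \<alpha>') ?M) = \<alpha>"
    unfolding conj' toggle_even_toggle_even[where M = ?M and A = ?A and n = n and r = "Suc R", OF ctx] by (rule conj_conj[OF part(1)])
  define V where "V = \<mu> 0"
  have V: "?M V = 0" using less_conj_iff[OF part(2), of 0 V] by (simp add: V_def)
  have G0: "Suc R \<le> ?A 0" using less_conj_iff[OF part(1), of R 0] gap by simp
  have G: "?M v < Suc R" if "?A (Suc v) < Suc R" for v
    using that less_conj_iff[OF part(1), of R "Suc v"] less_conj_iff[OF part(2), of R v] gap by (simp add: not_less_eq[symmetric])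
  have le: "\<alpha> 0 \<le> Suc V" "\<mu> 0 \<le> Suc V" "\<alpha>' 0 \<le> Suc V"
    using vstepD(3)[OF \<alpha>, of 0] vstepD(3)[OF v1, of 0] by (auto simp: V_def)
  have rN: "Suc R \<le> ?N" using r by simp
  have "(\<Sum>v<Suc V. max (?T v) (Suc R)) + (\<Sum>v<Suc V. max (?A v) (Suc R)) = (2 * n - Suc R) + 2 * (\<Sum>v<Suc V. max (?M v) (Suc R))"
    by (rule toggle_even_sum[OF ctx G0 G V])
  then show "(\<Sum>i\<in>{Suc R..<2 * n}. \<alpha>' i) + (\<Sum>i\<in>{Suc R..<2 * n}. \<alpha> i) = (2 * n - Suc R) + 2 * (\<Sum>i\<in>{Suc R..<2 * n}. \<mu> i)"
    using sum_rows_tail_conj[OF pA le(1) rN] sum_rows_tail_conj[OF \<mu> le(2) rN]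
      sum_rows_tail_conj[OF Nm' le(3) rN] unfolding conj' by linarith
qed

section \<open>The sign-reversing involution\<close>

definition pchains :: "nat \<Rightarrow> nat \<Rightarrow> (nat \<Rightarrow> nat) \<Rightarrow> (nat \<Rightarrow> nat \<Rightarrow> nat) set" where
  "pchains n m \<nu> = {c \<in> chains (2 * n) m \<nu>. paired (c 0)}"

definition pk :: "(nat \<Rightarrow> nat \<Rightarrow> nat) \<Rightarrow> nat \<Rightarrow> nat \<Rightarrow> nat" where
  "pk c b r = (\<Sum>i<r. c b i - c (Suc b) i)"

text \<open>Normalized so that the strip sizes \<open>n + Suc b - w\<close> and
  \<open>n + Suc b + w\<close>, which are the two indices in column \<open>b\<close> of the
  Jacobi--Trudi determinant, have the values \<open>- w\<close> and \<open>w\<close>.\<close>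

definition gam :: "nat \<Rightarrow> (nat \<Rightarrow> nat \<Rightarrow> nat) \<Rightarrow> nat \<Rightarrow> int" where
  "gam n c b = int (pk c b (2 * n)) - int n - int (Suc b)"

definition ind :: "(nat \<Rightarrow> nat) \<Rightarrow> nat \<Rightarrow> int \<Rightarrow> int" where
  "ind v k x = of_bool (x = - int (v k)) - of_bool (x = int (v k))"

text \<open>The coefficient of the chain when the Jacobi--Trudi determinant is expanded by Pieri's
  rule, apart from the sign given by the parity of the number of boxes.\<close>

definition sgn_chain :: "nat \<Rightarrow> nat \<Rightarrow> (nat \<Rightarrow> nat) \<Rightarrow> (nat \<Rightarrow> nat \<Rightarrow> nat) \<Rightarrow> int" where
  "sgn_chain n m v c = dt m (\<lambda>k b. ind v k (gam n c b))"

text \<open>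
  The lattice conditions: in the first \<open>r\<close> rows, no strip is larger than its neighbour on the side of the paired
  end \<open>c 0\<close>, and the strip next to that end meets at most half of the rows.
\<close>

definition violation :: "(nat \<Rightarrow> nat \<Rightarrow> nat) \<Rightarrow> nat \<Rightarrow> nat \<Rightarrow> bool" where
  "violation c r j \<longleftrightarrow> (case j of 0 \<Rightarrow> even r \<and> r div 2 < pk c 0 r | Suc b \<Rightarrow> pk c b r < pk c (Suc b) r)"

text \<open>
  Flipping at the first violated row negates one entry of \<open>gam\<close> or exchanges two neighbouring ones,
  and so changes the sign of the determinant \<open>sgn_chain\<close>.
\<close>

definition flip :: "nat \<Rightarrow> nat \<Rightarrow> nat \<Rightarrow> (nat \<Rightarrow> nat \<Rightarrow> nat) \<Rightarrow> nat \<Rightarrow> nat \<Rightarrow> nat" where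
  "flip n r j c = (case j of
      0 \<Rightarrow> c(0 := conjugate (toggle_even n r (conjugate (c 0)) (conjugate (c 1))))
    | Suc b \<Rightarrow> c(Suc b := conjugate (toggle r (conjugate (c b)) (conjugate (c (Suc b))) (conjugate (c (Suc (Suc b)))))))"

lemma ind_uminus: "v k \<noteq> 0 \<Longrightarrow> ind v k (- x) = - ind v k x"
  by (auto simp: ind_def of_bool_def)

lemma pk_cong: "(\<And>b i. i < r \<Longrightarrow> c' b i = c b i) \<Longrightarrow> r' \<le> r \<Longrightarrow> pk c' b r' = pk c b r'"
  unfolding pk_def by (rule sum.cong) auto

lemma violation_cong: "(\<And>b i. i < r \<Longrightarrow> c' b i = c b i) \<Longrightarrow> r' \<le> r \<Longrightarrow> violation c' r' j = violation c r' j"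
  using pk_cong[of r c' c r'] by (simp add: violation_def split: nat.split)

lemma pk_Suc: "pk c b (Suc r) = pk c b r + (c b r - c (Suc b) r)"
  by (simp add: pk_def)

lemma chainsD:
  assumes "c \<in> chains N m \<nu>" "parts N \<nu>"
  shows "b < m \<Longrightarrow> vstep N (c b) (c (Suc b))" "b \<le> m \<Longrightarrow> parts N (c b)"
proof -
  show v: "b < m \<Longrightarrow> vstep N (c b) (c (Suc b))" for b using assms by (simp add: chains_def)
  show "b \<le> m \<Longrightarrow> parts N (c b)"
    using v[of b] vstepD(1) assms by (cases "b < m") (auto simp: chains_def)
qed

lemma pk_total:
  assumes "vstep N (c b) (c (Suc b))" "r \<le> N"
  shows "int (pk c b N) = int (pk c b r) + int (\<Sum>i\<in>{r..<N}. c b i) - int (\<Sum>i\<in>{r..<N}. c (Suc b) i)"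
proof -
  have "pk c b N = pk c b r + (\<Sum>i\<in>{r..<N}. c b i - c (Suc b) i)"
    unfolding pk_def using assms(2) by (metis atLeast0LessThan le0 sum.atLeastLessThan_concat)
  moreover have "int (\<Sum>i\<in>{r..<N}. c b i - c (Suc b) i) = int (\<Sum>i\<in>{r..<N}. c b i) - int (\<Sum>i\<in>{r..<N}. c (Suc b) i)"
    using vstepD(2)[OF assms(1)] by (simp add: of_nat_diff sum_subtractf)
  ultimately show ?thesis by simp
qed

locale first_violation =
  fixes n m :: nat and \<nu> :: "nat \<Rightarrow> nat" and c :: "nat \<Rightarrow> nat \<Rightarrow> nat" and R j :: nat
  assumes c: "c \<in> pchains n m \<nu>" and \<nu>: "parts (2 * n) \<nu>" and R: "R < 2 * n" and j: "j < m"
    and violation: "violation c (Suc R) j" and first: "\<And>r. r \<le> R \<Longrightarrow> \<not> violation c r j"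
begin

definition c' where "c' = flip n (Suc R) j c"

lemma c_chain: "c \<in> chains (2 * n) m \<nu>" and c_paired: "paired (c 0)"
  using c by (auto simp: pchains_def)

lemmas stepc = chainsD(1)[OF c_chain \<nu>] and partsc = chainsD(2)[OF c_chain \<nu>]

text \<open>That no shorter initial segment is violated forces the strip to meet both rows of the
  pair \<open>R - 1\<close>, \<open>R\<close> and to exceed half of the first \<open>Suc R\<close>
  rows by exactly one. Complementing its boxes below row \<open>R\<close> then turns a strip of size
  \<open>k\<close> into one of size \<open>2 * n + 2 - k\<close>, which negates
  \<open>gam\<close>.\<close>

lemma flip_0:
  assumes j0: "j = 0"
  shows "c' \<in> pchains n m \<nu>" "\<And>b i. i \<le> R \<Longrightarrow> c' b i = c b i" "flip n (Suc R) j c' = c"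
    "gam n c' 0 = - gam n c 0" "\<And>b. 0 < b \<Longrightarrow> gam n c' b = gam n c b"
proof -
  have m: "0 < m" using j by simp
  have s: "vstep (2 * n) (c 0) (c 1)" using stepc[OF m] by simp
  have p1: "parts (2 * n) (c 1)" using partsc m by simp
  have ev: "even (Suc R)" and big: "Suc R div 2 < pk c 0 (Suc R)"
    using violation j0 by (auto simp: violation_def)
  then obtain i where i: "R = Suc (2 * i)" by (auto elim!: oddE)
  have "\<not> violation c (2 * i) 0" using first[of "2 * i"] j0 i by simp
  then have small: "pk c 0 (2 * i) \<le> i" by (simp add: violation_def)
  have d: "c 0 k - c 1 k \<le> 1" for k using vstepD(3)[OF s, of k] by simp
  have "pk c 0 (Suc R) = pk c 0 (2 * i) + (c 0 (2 * i) - c 1 (2 * i)) + (c 0 R - c 1 R)"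
    by (simp add: i pk_Suc)
  with big small d[of R] d[of "2 * i"] i have gapR: "c 0 R - c 1 R = 1" and tot: "pk c 0 (Suc R) = Suc (Suc R div 2)"
    by auto
  then have gap: "c 0 R = Suc (c 1 R)" by simp
  have c'_eq: "c' = c(0 := conjugate (toggle_even n (Suc R) (conjugate (c 0)) (conjugate (c 1))))"
    unfolding c'_def flip_def by (simp add: j0)
  note t = toggle_even_rows[OF s p1 c_paired R _ gap]
  have oddR: "odd R" using ev by simp
  note t = t[OF oddR]
  show agree: "c' b i = c b i" if "i \<le> R" for b i
    using t(3)[OF that] by (simp add: c'_eq)
  have s': "vstep (2 * n) (c' 0) (c' 1)" using t(1) by (simp add: c'_eq)
  show "c' \<in> pchains n m \<nu>"
  proof -
    have "vstep (2 * n) (c' b) (c' (Suc b))" if "b < m" for b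
      using s' stepc[OF that] by (cases "b = 0") (simp_all add: c'_eq)
    then show ?thesis
      using c_chain t(2) m by (auto simp: pchains_def chains_def c'_eq)
  qed
  show "flip n (Suc R) j c' = c"
  proof -
    have "flip n (Suc R) j x = x(0 := conjugate (toggle_even n (Suc R) (conjugate (x 0)) (conjugate (x 1))))" for x
      unfolding flip_def by (simp add: j0)
    then show ?thesis using t(4) by (simp add: c'_eq)
  qed
  have rN: "Suc R \<le> 2 * n" using R by simp
  have pk': "pk c' 0 (Suc R) = pk c 0 (Suc R)"
    by (rule pk_cong[of "Suc R"]) (auto simp: agree)
  have s0: "vstep (2 * n) (c 0) (c (Suc 0))" "vstep (2 * n) (c' 0) (c' (Suc 0))" using s s' by simp_all
  have sums: "(\<Sum>i\<in>{Suc R..<2 * n}. c' 0 i) + (\<Sum>i\<in>{Suc R..<2 * n}. c 0 i) =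
      (2 * n - Suc R) + 2 * (\<Sum>i\<in>{Suc R..<2 * n}. c (Suc 0) i)"
    using t(5) by (simp add: c'_eq)
  have c1: "c' (Suc 0) = c (Suc 0)" by (simp add: c'_eq)
  have "int (Suc R) = 2 * int (Suc R div 2)" using ev by presburger
  moreover have "int (2 * n - Suc R) = 2 * int n - int (Suc R)" using rN by (simp add: of_nat_diff)
  ultimately show "gam n c' 0 = - gam n c 0"
    unfolding gam_def pk_total[OF s0(1) rN] pk_total[OF s0(2) rN] pk' c1 tot
    using arg_cong[OF sums, of int] by simp
  show "gam n c' b = gam n c b" if "0 < b" for b
    using that by (simp add: gam_def pk_def c'_eq)
qed

text \<open>At the first violation the strip \<open>Suc b\<close> has a box in row \<open>R\<close>,
  the strip \<open>b\<close> has none, and their counts differ by exactly one. This one makes up for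
  the different shifts in \<open>gam\<close> of neighbouring strips, so exchanging the parts below
  row \<open>R\<close> exchanges the two values of \<open>gam\<close>.\<close>

lemma flip_Suc:
  assumes jb: "j = Suc b"
  shows "c' \<in> pchains n m \<nu>" "\<And>a i. i \<le> R \<Longrightarrow> c' a i = c a i" "flip n (Suc R) j c' = c"
    "gam n c' b = gam n c (Suc b)" "gam n c' (Suc b) = gam n c b"
    "\<And>a. a \<noteq> b \<Longrightarrow> a \<noteq> Suc b \<Longrightarrow> gam n c' a = gam n c a"
proof -
  have bm: "b < m" "Suc b < m" using j jb by auto
  note s1 = stepc[OF bm(1)] and s2 = stepc[OF bm(2)]
  have p: "parts (2 * n) (c (Suc (Suc b)))" using partsc bm by simp
  have big: "pk c b (Suc R) < pk c (Suc b) (Suc R)" using violation jb by (simp add: violation_def)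
  have small: "pk c (Suc b) R \<le> pk c b R" using first[of R] jb by (simp add: violation_def)
  have d: "c (Suc b) R - c (Suc (Suc b)) R \<le> 1" using vstepD(3)[OF s2, of R] by simp
  from big small d have "c b R - c (Suc b) R = 0" and tot: "pk c (Suc b) (Suc R) = Suc (pk c b (Suc R))"
    unfolding pk_Suc by linarith+
  then have gap: "c b R = c (Suc b) R" using vstepD(2)[OF s1, of R] by simp
  have c'_eq: "c' = c(Suc b := conjugate (toggle (Suc R) (conjugate (c b)) (conjugate (c (Suc b))) (conjugate (c (Suc (Suc b))))))"
    unfolding c'_def flip_def by (simp add: jb)
  note t = toggle_rows[OF s1 s2 p R gap]
  show agree: "c' a i = c a i" if "i \<le> R" for a i
    using t(3)[OF that] by (simp add: c'_eq)
  have s': "vstep (2 * n) (c' b) (c' (Suc b))" "vstep (2 * n) (c' (Suc b)) (c' (Suc (Suc b)))"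
    using t(1,2) by (simp_all add: c'_eq)
  show "c' \<in> pchains n m \<nu>"
  proof -
    have "vstep (2 * n) (c' a) (c' (Suc a))" if "a < m" for a
    proof -
      consider "a = b" | "a = Suc b" | "a \<noteq> b" "a \<noteq> Suc b" by blast
      then show ?thesis
      proof cases
        case 3
        then show ?thesis using stepc[OF that] by (simp add: c'_eq)
      qed (use s' in simp_all)
    qed
    moreover have "c' m = \<nu>" "\<forall>a>m. c' a = (\<lambda>_. 0)" "c' 0 = c 0"
      using c_chain bm by (auto simp: chains_def c'_eq)
    ultimately show ?thesis
      using c_paired by (auto simp: pchains_def chains_def)
  qed
  show "flip n (Suc R) j c' = c"
  proof -
    have "flip n (Suc R) j x =
        x(Suc b := conjugate (toggle (Suc R) (conjugate (x b)) (conjugate (x (Suc b))) (conjugate (x (Suc (Suc b))))))" for x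
      unfolding flip_def by (simp add: jb)
    then show ?thesis using t(4) by (simp add: c'_eq)
  qed
  have rN: "Suc R \<le> 2 * n" using R by simp
  have pk': "pk c' a (Suc R) = pk c a (Suc R)" for a
    by (rule pk_cong[of "Suc R"]) (auto simp: agree)
  have sums: "(\<Sum>i\<in>{Suc R..<2 * n}. c' (Suc b) i) + (\<Sum>i\<in>{Suc R..<2 * n}. c (Suc b) i) =
      (\<Sum>i\<in>{Suc R..<2 * n}. c b i) + (\<Sum>i\<in>{Suc R..<2 * n}. c (Suc (Suc b)) i)"
    using t(5) by (simp add: c'_eq)
  have cc: "c' b = c b" "c' (Suc (Suc b)) = c (Suc (Suc b))" by (simp_all add: c'_eq)
  show "gam n c' b = gam n c (Suc b)" "gam n c' (Suc b) = gam n c b"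
    unfolding gam_def pk_total[of _ c b, OF s1 rN] pk_total[of _ c "Suc b", OF s2 rN]
      pk_total[of _ c' b, OF s'(1) rN] pk_total[of _ c' "Suc b", OF s'(2) rN] pk' cc tot
    using arg_cong[OF sums, of int] by simp_all
  show "gam n c' a = gam n c a" if "a \<noteq> b" "a \<noteq> Suc b" for a
    using that by (simp add: gam_def pk_def c'_eq)
qed

lemma flip_props:
  shows "c' \<in> pchains n m \<nu>" "\<And>b i. i \<le> R \<Longrightarrow> c' b i = c b i" "flip n (Suc R) j c' = c"
  using flip_0(1,2,3) flip_Suc(1,2,3) by (cases j; blast)+

lemma sgn_chain_flip:
  assumes "\<And>k. v k \<noteq> 0"
  shows "sgn_chain n m v c' = - sgn_chain n m v c"
proof (cases j)
  case 0
  have "sgn_chain n m v c' = dt m (\<lambda>k b. (if b = 0 then - 1 else 1) * ind v k (gam n c b))"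
    unfolding sgn_chain_def
    by (rule dt_cong) (use flip_0(4,5)[OF 0] assms in \<open>auto simp: ind_uminus\<close>)
  also have "\<dots> = (\<Prod>b<m. if b = 0 then - 1 else 1) * sgn_chain n m v c"
    unfolding sgn_chain_def by (rule dt_scale_columns)
  also have "(\<Prod>b<m. if b = 0 then - 1 else 1) = (- 1 :: int)"
    using j 0 by (simp add: prod.delta)
  finally show ?thesis by simp
next
  case (Suc b)
  let ?p = "Transposition.transpose b (Suc b)"
  have p: "?p permutes {..<m}" using j Suc by (intro permutes_swap_id) auto
  have "gam n c' a = gam n c (?p a)" for a
    using flip_Suc(4,5,6)[OF Suc] by (simp add: Transposition.transpose_def)
  then have "sgn_chain n m v c' = dt m (\<lambda>k a. ind v k (gam n c (?p a)))"
    by (simp add: sgn_chain_def)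
  also have "\<dots> = of_int (sign ?p) * sgn_chain n m v c"
    unfolding sgn_chain_def by (rule dt_permute_columns[OF p])
  finally show ?thesis by (simp add: sign_swap_id)
qed

end

section \<open>Cancellation of the chains that violate a lattice condition\<close>

definition bad :: "nat \<Rightarrow> nat \<Rightarrow> (nat \<Rightarrow> nat \<Rightarrow> nat) \<Rightarrow> bool" where
  "bad n m c \<longleftrightarrow> (\<exists>r\<le>2 * n. \<exists>j<m. violation c r j)"

definition vrow :: "nat \<Rightarrow> (nat \<Rightarrow> nat \<Rightarrow> nat) \<Rightarrow> nat" where
  "vrow m c = (LEAST r. \<exists>j<m. violation c r j)"

definition vcol :: "nat \<Rightarrow> (nat \<Rightarrow> nat \<Rightarrow> nat) \<Rightarrow> nat" where
  "vcol m c = (LEAST j. violation c (vrow m c) j)"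

text \<open>A flip preserves all rows up to the violated one, and a violation at \<open>r\<close>
  depends on the first \<open>r\<close> rows only. So the flipped chain has its first violation at
  the same place, and flipping there again restores the chain.\<close>

lemma bad_sum_zero:
  assumes \<nu>: "parts (2 * n) \<nu>" and v: "\<And>k. v k \<noteq> 0"
  shows "(\<Sum>c | c \<in> pchains n m \<nu> \<and> bad n m c. sgn_chain n m v c) = 0"
proof -
  let ?Y = "{c. c \<in> pchains n m \<nu> \<and> bad n m c}"
  define F where "F = (\<lambda>c. flip n (vrow m c) (vcol m c) c)"
  have main: "F c \<in> ?Y \<and> F (F c) = c \<and> sgn_chain n m v (F c) = - sgn_chain n m v c" if c: "c \<in> ?Y" for c
  proof -
    obtain r0 j0 where r0: "r0 \<le> 2 * n" "j0 < m" "violation c r0 j0" using c by (auto simp: bad_def)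
    let ?r = "vrow m c" and ?j = "vcol m c"
    have ex: "\<exists>j<m. violation c ?r j" unfolding vrow_def by (rule LeastI[of _ r0]) (use r0 in blast)
    have "?r \<le> r0" unfolding vrow_def by (rule Least_le) (use r0 in blast)
    with r0 have r_le: "?r \<le> 2 * n" by simp
    have less: "\<not> violation c r j" if "r < ?r" "j < m" for r j
      using not_less_Least[of r "\<lambda>r. \<exists>j<m. violation c r j"] that unfolding vrow_def by blast
    obtain j1 where j1: "j1 < m" "violation c ?r j1" using ex by blast
    have vj: "violation c ?r ?j" unfolding vcol_def by (rule LeastI[of _ j1]) (rule j1)
    have "?j \<le> j1" unfolding vcol_def by (rule Least_le) (rule j1)
    with j1 have jm: "?j < m" by simp
    have "?r \<noteq> 0"
    proof
      assume "?r = 0"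
      then show False using vj by (simp add: violation_def pk_def split: nat.splits)
    qed
    then obtain R where rR: "?r = Suc R" by (cases ?r) auto
    interpret first_violation n m \<nu> c R ?j
      by unfold_locales (use c \<nu> r_le rR jm vj less in auto)
    have F: "F c = c'" by (simp only: F_def c'_def rR)
    have agree: "violation c' r j = violation c r j" if "r \<le> Suc R" for r j
      by (rule violation_cong[of "Suc R"]) (use flip_props(2) that in auto)
    have row: "vrow m c' = ?r"
      unfolding vrow_def[of m c']
    proof (rule Least_equality)
      show "\<exists>j<m. violation c' ?r j" using agree[of ?r] rR vj jm by auto
    next
      fix r assume "\<exists>j<m. violation c' r j"
      then show "?r \<le> r" using agree[of r] less rR by (metis not_le less_imp_le_nat)
    qed
    have col: "vcol m c' = ?j"
    proof -
      have "violation c' ?r = violation c ?r" using agree[of ?r] rR by (simp add: fun_eq_iff)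
      then have "(LEAST j. violation c' ?r j) = (LEAST j. violation c ?r j)" by (simp only:)
      then show ?thesis
        unfolding vcol_def[of m c'] row by (rule trans) (rule vcol_def[symmetric])
    qed
    have "bad n m c'"
      unfolding bad_def using agree[of ?r] rR vj jm r_le by auto
    moreover have "F c' = c" by (simp only: F_def row col rR flip_props(3))
    ultimately show ?thesis
      unfolding F using flip_props(1) sgn_chain_flip[of v] v by blast
  qed
  have "(\<Sum>c\<in>?Y. sgn_chain n m v c) = (\<Sum>c\<in>?Y. - sgn_chain n m v c)"
    by (rule sum.reindex_bij_witness[of _ F F]) (use main in auto)
  then show ?thesis by (simp add: sum_negf)
qed

lemma strict_mono_permutes_id:
  assumes p: "p permutes {..<m::nat}" and mono: "\<And>i j. i < j \<Longrightarrow> j < m \<Longrightarrow> p i < p j"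
  shows "p = id"
proof -
  have ge: "i \<le> p i" if "i < m" for i
    using that
  proof (induction i)
    case (Suc i)
    then show ?case using mono[of i "Suc i"] by simp
  qed simp
  have "(\<Sum>i<m. p i) = (\<Sum>i<m. i)"
    using sum.permute[OF p, of "\<lambda>i. i"] by (simp add: o_def)
  then have "p i = i" if "i < m" for i
    using sum_mono_inv[of "\<lambda>i. i" "{..<m}" p i] ge that by auto
  then show ?thesis using permutes_not_in[OF p] by (auto simp: fun_eq_iff)
qed

text \<open>At \<open>r = 2 * n\<close> the lattice conditions make the values of \<open>gam\<close>
  negative and strictly decreasing. Since \<open>v\<close> is strictly increasing, only the identity
  permutation can contribute to the determinant.\<close>

lemma good_sgn_chain:
  assumes good: "\<not> bad n m c" and v: "\<And>i j. i < j \<Longrightarrow> j < m \<Longrightarrow> v i < v j" "\<And>k. v k \<noteq> 0"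
  shows "sgn_chain n m v c = of_bool (\<forall>b<m. gam n c b = - int (v b))"
proof -
  have step: "gam n c (Suc b) < gam n c b" if "Suc b < m" for b
  proof -
    have "\<not> violation c (2 * n) (Suc b)" using good that by (auto simp: bad_def)
    then show ?thesis by (simp add: violation_def gam_def)
  qed
  have neg0: "gam n c 0 < 0" if "0 < m"
  proof -
    have "\<not> violation c (2 * n) 0" using good that by (auto simp: bad_def)
    then show ?thesis by (simp add: violation_def gam_def)
  qed
  have neg: "gam n c b < 0" if "b < m" for b
    using that by (induction b) (use neg0 step in \<open>fastforce+\<close>)
  have mono: "gam n c b < gam n c a" if "a < b" "b < m" for a b
    using that
  proof (induction b)
    case (Suc b)
    then show ?case using step[of b] by (cases "a = b") auto
  qed simp
  have ind: "ind v k (gam n c b) = of_bool (gam n c b = - int (v k))" if "b < m" for k b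
    using neg[OF that] by (auto simp: ind_def)
  have prd: "(\<Prod>b<m. ind v (p b) (gam n c b)) = of_bool (p = id \<and> (\<forall>b<m. gam n c b = - int (v b)))"
    if p: "p permutes {..<m}" for p
  proof (cases "\<forall>b<m. gam n c b = - int (v (p b))")
    case True
    have "p i < p j" if "i < j" "j < m" for i j
    proof -
      have "v (p i) < v (p j)" using mono[OF that] True that by auto
      moreover have "p i < m" "p j < m" using permutes_in_image[OF p] that by auto
      ultimately show ?thesis using v(1) by (metis linorder_neqE_nat less_asym' order_less_irrefl)
    qed
    then have "p = id" by (rule strict_mono_permutes_id[OF p])
    then show ?thesis using True ind by simp
  next
    case False
    then obtain b where "b < m" "gam n c b \<noteq> - int (v (p b))" by blast
    then have "(\<Prod>b<m. ind v (p b) (gam n c b)) = 0"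
      using ind by (intro prod_zero) auto
    then show ?thesis using False by auto
  qed
  have "sgn_chain n m v c = (\<Sum>p | p permutes {..<m}. if p = id then of_bool (\<forall>b<m. gam n c b = - int (v b)) else 0)"
    unfolding sgn_chain_def dt_leibniz'
    by (rule sum.cong[OF refl]) (auto simp: prd sign_id)
  also have "\<dots> = of_bool (\<forall>b<m. gam n c b = - int (v b))"
    by (subst sum.delta) (auto simp: finite_permutations permutes_id)
  finally show ?thesis .
qed

theorem sum_sgn_chain:
  assumes \<nu>: "parts (2 * n) \<nu>" and v: "\<And>i j. i < j \<Longrightarrow> j < m \<Longrightarrow> v i < v j" "\<And>k. v k \<noteq> 0"
  shows "(\<Sum>c\<in>pchains n m \<nu>. sgn_chain n m v c) =
    int (card {c \<in> pchains n m \<nu>. \<not> bad n m c \<and> (\<forall>b<m. gam n c b = - int (v b))})"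
proof -
  have fin: "finite (pchains n m \<nu>)" unfolding pchains_def using finite_chains by simp
  have "(\<Sum>c\<in>pchains n m \<nu>. sgn_chain n m v c) =
      (\<Sum>c | c \<in> pchains n m \<nu> \<and> bad n m c. sgn_chain n m v c) +
      (\<Sum>c | c \<in> pchains n m \<nu> \<and> \<not> bad n m c. sgn_chain n m v c)"
    by (subst sum.union_disjoint[symmetric]) (use fin in \<open>auto intro!: sum.cong\<close>)
  also have "(\<Sum>c | c \<in> pchains n m \<nu> \<and> \<not> bad n m c. sgn_chain n m v c) =
      (\<Sum>c | c \<in> pchains n m \<nu> \<and> \<not> bad n m c. of_bool (\<forall>b<m. gam n c b = - int (v b)))"
    by (rule sum.cong) (use good_sgn_chain[of n m _ v] v in auto)
  also have "\<dots> = int (card {c \<in> pchains n m \<nu>. \<not> bad n m c \<and> (\<forall>b<m. gam n c b = - int (v b))})"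
    using fin by (simp add: of_bool_def sum.If_cases Collect_conj_eq Int_assoc) (simp add: Int_def)?
  finally show ?thesis using bad_sum_zero[OF \<nu> v(2)] by simp
qed

section \<open>Expansion of the Jacobi--Trudi determinant over chains\<close>

lemma strip_size_pk: "strip_size (2 * n) (c b) (c (Suc b)) = pk c b (2 * n)"
  by (simp add: strip_size_def pk_def)

text \<open>All entries become combinations of the same signed \<open>esym\<close> values with
  integer coefficients, the form that \<open>dt_sum_expand\<close> expands column by column.\<close>

lemma sesym_diff_expand:
  "sesym (2 * n) z (int n + int (Suc b) - int w) - sesym (2 * n) z (int n + int (Suc b) + int w) =
    (\<Sum>r\<le>2 * n. of_int (ind (\<lambda>_. w) 0 (int r - int n - int (Suc b))) * ((- 1) ^ r * esym (2 * n) z r))"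
proof -
  have g: "sesym (2 * n) z k = (\<Sum>r\<le>2 * n. of_bool (int r = k) * ((- 1) ^ r * esym (2 * n) z r))" for k
  proof (cases "0 \<le> k \<and> k \<le> int (2 * n)")
    case True
    then obtain s where s: "k = int s" "s \<le> 2 * n"
      by (metis nat_0_le of_nat_le_iff)
    have "(\<Sum>r\<le>2 * n. of_bool (int r = k) * ((- 1) ^ r * esym (2 * n) z r)) =
        (\<Sum>r\<le>2 * n. if r = s then (- 1) ^ r * esym (2 * n) z r else 0)"
      by (rule sum.cong) (auto simp: s)
    then show ?thesis using s by (simp add: sesym_def)
  next
    case False
    then have "of_bool (int r = k) * ((- 1) ^ r * esym (2 * n) z r) = 0" if "r \<in> {..2 * n}" for r
      using that by auto
    then have "(\<Sum>r\<le>2 * n. of_bool (int r = k) * ((- 1) ^ r * esym (2 * n) z r)) = 0"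
      by (intro sum.neutral) blast
    then show ?thesis using False by (auto simp: sesym_def)
  qed
  have i: "ind (\<lambda>_. w) 0 (int r - int n - int (Suc b)) =
      of_bool (int r = int n + int (Suc b) - int w) - of_bool (int r = int n + int (Suc b) + int w)" for r
    by (auto simp: ind_def of_bool_def)
  show ?thesis
    unfolding g i sum_subtractf[symmetric] by (simp add: left_diff_distrib)
qed

lemma dt_sum_expand:
  assumes "finite R"
  shows "dt m (\<lambda>k b. \<Sum>r\<in>R. of_int (h k b r) * e r) =
    (\<Sum>\<kappa>\<in>PiE {..<m} (\<lambda>_. R). of_int (dt m (\<lambda>k b. h k b (\<kappa> b))) * (\<Prod>b<m. e (\<kappa> b)))"
proof -
  have "dt m (\<lambda>k b. \<Sum>r\<in>R. of_int (h k b r) * e r) =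
      (\<Sum>p | p permutes {..<m}. of_int (sign p) * (\<Sum>\<kappa>\<in>PiE {..<m} (\<lambda>_. R). \<Prod>b<m. of_int (h (p b) b (\<kappa> b)) * e (\<kappa> b)))"
    unfolding dt_leibniz' by (subst prod_sum_PiE) (use assms in auto)
  also have "\<dots> = (\<Sum>\<kappa>\<in>PiE {..<m} (\<lambda>_. R). \<Sum>p | p permutes {..<m}. of_int (sign p) * (\<Prod>b<m. of_int (h (p b) b (\<kappa> b)) * e (\<kappa> b)))"
    unfolding sum_distrib_left by (rule sum.swap)
  also have "\<dots> = (\<Sum>\<kappa>\<in>PiE {..<m} (\<lambda>_. R). of_int (dt m (\<lambda>k b. h k b (\<kappa> b))) * (\<Prod>b<m. e (\<kappa> b)))"
    by (rule sum.cong[OF refl]) (simp add: dt_leibniz' prod.distrib sum_distrib_right mult.assoc)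
  finally show ?thesis .
qed

definition jt_det :: "nat \<Rightarrow> nat \<Rightarrow> (nat \<Rightarrow> 'a::comm_ring_1) \<Rightarrow> (nat \<Rightarrow> nat) \<Rightarrow> 'a" where
  "jt_det n m z v = dt m (\<lambda>k b. sesym (2 * n) z (int n + int (Suc b) - int (v k)) -
    sesym (2 * n) z (int n + int (Suc b) + int (v k)))"

lemma jt_det_mult_alt:
  assumes \<nu>: "parts (2 * n) \<nu>"
  shows "jt_det n m z v * alt (2 * n) z \<nu> =
    (\<Sum>c\<in>chains (2 * n) m \<nu>. of_int (sgn_chain n m v c) * (- 1) ^ (\<Sum>b<m. pk c b (2 * n)) * alt (2 * n) z (c 0))"
proof -
  let ?N = "2 * n" and ?K = "PiE {..<m} (\<lambda>_. {..2 * n})" and ?C = "chains (2 * n) m \<nu>"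
  let ?s = "\<lambda>\<kappa>. dt m (\<lambda>k b. ind v k (int (\<kappa> b) - int n - int (Suc b)))"
  let ?ok = "\<lambda>\<kappa> c. \<forall>b<m. strip_size ?N (c b) (c (Suc b)) = \<kappa> b"
  let ?t = "\<lambda>\<kappa>. of_int (?s \<kappa>) * (- 1) ^ (\<Sum>b<m. \<kappa> b) :: 'a"
  have ind: "ind (\<lambda>_. v k) 0 x = ind v k x" for k x by (simp add: ind_def)
  have "jt_det n m z v = (\<Sum>\<kappa>\<in>?K. of_int (?s \<kappa>) * (\<Prod>b<m. (- 1) ^ \<kappa> b * esym ?N z (\<kappa> b)))"
    unfolding jt_det_def sesym_diff_expand ind by (rule dt_sum_expand) simp
  also have "\<dots> = (\<Sum>\<kappa>\<in>?K. ?t \<kappa> * (\<Prod>b<m. esym ?N z (\<kappa> b)))"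
    by (simp add: prod.distrib power_sum mult.assoc)
  finally have "jt_det n m z v * alt ?N z \<nu> = (\<Sum>\<kappa>\<in>?K. ?t \<kappa> * ((\<Prod>b<m. esym ?N z (\<kappa> b)) * alt ?N z \<nu>))"
    by (simp add: sum_distrib_right mult.assoc)
  also have "\<dots> = (\<Sum>\<kappa>\<in>?K. \<Sum>c | c \<in> ?C \<and> ?ok \<kappa> c. ?t \<kappa> * alt ?N z (c 0))"
    unfolding prod_esym_mult_alt[OF \<nu>] sum_distrib_left ..
  also have "\<dots> = (\<Sum>c\<in>?C. \<Sum>\<kappa> | \<kappa> \<in> ?K \<and> ?ok \<kappa> c. ?t \<kappa> * alt ?N z (c 0))"
    by (rule sum.swap_restrict) (auto intro: finite_PiE finite_chains)
  also have "\<dots> = (\<Sum>c\<in>?C. of_int (sgn_chain n m v c) * (- 1) ^ (\<Sum>b<m. pk c b ?N) * alt ?N z (c 0))"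
  proof (rule sum.cong[OF refl])
    fix c assume c: "c \<in> ?C"
    \<comment> \<open>A chain determines its strip sizes, so exactly one choice
      \<open>\<kappa>\<close> contributes to it.\<close>
    let ?k = "restrict (\<lambda>b. pk c b ?N) {..<m}"
    have "?k \<in> ?K"
    proof
      fix b assume "b \<in> {..<m}"
      then have "vstep ?N (c b) (c (Suc b))" using chainsD(1)[OF c \<nu>] by simp
      then show "restrict (\<lambda>b. pk c b ?N) {..<m} b \<in> {..2 * n}"
        using strip_size_le[of ?N "c b" "c (Suc b)"] \<open>b \<in> {..<m}\<close> by (simp add: strip_size_pk)
    qed simp
    moreover have "\<kappa> = ?k" if "\<kappa> \<in> ?K" "?ok \<kappa> c" for \<kappa>
      by (rule ext) (use that in \<open>auto simp: strip_size_pk PiE_def extensional_def\<close>)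
    moreover have "?ok ?k c" by (simp add: strip_size_pk)
    ultimately have "{\<kappa>. \<kappa> \<in> ?K \<and> ?ok \<kappa> c} = {?k}" by blast
    moreover have "?s ?k = sgn_chain n m v c"
      unfolding sgn_chain_def gam_def by (rule dt_cong) simp
    ultimately show "(\<Sum>\<kappa> | \<kappa> \<in> ?K \<and> ?ok \<kappa> c. ?t \<kappa> * alt ?N z (c 0)) =
        of_int (sgn_chain n m v c) * (- 1) ^ (\<Sum>b<m. pk c b ?N) * alt ?N z (c 0)"
      by simp
  qed
  finally show ?thesis .
qed

lemma sum_pk_total:
  assumes "c \<in> chains (2 * n) m \<nu>" "parts (2 * n) \<nu>"
  shows "(\<Sum>b<m. pk c b (2 * n)) + (\<Sum>i<2 * n. \<nu> i) = (\<Sum>i<2 * n. c 0 i)"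
proof -
  have "b \<le> m \<Longrightarrow> (\<Sum>a<b. pk c a (2 * n)) + (\<Sum>i<2 * n. c b i) = (\<Sum>i<2 * n. c 0 i)" for b
  proof (induction b)
    case (Suc b)
    have "pk c b (2 * n) + (\<Sum>i<2 * n. c (Suc b) i) = (\<Sum>i<2 * n. c b i)"
      unfolding pk_def sum.distrib[symmetric]
      by (rule sum.cong) (use vstepD(2)[OF chainsD(1)[OF assms, of b]] Suc.prems in auto)
    then show ?case using Suc by simp
  qed simp
  from this[of m] show ?thesis using assms by (simp add: chains_def)
qed

lemma paired_sum_even: "paired p \<Longrightarrow> even (\<Sum>i<2 * n. p i :: nat)"
proof -
  assume "paired p"
  then have "(\<Sum>i<2 * n. p i) = 2 * (\<Sum>i<n. p (2 * i))"
    by (induction n) (simp_all add: paired_def)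
  then show ?thesis by simp
qed

definition good :: "nat \<Rightarrow> nat \<Rightarrow> (nat \<Rightarrow> nat) \<Rightarrow> (nat \<Rightarrow> nat) \<Rightarrow> (nat \<Rightarrow> nat \<Rightarrow> nat) set" where
  "good n m v \<nu> = {c \<in> pchains n m \<nu>. \<not> bad n m c \<and> (\<forall>b<m. gam n c b = - int (v b))}"

text \<open>The power of -1 is 1 on the chains that remain: the total number of boxes is the
  difference of the sizes of the paired \<open>c 0\<close> and of \<open>\<nu>\<close>, both
  even.\<close>

lemma sum_chains_paired:
  assumes \<nu>: "parts (2 * n) \<nu>" "even (\<Sum>i<2 * n. \<nu> i)"
    and v: "\<And>i j. i < j \<Longrightarrow> j < m \<Longrightarrow> v i < v j" "\<And>k. v k \<noteq> 0"
  shows "(\<Sum>c\<in>chains (2 * n) m \<nu>. sgn_chain n m v c * (- 1) ^ (\<Sum>b<m. pk c b (2 * n)) * of_bool (paired (c 0))) =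
    int (card (good n m v \<nu>))"
proof -
  have "(\<Sum>c\<in>chains (2 * n) m \<nu>. sgn_chain n m v c * (- 1) ^ (\<Sum>b<m. pk c b (2 * n)) * of_bool (paired (c 0))) =
      (\<Sum>c\<in>pchains n m \<nu>. sgn_chain n m v c)"
  proof (rule sum.mono_neutral_cong_right)
    fix c assume c: "c \<in> pchains n m \<nu>"
    then have "even (\<Sum>b<m. pk c b (2 * n))"
      using sum_pk_total[OF _ \<nu>(1), of c m] paired_sum_even[of "c 0" n] \<nu>(2)
      by (auto simp: pchains_def) (metis even_add)
    then show "sgn_chain n m v c * (- 1) ^ (\<Sum>b<m. pk c b (2 * n)) * of_bool (paired (c 0)) = sgn_chain n m v c"
      using c by (simp add: pchains_def)
  qed (auto simp: pchains_def finite_chains)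
  then show ?thesis using sum_sgn_chain[OF \<nu>(1) v] by (simp add: good_def)
qed

section \<open>The group ring of the weight lattice\<close>

type_synonym laurent = "weight \<Rightarrow>\<^sub>0 int"

text \<open>Sums of weights must survive simplification as elements of an additive group, because
  the rules for \<open>ex\<close> match on them.\<close>

declare fun_diff_def [simp del] func_plus [simp del] func_zero [simp del] fun_Compl_def [simp del]

abbreviation cf :: "laurent \<Rightarrow> weight \<Rightarrow> int" where "cf \<equiv> Poly_Mapping.lookup"

definition ex :: "weight \<Rightarrow> laurent" where
  "ex \<mu> = Poly_Mapping.single \<mu> 1"

lemma ex_add: "ex (\<mu> + \<nu>) = ex \<mu> * ex \<nu>"
  by (simp add: ex_def mult_single)

lemma ex_0 [simp]: "ex 0 = 1"
  by (simp add: ex_def)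

lemma ex_mult_uminus [simp]: "ex \<mu> * ex (- \<mu>) = 1"
  by (simp flip: ex_add)

lemma cf_ex: "cf (ex \<mu>) \<kappa> = of_bool (\<kappa> = \<mu>)"
  by (auto simp: ex_def lookup_single when_def)

lemma ex_power: "ex \<mu> ^ k = ex (\<lambda>i. real k * \<mu> i)"
proof (induction k)
  case 0
  have "(\<lambda>i. real 0 * \<mu> i) = 0" by (simp add: fun_eq_iff)
  then show ?case by simp
next
  case (Suc k)
  have "(\<lambda>i. real (Suc k) * \<mu> i) = \<mu> + (\<lambda>i. real k * \<mu> i)"
    by (simp add: fun_eq_iff algebra_simps)
  then show ?case using Suc by (simp add: ex_add)
qed

lemma ex_sum: "finite A \<Longrightarrow> ex (\<Sum>i\<in>A. f i) = (\<Prod>i\<in>A. ex (f i))"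
proof (induction A rule: finite_induct)
  case (insert x F)
  show ?case unfolding sum.insert[OF insert(1,2)] prod.insert[OF insert(1,2)] ex_add insert(3) ..
qed (simp only: sum.empty prod.empty ex_0)

lemma sum_fun_apply: "(\<Sum>i\<in>A. f i) k = (\<Sum>i\<in>A. f i k)" for f :: "'a \<Rightarrow> weight"
  by (induction A rule: infinite_finite_induct) auto

lemma laurent_induct [case_names zero single add]:
  fixes f :: laurent
  assumes "P 0" "\<And>k v. P (Poly_Mapping.single k v)" "\<And>f g. P f \<Longrightarrow> P g \<Longrightarrow> P (f + g)"
  shows "P f"
proof (induction f rule: update_induct)
  case const
  show ?case by (rule assms)
next
  case (update f a b)
  have "Poly_Mapping.update a b f = f + Poly_Mapping.single a b"
    using update(1) by (intro poly_mapping_eqI) (auto simp: lookup_update lookup_add lookup_single when_def in_keys_iff)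
  then show ?case using assms(2,3) update by simp
qed

lemma cf_mult_ex: "cf (f * ex \<mu>) \<kappa> = cf f (\<kappa> - \<mu>)"
proof (induction f rule: laurent_induct)
  case (single k v)
  have "k + \<mu> = \<kappa> \<longleftrightarrow> k = \<kappa> - \<mu>" by auto
  then show ?case by (simp only: ex_def mult_single lookup_single mult_1_right)
qed (simp_all only: distrib_right lookup_add mult_zero_left lookup_zero)

section \<open>Constant terms of alternants\<close>

definition scale_eps :: "real \<Rightarrow> nat \<Rightarrow> weight" where
  "scale_eps a i = (\<lambda>k. a * eps i k)"

lemma scale_eps_add: "scale_eps (a + b) i = scale_eps a i + scale_eps b i"
  by (simp add: scale_eps_def fun_eq_iff algebra_simps)

lemma ex_eps_power: "ex (eps i) ^ a = ex (scale_eps (real a) i)" "ex (- eps i) ^ a = ex (scale_eps (- real a) i)"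
  by (simp_all add: ex_power scale_eps_def)

lemma sum_scale_eps: "(\<Sum>i<n. scale_eps (c i) i) = (\<lambda>k. if k < n then c k else 0)"
proof
  fix k
  have "(\<Sum>i<n. c i * eps i k) = (\<Sum>i<n. if i = k then c i else 0)"
    by (rule sum.cong) (auto simp: eps_def)
  then show "(\<Sum>i<n. scale_eps (c i) i) k = (if k < n then c k else 0)"
    by (simp add: sum_fun_apply scale_eps_def)
qed

text \<open>Each factor involves a single variable, so taking the constant term commutes with the
  product.\<close>

lemma cf_prod_scale_eps_diff:
  "cf (\<Prod>i<n. ex (scale_eps (c i) i) - ex (scale_eps (d i) i)) 0 =
    (\<Prod>i<n. of_bool (c i = 0) - of_bool (d i = 0))"
proof -
  have s: "(\<Prod>i\<in>S. ex (scale_eps (c i) i)) * (\<Prod>i\<in>{..<n}-S. - ex (scale_eps (d i) i)) =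
      (- 1) ^ card ({..<n} - S) * ex (\<lambda>k. if k < n then (if k \<in> S then c k else d k) else 0)"
    if "S \<subseteq> {..<n}" for S
  proof -
    have "(\<Prod>i\<in>{..<n}-S. - ex (scale_eps (d i) i)) = (- 1) ^ card ({..<n} - S) * (\<Prod>i\<in>{..<n}-S. ex (scale_eps (d i) i))"
      by (rule prod_uminus)
    moreover have "(\<Prod>i\<in>S. ex (scale_eps (c i) i)) * (\<Prod>i\<in>{..<n}-S. ex (scale_eps (d i) i)) =
        (\<Prod>i<n. ex (scale_eps (if i \<in> S then c i else d i) i))"
    proof -
      have "(\<Prod>i<n. ex (scale_eps (if i \<in> S then c i else d i) i)) =
          (\<Prod>i\<in>{..<n}-S. ex (scale_eps (if i \<in> S then c i else d i) i)) * (\<Prod>i\<in>S. ex (scale_eps (if i \<in> S then c i else d i) i))"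
        by (rule prod.subset_diff[OF that]) simp
      then show ?thesis by (simp add: mult.commute)
    qed
    moreover have "(\<Prod>i<n. ex (scale_eps (if i \<in> S then c i else d i) i)) =
        ex (\<lambda>k. if k < n then (if k \<in> S then c k else d k) else 0)"
      by (simp only: ex_sum[symmetric] finite_lessThan sum_scale_eps)
    moreover have "p * q = s * t" if "q = s * q'" "p * q' = r" "r = t" for p q q' r s t :: laurent
      unfolding that(1) that(3)[symmetric] that(2)[symmetric] by (rule mult.left_commute)
    ultimately show ?thesis by blast
  qed
  have z: "cf ((- 1) ^ a * f) k = (- 1) ^ a * cf f k" for a and f :: laurent and k
    by (cases "even a") simp_all
  have zero: "(0 = (\<lambda>k. if k < n then (if k \<in> S then c k else d k) else 0)) \<longleftrightarrow>
      (\<forall>i<n. (if i \<in> S then c i else d i) = 0)" for S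
    by (auto simp: fun_eq_iff)
  have "cf (\<Prod>i<n. ex (scale_eps (c i) i) - ex (scale_eps (d i) i)) 0 =
      (\<Sum>S\<in>Pow {..<n}. (- 1) ^ card ({..<n} - S) * of_bool (\<forall>i<n. (if i \<in> S then c i else d i) = 0))"
    using prod_add[of "{..<n}" "\<lambda>i. ex (scale_eps (c i) i)" "\<lambda>i. - ex (scale_eps (d i) i)"]
    by (simp add: lookup_sum s z cf_ex zero)
  also have "\<dots> = (\<Sum>S\<in>Pow {..<n}. (\<Prod>i\<in>S. of_bool (c i = 0)) * (\<Prod>i\<in>{..<n}-S. - of_bool (d i = 0)))"
  proof (rule sum.cong[OF refl])
    fix S assume S: "S \<in> Pow {..<n}"
    have b: "(\<Prod>i\<in>A. of_bool (P i)) = (of_bool (\<forall>i\<in>A. P i) :: int)" if "finite A" for A :: "nat set" and P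
      using that by (induction A rule: finite_induct) auto
    have "finite S" using S finite_subset by auto
    then have "(\<Prod>i\<in>S. of_bool (c i = 0)) * (\<Prod>i\<in>{..<n}-S. - of_bool (d i = 0)) =
        (- 1) ^ card ({..<n} - S) * (of_bool ((\<forall>i\<in>S. c i = 0) \<and> (\<forall>i\<in>{..<n}-S. d i = 0)) :: int)"
      by (simp add: prod_uminus b)
    moreover have "(\<forall>i\<in>S. c i = 0) \<and> (\<forall>i\<in>{..<n}-S. d i = 0) \<longleftrightarrow> (\<forall>i<n. (if i \<in> S then c i else d i) = 0)"
      using S by auto
    ultimately show "(- 1) ^ card ({..<n} - S) * of_bool (\<forall>i<n. (if i \<in> S then c i else d i) = 0) =
        (\<Prod>i\<in>S. of_bool (c i = 0)) * (\<Prod>i\<in>{..<n}-S. - of_bool (d i = 0) :: int)" by simp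
  qed
  also have "\<dots> = (\<Prod>i<n. of_bool (c i = 0) - of_bool (d i = 0))"
    using prod_add[of "{..<n}" "\<lambda>i. of_bool (c i = 0) :: int" "\<lambda>i. - of_bool (d i = 0)"] by simp
  finally show ?thesis .
qed

text \<open>The only perfect matching of \<open>{..<2 * n}\<close> by neighbours is the obvious one:
  were \<open>2 * k\<close> matched with \<open>2 * k - 1\<close>, the latter would already belong
  to the preceding pair by induction.\<close>

lemma adjacent_matching:
  assumes p: "p permutes {..<2 * n}"
    and adj: "\<And>i. i < n \<Longrightarrow> p (Suc (2 * i)) = Suc (p (2 * i)) \<or> p (2 * i) = Suc (p (Suc (2 * i)))"
    and k: "k < n"
  shows "\<exists>i<n. {p (2 * i), p (Suc (2 * i))} = {2 * k, Suc (2 * k)}"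
  using k
proof (induction k rule: less_induct)
  case (less k)
  obtain a where a: "p a = 2 * k" "a < 2 * n"
    using permutes_image[OF p] less.prems by (metis (no_types, opaque_lifting) image_iff lessThan_iff mult_less_cancel1 pos2)
  define i where "i = a div 2"
  have i: "i < n" using a(2) by (simp add: i_def)
  have inj: "p u = p v \<Longrightarrow> u = v" for u v using permutes_inj[OF p] by (simp add: inj_def)
  have "a = 2 * i \<or> a = Suc (2 * i)" unfolding i_def by presburger
  then obtain b where b: "{p (2 * i), p (Suc (2 * i))} = {2 * k, p b}" "b div 2 = i" "b \<noteq> a"
      "p b = Suc (2 * k) \<or> 2 * k = Suc (p b)"
  proof
    assume "a = 2 * i"
    then show thesis using that[of "Suc (2 * i)"] a adj[OF i] by auto
  next
    assume "a = Suc (2 * i)"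
    then show thesis using that[of "2 * i"] a adj[OF i] by auto
  qed
  show ?case
  proof (cases "p b = Suc (2 * k)")
    case True
    then show ?thesis using b i by auto
  next
    case False
    with b have pb: "2 * k = Suc (p b)" by simp
    then obtain k' where k': "k = Suc k'" by (cases k) auto
    with pb have pb': "p b = Suc (2 * k')" by simp
    obtain i' where i': "i' < n" "{p (2 * i'), p (Suc (2 * i'))} = {2 * k', Suc (2 * k')}"
      using less.IH[of k'] less.prems k' by auto
    then have "p b \<in> {p (2 * i'), p (Suc (2 * i'))}" using pb' by simp
    then have "b = 2 * i' \<or> b = Suc (2 * i')" using inj by auto
    then have "i' = i" using b(2) by auto
    then have "{2 * k', Suc (2 * k')} = {2 * k, p b}" using b(1) i'(2) by simp
    then have "2 * k \<in> {2 * k', Suc (2 * k')}" by simp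
    then show ?thesis using k' by auto
  qed
qed

text \<open>A signed count of the permutations that map pairs to pairs; it is the constant term in
  \<open>ct_alt_mult\<close> for every paired partition. It stays unevaluated and cancels against
  the case of the zero partition.\<close>

definition pair_const :: "nat \<Rightarrow> int" where
  "pair_const n = (\<Sum>p | p permutes {..<2 * n}. sign p *
    (of_bool (\<forall>i<n. p (2 * i) div 2 = p (Suc (2 * i)) div 2) * (\<Prod>i<n. if even (p (2 * i)) then - 1 else 1)))"

abbreviation xv :: "nat \<Rightarrow> laurent" where "xv i \<equiv> ex (eps i)"
abbreviation xi :: "nat \<Rightarrow> laurent" where "xi i \<equiv> ex (- eps i)"
abbreviation zv :: "nat \<Rightarrow> laurent" where "zv \<equiv> interleave xv xi"

text \<open>In the Leibniz term of \<open>p\<close> the exponent of the variable \<open>x i\<close>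
  is \<open>d i\<close>, and the factor \<open>x i - 1 / x i\<close> leaves a constant term only for
  \<open>d i = 1\<close> and \<open>d i = - 1\<close>. Since \<open>l\<close> decreases at least as
  fast as the index grows, \<open>p\<close> then matches neighbours, and the unit differences force
  equal rows.\<close>

lemma pair_term:
  fixes \<beta> :: "nat \<Rightarrow> nat"
  assumes \<beta>: "parts (2 * n) \<beta>" and p: "p permutes {..<2 * n}"
  defines "l \<equiv> \<lambda>j. \<beta> j + (2 * n - 1 - j)"
  defines "d \<equiv> \<lambda>i. real (l (p (2 * i))) - real (l (p (Suc (2 * i))))"
  shows "(\<Prod>i<n. of_bool (d i + 1 = 0) - of_bool (d i - 1 = 0) :: int) =
    of_bool (paired \<beta>) * (of_bool (\<forall>i<n. p (2 * i) div 2 = p (Suc (2 * i)) div 2) * (\<Prod>i<n. if even (p (2 * i)) then - 1 else 1))"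
proof -
  have inj: "p u = p v \<longleftrightarrow> u = v" for u v using permutes_inj[OF p] by (auto simp: inj_def)
  have lt: "p j < 2 * n" if "j < 2 * n" for j using permutes_in_image[OF p] that by simp
  have anti: "antimono \<beta>" using \<beta> by (intro decseq_SucI) (simp add: parts_def)
  have ld: "l b + (b - a) \<le> l a" if "a \<le> b" "b < 2 * n" for a b
    using decseqD[OF anti that(1)] that by (simp add: l_def)
  let ?proper = "\<forall>i<n. p (2 * i) div 2 = p (Suc (2 * i)) div 2"
  show ?thesis
  proof (cases "(\<forall>i<n. d i = 1 \<or> d i = - 1)")
    case False
    then obtain i where i: "i < n" "d i \<noteq> 1" "d i \<noteq> - 1" by blast
    then have "(\<Prod>i<n. of_bool (d i + 1 = 0) - of_bool (d i - 1 = 0) :: int) = 0"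
      by (intro prod_zero) (auto intro!: bexI[of _ i])
    moreover have "\<not> (paired \<beta> \<and> ?proper)"
    proof
      assume pp: "paired \<beta> \<and> ?proper"
      let ?a = "p (2 * i)" and ?b = "p (Suc (2 * i))"
      have ab: "?a div 2 = ?b div 2" "?a \<noteq> ?b" "?a < 2 * n" "?b < 2 * n" using pp i inj lt by auto
      have "l (2 * k) = Suc (l (Suc (2 * k)))" if "k < n" for k
        using pp that by (simp add: paired_def l_def)
      from this[of "?a div 2"] have l: "l (2 * (?a div 2)) = Suc (l (Suc (2 * (?a div 2))))" using ab by simp
      have "(?a = 2 * (?a div 2) \<and> ?b = Suc (2 * (?a div 2))) \<or> (?b = 2 * (?a div 2) \<and> ?a = Suc (2 * (?a div 2)))"
        using ab(1,2) by presburger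
      then have "l ?a = Suc (l ?b) \<or> l ?b = Suc (l ?a)" using l by metis
      then have "d i = 1 \<or> d i = - 1" by (auto simp: d_def)
      then show False using i by blast
    qed
    ultimately show ?thesis by auto
  next
    case True
    have adj: "p (Suc (2 * i)) = Suc (p (2 * i)) \<or> p (2 * i) = Suc (p (Suc (2 * i)))" if i: "i < n" for i
    proof -
      let ?a = "p (2 * i)" and ?b = "p (Suc (2 * i))"
      have ab: "?a \<noteq> ?b" "?a < 2 * n" "?b < 2 * n" using i inj lt by auto
      have "l ?a = Suc (l ?b) \<or> l ?b = Suc (l ?a)" using True i by (auto simp: d_def)
      moreover have "x = Suc y \<or> y = Suc x"
        if "lx = Suc ly \<or> ly = Suc lx" "x \<noteq> y" "x \<le> y \<Longrightarrow> ly + (y - x) \<le> lx" "y \<le> x \<Longrightarrow> lx + (x - y) \<le> ly"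
        for x y lx ly :: nat
        using that by (cases "x \<le> y") auto
      ultimately have "?a = Suc ?b \<or> ?b = Suc ?a"
        using ab ld[of ?a ?b] ld[of ?b ?a] by blast
      then show ?thesis by blast
    qed
    have match: "\<exists>i<n. {p (2 * i), p (Suc (2 * i))} = {2 * k, Suc (2 * k)}" if "k < n" for k
      by (rule adjacent_matching[OF p _ that]) (rule adj)
    have proper: "?proper"
    proof (intro allI impI)
      fix i assume i: "i < n"
      let ?k = "p (2 * i) div 2"
      have "p (2 * i) div 2 < n" using lt[of "2 * i"] i by simp
      then obtain i' where i': "i' < n"
        "{p (2 * i'), p (Suc (2 * i'))} = {2 * (p (2 * i) div 2), Suc (2 * (p (2 * i) div 2))}"
        using match by blast
      have "p (2 * i) = 2 * ?k \<or> p (2 * i) = Suc (2 * ?k)" by presburger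
      then have "p (2 * i) \<in> {2 * (p (2 * i) div 2), Suc (2 * (p (2 * i) div 2))}" by blast
      then have "p (2 * i) \<in> {p (2 * i'), p (Suc (2 * i'))}" by (simp only: i'(2))
      then have "p (2 * i) = p (2 * i') \<or> p (2 * i) = p (Suc (2 * i'))" by blast
      then have "2 * i = 2 * i' \<or> 2 * i = Suc (2 * i')" by (simp only: inj)
      then have "i' = i" by presburger
      then have "p (Suc (2 * i)) \<in> {p (2 * i'), p (Suc (2 * i'))}" by simp
      then have "p (Suc (2 * i)) \<in> {2 * (p (2 * i) div 2), Suc (2 * (p (2 * i) div 2))}" by (simp only: i'(2))
      then have "p (Suc (2 * i)) = 2 * ?k \<or> p (Suc (2 * i)) = Suc (2 * ?k)" by blast
      then show "p (2 * i) div 2 = p (Suc (2 * i)) div 2" by presburger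
    qed
    have lpair: "l (2 * k) = Suc (l (Suc (2 * k)))" if k: "k < n" for k
    proof -
      obtain i where i: "i < n" "{p (2 * i), p (Suc (2 * i))} = {2 * k, Suc (2 * k)}" using match[OF k] by blast
      then have "(p (2 * i) = 2 * k \<and> p (Suc (2 * i)) = Suc (2 * k)) \<or> (p (2 * i) = Suc (2 * k) \<and> p (Suc (2 * i)) = 2 * k)"
        by (auto simp: doubleton_eq_iff)
      moreover have "l (2 * k) > l (Suc (2 * k))" using ld[of "2 * k" "Suc (2 * k)"] k by simp
      moreover have "l (p (2 * i)) = Suc (l (p (Suc (2 * i)))) \<or> l (p (Suc (2 * i))) = Suc (l (p (2 * i)))"
        using True i(1) by (auto simp: d_def)
      ultimately show ?thesis by auto
    qed
    have "paired \<beta>"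
      unfolding paired_def
    proof
      fix k
      show "\<beta> (2 * k) = \<beta> (Suc (2 * k))"
      proof (cases "k < n")
        case True
        then show ?thesis using lpair[OF True] by (simp add: l_def)
      next
        case False
        then show ?thesis using \<beta> by (simp add: parts_def)
      qed
    qed
    moreover have "(\<Prod>i<n. of_bool (d i + 1 = 0) - of_bool (d i - 1 = 0) :: int) = (\<Prod>i<n. if even (p (2 * i)) then - 1 else 1)"
    proof (rule prod.cong[OF refl])
      fix i assume "i \<in> {..<n}"
      then have i: "i < n" by simp
      let ?a = "p (2 * i)" and ?b = "p (Suc (2 * i))"
      have ab: "?a div 2 = ?b div 2" "?a \<noteq> ?b" "?a < 2 * n" using proper i inj lt by auto
      have l: "l (2 * (?a div 2)) = Suc (l (Suc (2 * (?a div 2))))" using lpair[of "?a div 2"] ab by simp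
      show "of_bool (d i + 1 = 0) - of_bool (d i - 1 = 0) = (if even ?a then - 1 else (1 :: int))"
      proof (cases "even ?a")
        case True
        have "?a = 2 * (?a div 2)" "?b = Suc (2 * (?a div 2))" using ab(1,2) True by presburger+
        then have "l ?a = Suc (l ?b)" using l by (simp only:)
        then have "d i = 1" by (simp add: d_def)
        then show ?thesis using True by simp
      next
        case False
        have "?a = Suc (2 * (?a div 2))" "?b = 2 * (?a div 2)" using ab(1,2) False by presburger+
        then have "l ?b = Suc (l ?a)" using l by (simp only:)
        then have "d i = - 1" by (simp add: d_def)
        then show ?thesis using False by simp
      qed
    qed
    ultimately show ?thesis using proper by simp
  qed
qed

lemma cf_of_int_mult: "cf (of_int a * g) \<kappa> = a * cf g \<kappa>"
proof -
  have "of_int a = (Poly_Mapping.single 0 a :: laurent)" by (simp add: single_of_int[symmetric])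
  then show ?thesis
    by (induction g rule: laurent_induct) (simp_all add: distrib_left lookup_add mult_single lookup_single when_def)
qed

lemma ct_alt_mult:
  assumes \<beta>: "parts (2 * n) \<beta>"
  shows "cf (alt (2 * n) zv \<beta> * (\<Prod>i<n. xv i - xi i)) 0 = of_bool (paired \<beta>) * pair_const n"
proof -
  let ?l = "\<lambda>j. \<beta> j + (2 * n - 1 - j)"
  let ?d = "\<lambda>p i. real (?l (p (2 * i))) - real (?l (p (Suc (2 * i))))"
  have prd: "(\<Prod>k<2 * n. zv k ^ ?l (p k)) * (\<Prod>i<n. xv i - xi i) =
      (\<Prod>i<n. ex (scale_eps (?d p i + 1) i) - ex (scale_eps (?d p i - 1) i))" for p
    unfolding prod_lessThan_double prod.distrib[symmetric]
  proof (rule prod.cong[OF refl])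
    fix i
    have x: "xv i = ex (scale_eps 1 i)" "xi i = ex (scale_eps (- 1) i)"
      using ex_eps_power[of i 1] by simp_all
    have "zv (2 * i) ^ a * zv (Suc (2 * i)) ^ b = ex (scale_eps (real a - real b) i)" for a b
      by (simp only: interleave_simps ex_eps_power ex_add[symmetric] scale_eps_add[symmetric]) (simp add: scale_eps_def)
    moreover have "ex (scale_eps a i) * (xv i - xi i) = ex (scale_eps (a + 1) i) - ex (scale_eps (a - 1) i)" for a
      unfolding x right_diff_distrib ex_add[symmetric] scale_eps_add[symmetric] by simp
    ultimately show "zv (2 * i) ^ ?l (p (2 * i)) * zv (Suc (2 * i)) ^ ?l (p (Suc (2 * i))) * (xv i - xi i) =
        ex (scale_eps (?d p i + 1) i) - ex (scale_eps (?d p i - 1) i)" by (simp only:)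
  qed
  have "cf (alt (2 * n) zv \<beta> * (\<Prod>i<n. xv i - xi i)) 0 =
      (\<Sum>p | p permutes {..<2 * n}. sign p * (\<Prod>i<n. of_bool (?d p i + 1 = 0) - of_bool (?d p i - 1 = 0)))"
    unfolding alt_def dt_leibniz sum_distrib_right mult.assoc prd lookup_sum cf_of_int_mult cf_prod_scale_eps_diff ..
  also have "\<dots> = (\<Sum>p | p permutes {..<2 * n}. of_bool (paired \<beta>) * (sign p *
    (of_bool (\<forall>i<n. p (2 * i) div 2 = p (Suc (2 * i)) div 2) * (\<Prod>i<n. if even (p (2 * i)) then - 1 else 1))))"
    by (rule sum.cong[OF refl]) (use pair_term[OF \<beta>] in \<open>simp add: mult_ac\<close>)
  finally show ?thesis by (simp add: pair_const_def sum_distrib_left)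
qed

section \<open>The Weyl group as the group of signed permutations\<close>

text \<open>Acting by precomposition with \<open>p\<close> reverses the order of composition of the
  permutations, as \<open>gact_comp\<close> shows.\<close>

definition gact :: "(nat \<Rightarrow> nat) \<Rightarrow> (nat \<Rightarrow> int) \<Rightarrow> weight \<Rightarrow> weight" where
  "gact p s v = (\<lambda>k. of_int (s k) * v (p k))"

definition signs :: "nat \<Rightarrow> (nat \<Rightarrow> int) set" where
  "signs n = {s. (\<forall>k. s k = 1 \<or> s k = - 1) \<and> (\<forall>k\<ge>n. s k = 1)}"

definition hyper :: "nat \<Rightarrow> ((nat \<Rightarrow> nat) \<times> (nat \<Rightarrow> int)) set" where
  "hyper n = {(p, s). p permutes {..<n} \<and> s \<in> signs n}"

text \<open>The determinant of the signed permutation matrix.\<close>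

definition hsign :: "nat \<Rightarrow> (nat \<Rightarrow> nat) \<Rightarrow> (nat \<Rightarrow> int) \<Rightarrow> int" where
  "hsign n p s = sign p * (\<Prod>k<n. s k)"

lemma gact_comp: "gact p s \<circ> gact q r = gact (q \<circ> p) (\<lambda>k. s k * r (p k))"
  by (simp add: gact_def fun_eq_iff)

lemma gact_id: "gact id (\<lambda>_. 1) = id"
  by (simp add: gact_def fun_eq_iff)

lemma gact_inj:
  assumes "(p, s) \<in> hyper n" "(q, r) \<in> hyper n" "gact p s = gact q r"
  shows "p = q \<and> s = r"
proof -
  have e: "of_int (s k) * v (p k) = of_int (r k) * v (q k)" for v :: weight and k
    using fun_cong[OF fun_cong[OF assms(3), of v], of k] by (simp add: gact_def)
  have s: "s k = r k" for k using e[of k "\<lambda>_. 1"] by simp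
  have r: "r k \<noteq> 0" for k using assms(2) by (auto simp: hyper_def signs_def dest: spec[of _ k])
  have "p k = q k" for k
    using e[of k "\<lambda>i. if i = p k then 1 else 0"] s[of k] r[of k] by (auto split: if_splits)
  then show ?thesis using s by auto
qed

lemma hyper_comp:
  assumes "(p, s) \<in> hyper n" "(q, r) \<in> hyper n"
  shows "(q \<circ> p, \<lambda>k. s k * r (p k)) \<in> hyper n"
    and "hsign n (q \<circ> p) (\<lambda>k. s k * r (p k)) = hsign n p s * hsign n q r"
proof -
  have p: "p permutes {..<n}" and q: "q permutes {..<n}" and s: "s \<in> signs n" and r: "r \<in> signs n"
    using assms by (auto simp: hyper_def)
  have "p k = k" if "k \<ge> n" for k using p that by (simp add: permutes_def)
  moreover have "s k * r (p k) = 1 \<or> s k * r (p k) = - 1" for k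
  proof -
    have "s k = 1 \<or> s k = - 1" "r (p k) = 1 \<or> r (p k) = - 1" using s r unfolding signs_def by blast+
    then show ?thesis by auto
  qed
  ultimately have "(\<lambda>k. s k * r (p k)) \<in> signs n" using s r by (auto simp: signs_def)
  then show "(q \<circ> p, \<lambda>k. s k * r (p k)) \<in> hyper n"
    using p q by (auto simp: hyper_def intro: permutes_compose)
  have "(\<Prod>k<n. r (p k)) = (\<Prod>k<n. r k)"
    using prod.permute[OF p, of r] by (simp add: comp_def)
  moreover have "sign (q \<circ> p) = sign q * sign p"
    by (rule sign_compose) (use p q in \<open>auto simp: permutation_permutes\<close>)
  ultimately show "hsign n (q \<circ> p) (\<lambda>k. s k * r (p k)) = hsign n p s * hsign n q r"
    by (simp add: hsign_def prod.distrib mult_ac)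
qed

definition flip1 :: "nat \<Rightarrow> nat \<Rightarrow> int" where
  "flip1 i = (\<lambda>k. if k = i then - 1 else 1)"

lemma
  shows hyper_id: "(id, \<lambda>_. 1) \<in> hyper n"
    and hyper_transpose: "i < n \<Longrightarrow> j < n \<Longrightarrow> (Transposition.transpose i j, \<lambda>_. 1) \<in> hyper n"
    and hyper_flip1: "i < n \<Longrightarrow> (id, flip1 i) \<in> hyper n"
  by (auto simp: hyper_def signs_def flip1_def permutes_id permutes_swap_id)

lemma reflection_minus:
  assumes "i < j" "j < n"
  shows "reflection n (eps i - eps j) = gact (Transposition.transpose i j) (\<lambda>_. 1)"
proof (rule ext, rule ext)
  fix v k
  have "inner_prod n u (eps i - eps j) = u i - u j" for u
    using assms by (simp add: inner_prod_diff inner_prod_eps)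
  then show "reflection n (eps i - eps j) v k = gact (Transposition.transpose i j) (\<lambda>_. 1) v k"
    using assms by (simp add: reflection_def gact_def Transposition.transpose_def eps_def diff_divide_distrib add_divide_distrib)
qed

lemma reflection_plus:
  assumes "i < j" "j < n"
  shows "reflection n (eps i + eps j) = gact (Transposition.transpose i j) (\<lambda>k. if k = i \<or> k = j then - 1 else 1)"
proof (rule ext, rule ext)
  fix v k
  have "inner_prod n u (eps i + eps j) = u i + u j" for u
    using assms by (simp add: inner_prod_add inner_prod_eps)
  then show "reflection n (eps i + eps j) v k =
      gact (Transposition.transpose i j) (\<lambda>k. if k = i \<or> k = j then - 1 else 1) v k"
    using assms by (simp add: reflection_def gact_def Transposition.transpose_def eps_def diff_divide_distrib add_divide_distrib)
qed

lemma reflection_long: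
  assumes "i < n"
  shows "reflection n (eps i + eps i) = gact id (flip1 i)"
proof (rule ext, rule ext)
  fix v k
  have "inner_prod n u (eps i + eps i) = 2 * u i" for u
    unfolding inner_prod_add using assms by (simp add: inner_prod_eps)
  moreover have "(eps i + eps i) k = (if k = i then 2 else 0)" for k
    unfolding plus_fun_def by (simp add: eps_def)
  ultimately show "reflection n (eps i + eps i) v k = gact id (flip1 i) v k"
    unfolding reflection_def by (simp add: gact_def flip1_def)
qed

definition words :: "nat \<Rightarrow> (weight \<Rightarrow> weight) set" where
  "words n = {foldr (\<lambda>\<alpha> u. reflection n \<alpha> \<circ> u) \<alpha>s id | \<alpha>s. set \<alpha>s \<subseteq> simple_roots n}"

lemma words_id: "id \<in> words n"
  unfolding words_def by (rule CollectI, rule exI[of _ "[]"]) simp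

lemma words_comp:
  assumes "w \<in> words n" "u \<in> words n"
  shows "w \<circ> u \<in> words n"
proof -
  obtain as bs where ab: "set as \<subseteq> simple_roots n" "set bs \<subseteq> simple_roots n"
      "w = foldr (\<lambda>\<alpha> u. reflection n \<alpha> \<circ> u) as id" "u = foldr (\<lambda>\<alpha> u. reflection n \<alpha> \<circ> u) bs id"
    using assms by (auto simp: words_def)
  have "foldr (\<lambda>\<alpha> u. reflection n \<alpha> \<circ> u) as id \<circ> u = foldr (\<lambda>\<alpha> u. reflection n \<alpha> \<circ> u) as u"
      for u :: "weight \<Rightarrow> weight"
  proof (induction as)
    case (Cons a as)
    let ?F = "\<lambda>\<alpha> u. reflection n \<alpha> \<circ> u"
    have "foldr ?F (a # as) id \<circ> u = reflection n a \<circ> (foldr ?F as id \<circ> u)" by (rule ext) simp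
    also have "\<dots> = foldr ?F (a # as) u" unfolding Cons by (rule ext) simp
    finally show ?case .
  qed simp
  then have "w \<circ> u = foldr (\<lambda>\<alpha> u. reflection n \<alpha> \<circ> u) (as @ bs) id"
    by (simp only: ab(3,4) foldr_append o_apply)
  then show ?thesis unfolding words_def using ab(1,2)
    by (intro CollectI exI[of _ "as @ bs"]) auto
qed

lemma words_simple: "\<alpha> \<in> simple_roots n \<Longrightarrow> reflection n \<alpha> \<in> words n"
  unfolding words_def by (rule CollectI, rule exI[of _ "[\<alpha>]"]) simp

lemma words_transpose: "i < j \<Longrightarrow> j < n \<Longrightarrow> gact (Transposition.transpose i j) (\<lambda>_. 1) \<in> words n"
proof (induction j)
  case (Suc j)
  have adj: "gact (Transposition.transpose j (Suc j)) (\<lambda>_. 1) \<in> words n"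
    using Suc.prems reflection_minus[of j "Suc j" n] words_simple[of "eps j - eps (Suc j)" n]
    by (auto simp: simple_roots_def)
  show ?case
  proof (cases "i = j")
    case False
    then have i: "gact (Transposition.transpose i j) (\<lambda>_. 1) \<in> words n" using Suc by simp
    have "Transposition.transpose i (Suc j) =
        Transposition.transpose j (Suc j) \<circ> (Transposition.transpose i j \<circ> Transposition.transpose j (Suc j))"
      using False Suc.prems by (auto simp: fun_eq_iff Transposition.transpose_def)
    then have "gact (Transposition.transpose i (Suc j)) (\<lambda>_. 1) =
        gact (Transposition.transpose j (Suc j)) (\<lambda>_. 1) \<circ> gact (Transposition.transpose i j) (\<lambda>_. 1) \<circ>
        gact (Transposition.transpose j (Suc j)) (\<lambda>_. 1)"
      by (simp add: gact_comp comp_assoc)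
    then show ?thesis by (simp only:) (intro words_comp i adj)
  qed (use adj in simp)
qed simp

lemma words_flip1:
  assumes i: "i < n"
  shows "gact id (flip1 i) \<in> words n"
proof -
  define l where "l = n - 1"
  have l: "l < n" "Suc l = n" using i by (auto simp: l_def)
  have last: "gact id (flip1 l) \<in> words n"
    using reflection_long[OF l(1)] words_simple[of "eps l + eps l" n] l by (auto simp: simple_roots_def)
  show ?thesis
  proof (cases "i = l")
    case False
    then have t: "gact (Transposition.transpose i l) (\<lambda>_. 1) \<in> words n" using words_transpose[of i l n] l i by simp
    have "gact id (flip1 i) = gact (Transposition.transpose i l) (\<lambda>_. 1) \<circ> gact id (flip1 l) \<circ> gact (Transposition.transpose i l) (\<lambda>_. 1)"
      using False by (auto simp: gact_comp gact_def flip1_def fun_eq_iff Transposition.transpose_def)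
    then show ?thesis by (simp only:) (intro words_comp t last)
  qed (use last in simp)
qed

text \<open>Conjugation carries adjacent transpositions to all transpositions and the last sign
  change to all sign changes.\<close>

lemma words_hyper:
  assumes "(p, s) \<in> hyper n"
  shows "gact p s \<in> words n"
proof -
  have p: "p permutes {..<n}" and s: "s \<in> signs n" using assms by (auto simp: hyper_def)
  have "gact p (\<lambda>_. 1) \<in> words n"
    using p finite_lessThan
  proof (induction p rule: permutes_induct)
    case id
    show ?case unfolding gact_id by (rule words_id)
  next
    case (swap a b p)
    have "gact (Transposition.transpose a b) (\<lambda>_. 1) \<in> words n"
    proof (cases a b rule: linorder_cases)
      case less
      then show ?thesis using words_transpose[of a b n] swap by simp
    next
      case greater
      then show ?thesis using words_transpose[of b a n] swap by (simp add: transpose_commute)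
    qed (simp only: transpose_same gact_id words_id)
    moreover have "gact (Transposition.transpose a b \<circ> p) (\<lambda>_. 1) = gact p (\<lambda>_. 1) \<circ> gact (Transposition.transpose a b) (\<lambda>_. 1)"
      by (simp add: gact_comp)
    ultimately show ?case by (simp only:) (intro words_comp swap)
  qed
  moreover have "gact id (\<lambda>k. if k \<in> A then - 1 else 1) \<in> words n" if "finite A" "A \<subseteq> {..<n}" for A
    using that
  proof (induction A rule: finite_induct)
    case empty
    show ?case by (simp only: empty_iff if_False gact_id words_id)
  next
    case (insert a A)
    have "gact id (\<lambda>k. if k \<in> insert a A then - 1 else 1) = gact id (flip1 a) \<circ> gact id (\<lambda>k. if k \<in> A then - 1 else 1)"
      using insert.hyps(2) by (auto simp: gact_comp gact_def flip1_def fun_eq_iff)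
    then show ?case
      by (simp only:) (intro words_comp words_flip1 insert.IH, use insert.prems in auto)
  qed
  note signs = this
  have "gact id s \<in> words n"
  proof -
    have "s = (\<lambda>k. if k \<in> {k. k < n \<and> s k = - 1} then - 1 else 1)"
      using s by (auto simp: signs_def fun_eq_iff not_less)
    then have "gact id s = gact id (\<lambda>k. if k \<in> {k. k < n \<and> s k = - 1} then - 1 else 1)"
      by (rule arg_cong)
    then show ?thesis using signs[of "{k. k < n \<and> s k = - 1}"] by (simp only:) auto
  qed
  moreover have "gact p s = gact id s \<circ> gact p (\<lambda>_. 1)"
    by (simp add: gact_comp)
  ultimately show ?thesis by (simp only:) (rule words_comp)
qed

lemma simple_roots_hyper:
  assumes "\<alpha> \<in> simple_roots n"
  shows "\<exists>p s. (p, s) \<in> hyper n \<and> reflection n \<alpha> = gact p s \<and> hsign n p s = - 1"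
proof -
  consider i where "Suc i < n" "\<alpha> = eps i - eps (Suc i)" | i where "Suc i = n" "\<alpha> = eps i + eps i"
    using assms by (auto simp: simple_roots_def)
  then show ?thesis
  proof cases
    case 1
    then show ?thesis
      using reflection_minus[of i "Suc i" n] hyper_transpose[of i n "Suc i"]
      by (intro exI[of _ "Transposition.transpose i (Suc i)"] exI[of _ "\<lambda>_. 1"]) (simp add: hsign_def sign_swap_id)
  next
    case 2
    then have "(\<Prod>k<n. flip1 i k) = - 1" by (auto simp: flip1_def)
    then show ?thesis
      using 2 reflection_long[of i n] hyper_flip1[of i n]
      by (intro exI[of _ id] exI[of _ "flip1 i"]) (auto simp: hsign_def)
  qed
qed

text \<open>\<open>hsign\<close> is multiplicative and equals -1 on simple reflections, so the
  product of a word determines the parity of its length.\<close>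

lemma word_hyper:
  "set \<alpha>s \<subseteq> simple_roots n \<Longrightarrow> \<exists>p s. (p, s) \<in> hyper n \<and>
    foldr (\<lambda>\<alpha> u. reflection n \<alpha> \<circ> u) \<alpha>s id = gact p s \<and> hsign n p s = (- 1) ^ length \<alpha>s"
proof (induction \<alpha>s)
  case Nil
  show ?case
  proof (intro exI conjI)
    show "(id, \<lambda>_. 1) \<in> hyper n" by (rule hyper_id)
    show "foldr (\<lambda>\<alpha> u. reflection n \<alpha> \<circ> u) [] id = gact id (\<lambda>_. 1)"
      by (simp only: foldr.simps id_apply gact_id)
  qed (simp add: hsign_def)
next
  case (Cons \<alpha> \<alpha>s)
  have sub: "\<alpha> \<in> simple_roots n" "set \<alpha>s \<subseteq> simple_roots n" using Cons.prems by auto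
  obtain q r where qr: "(q, r) \<in> hyper n" "foldr (\<lambda>\<alpha> u. reflection n \<alpha> \<circ> u) \<alpha>s id = gact q r"
      "hsign n q r = (- 1) ^ length \<alpha>s"
    using Cons.IH[OF sub(2)] by (elim exE conjE) (rule that)
  obtain p s where ps: "(p, s) \<in> hyper n" "reflection n \<alpha> = gact p s" "hsign n p s = - 1"
    using simple_roots_hyper[OF sub(1)] by (elim exE conjE) (rule that)
  show ?case
  proof (intro exI conjI)
    show "(q \<circ> p, \<lambda>k. s k * r (p k)) \<in> hyper n" by (rule hyper_comp(1)[OF ps(1) qr(1)])
    show "foldr (\<lambda>\<alpha> u. reflection n \<alpha> \<circ> u) (\<alpha> # \<alpha>s) id = gact (q \<circ> p) (\<lambda>k. s k * r (p k))"
      by (simp only: foldr.simps o_apply qr(2) ps(2) gact_comp)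
    show "hsign n (q \<circ> p) (\<lambda>k. s k * r (p k)) = (- 1) ^ length (\<alpha> # \<alpha>s)"
      using hyper_comp(2)[OF ps(1) qr(1)] by (simp add: ps(3) qr(3))
  qed
qed

lemma weyl_group_eq: "weyl_group n = (\<lambda>(p, s). gact p s) ` hyper n"
proof
  show "weyl_group n \<subseteq> (\<lambda>(p, s). gact p s) ` hyper n"
  proof
    fix w assume "w \<in> weyl_group n"
    then show "w \<in> (\<lambda>(p, s). gact p s) ` hyper n"
    proof induction
      case one
      show ?case using hyper_id[of n] gact_id by (metis (no_types, lifting) case_prod_conv image_eqI)
    next
      case (mult \<alpha> w)
      then obtain q r where qr: "(q, r) \<in> hyper n" "w = gact q r" by auto
      have "\<exists>p s. (p, s) \<in> hyper n \<and> reflection n \<alpha> = gact p s"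
        using mult.hyps(1)
      proof (cases rule: pos_roots_cases)
        case (minus i j)
        then show ?thesis using reflection_minus[of i j n] hyper_transpose[of i n j] by auto
      next
        case (plus i j)
        then have "(Transposition.transpose i j, \<lambda>k. if k = i \<or> k = j then - 1 else 1) \<in> hyper n"
          by (auto simp: hyper_def signs_def permutes_swap_id)
        then show ?thesis using reflection_plus[of i j n] plus by blast
      next
        case (long i)
        then show ?thesis using reflection_long[of i n] hyper_flip1[of i n] by auto
      qed
      then obtain p s where ps: "(p, s) \<in> hyper n" "reflection n \<alpha> = gact p s" by blast
      show ?case using hyper_comp(1)[OF ps(1) qr(1)] by (force simp: qr(2) ps(2) gact_comp)
    qed
  qed
  have gen: "w \<in> weyl_group n" if "w \<in> words n" for w
  proof -
    obtain \<alpha>s where \<alpha>s: "set \<alpha>s \<subseteq> simple_roots n" "w = foldr (\<lambda>\<alpha> u. reflection n \<alpha> \<circ> u) \<alpha>s id"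
      using \<open>w \<in> words n\<close> by (auto simp: words_def)
    have "simple_roots n \<subseteq> pos_roots n"
      by (auto simp: simple_roots_def pos_roots_def)
    with \<alpha>s(1) show ?thesis unfolding \<alpha>s(2)
      by (induction \<alpha>s) (auto intro: weyl_group.intros)
  qed
  show "(\<lambda>(p, s). gact p s) ` hyper n \<subseteq> weyl_group n"
    using words_hyper gen by auto
qed

text \<open>The \<open>LEAST\<close> in \<open>weyl_length\<close> needs some word to exist, which
  is \<open>words_hyper\<close>; after that only parity enters.\<close>

lemma weyl_length_sign:
  assumes ps: "(p, s) \<in> hyper n"
  shows "(- 1) ^ weyl_length n (gact p s) = hsign n p s"
proof -
  define P where "P = (\<lambda>k. \<exists>\<alpha>s. length \<alpha>s = k \<and> set \<alpha>s \<subseteq> simple_roots n \<and>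
      gact p s = foldr (\<lambda>\<alpha> u. reflection n \<alpha> \<circ> u) \<alpha>s id)"
  have "\<exists>k. P k"
    using words_hyper[OF ps] by (auto simp: words_def P_def)
  then have "P (weyl_length n (gact p s))"
    unfolding weyl_length_def P_def[symmetric] by (rule LeastI_ex)
  then obtain \<beta>s where \<beta>s: "length \<beta>s = weyl_length n (gact p s)" "set \<beta>s \<subseteq> simple_roots n"
      "gact p s = foldr (\<lambda>\<alpha> u. reflection n \<alpha> \<circ> u) \<beta>s id"
    unfolding P_def by (elim exE conjE) (rule that)
  obtain q r where qr: "(q, r) \<in> hyper n" "foldr (\<lambda>\<alpha> u. reflection n \<alpha> \<circ> u) \<beta>s id = gact q r"
      "hsign n q r = (- 1) ^ length \<beta>s"
    using word_hyper[OF \<beta>s(2)] by blast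
  have "p = q \<and> s = r" by (rule gact_inj[OF ps qr(1)]) (rule trans[OF \<beta>s(3) qr(2)])
  then show ?thesis using qr(3) \<beta>s(1) by simp
qed

lemma finite_hyper: "finite (hyper n)"
proof (rule inj_on_finite)
  show "inj_on (\<lambda>(p, s). gact p s) (hyper n)"
    using gact_inj by (fastforce simp: inj_on_def)
  show "(\<lambda>(p, s). gact p s) ` hyper n \<subseteq> weyl_group n" by (simp add: weyl_group_eq)
  show "finite (weyl_group n)" by (rule finite_weyl_group)
qed

lemma sum_weyl_group:
  "(\<Sum>w\<in>weyl_group n. (- 1) ^ weyl_length n w * f w) = (\<Sum>(p, s)\<in>hyper n. of_int (hsign n p s) * f (gact p s))"
    for f :: "_ \<Rightarrow> 'b::comm_ring_1"
proof -
  have inj: "inj_on (\<lambda>(p, s). gact p s) (hyper n)"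
    using gact_inj by (fastforce simp: inj_on_def)
  have "(- 1) ^ weyl_length n (gact p s) = (of_int (hsign n p s) :: 'b)" if "(p, s) \<in> hyper n" for p s
    by (simp flip: weyl_length_sign[OF that])
  then show ?thesis
    unfolding weyl_group_eq sum.reindex[OF inj]
    by (intro sum.cong) auto
qed

section \<open>Roots and the Kostant partition function\<close>

definition zsg :: "nat \<Rightarrow> int" where "zsg a = (if even a then 1 else - 1)"

text \<open>The weight of the variable \<open>zv a\<close>: even indices belong to the
  \<open>x i\<close>, odd ones to their inverses.\<close>

definition zwt :: "nat \<Rightarrow> weight" where "zwt a = (\<lambda>k. if k = a div 2 then of_int (zsg a) else 0)"

text \<open>The products of two variables are the exponentials of roots, except for a variable times
  its own inverse.\<close>

definition root_pairs :: "nat \<Rightarrow> (nat \<times> nat) set" where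
  "root_pairs n = {(a, b). a \<le> b \<and> b < 2 * n \<and> (a div 2 = b div 2 \<longrightarrow> a = b)}"

definition all_roots :: "nat \<Rightarrow> weight set" where
  "all_roots n = {zwt a + zwt b | a b. a < 2 * n \<and> b < 2 * n \<and> (a div 2 = b div 2 \<longrightarrow> a = b)}"

lemma zwt_double: "zwt (2 * i) = eps i" "zwt (Suc (2 * i)) = - eps i"
  by (auto simp: zwt_def zsg_def eps_def fun_eq_iff)

lemma zv_eq: "zv a = ex (zwt a)"
proof (cases "even a")
  case True
  then obtain i where "a = 2 * i" by blast
  then show ?thesis by (simp add: zwt_double)
next
  case False
  then obtain i where "a = Suc (2 * i)" by (auto elim: oddE)
  then show ?thesis by (simp add: zwt_double)
qed

lemma all_roots_image: "all_roots n = (\<lambda>(a, b). zwt a + zwt b) ` root_pairs n"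
proof
  show "all_roots n \<subseteq> (\<lambda>(a, b). zwt a + zwt b) ` root_pairs n"
  proof
    fix \<alpha> assume "\<alpha> \<in> all_roots n"
    then obtain a b where ab: "\<alpha> = zwt a + zwt b" "a < 2 * n" "b < 2 * n" "a div 2 = b div 2 \<longrightarrow> a = b"
      unfolding all_roots_def by blast
    show "\<alpha> \<in> (\<lambda>(a, b). zwt a + zwt b) ` root_pairs n"
    proof (cases "a \<le> b")
      case True
      then show ?thesis using ab by (intro image_eqI[of _ _ "(a, b)"]) (auto simp: root_pairs_def)
    next
      case False
      then show ?thesis using ab by (intro image_eqI[of _ _ "(b, a)"]) (auto simp: root_pairs_def add.commute)
    qed
  qed
  show "(\<lambda>(a, b). zwt a + zwt b) ` root_pairs n \<subseteq> all_roots n"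
    unfolding all_roots_def root_pairs_def by fastforce
qed

text \<open>The pair can be recovered from the weight: \<open>x\<close> belongs to it exactly when
  the coordinate \<open>x div 2\<close> is nonzero and has the sign of \<open>zwt x\<close>.\<close>

lemma inj_root_pairs: "inj_on (\<lambda>(a, b). zwt a + zwt b) (root_pairs n)"
proof -
  have mem: "x = a \<or> x = b \<longleftrightarrow> of_int (zsg x) * (zwt a + zwt b) (x div 2) > 0"
    if ab: "(a, b) \<in> root_pairs n" for a b x
  proof -
    have eq: "x = y" if "x div 2 = y div 2" "zsg x = zsg y" for y
    proof -
      have "even x = even y" using that(2) by (auto simp: zsg_def split: if_splits)
      then show ?thesis using that(1) by presburger
    qed
    have sq: "zsg y * zsg y = 1" "zsg y = 1 \<or> zsg y = - 1" for y by (auto simp: zsg_def)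
    have "(of_int (zsg x) * (zwt a + zwt b) (x div 2) :: real) =
        of_int ((if x div 2 = a div 2 then zsg x * zsg a else 0) + (if x div 2 = b div 2 then zsg x * zsg b else 0))"
      by (simp add: zwt_def algebra_simps)
    also have "\<dots> > 0 \<longleftrightarrow>
        (if x div 2 = a div 2 then zsg x * zsg a else 0) + (if x div 2 = b div 2 then zsg x * zsg b else 0) > 0"
      by (simp only: of_int_0_less_iff)
    also have "\<dots> \<longleftrightarrow> x = a \<or> x = b"
    proof (cases "a = b")
      case True
      then show ?thesis using eq[of a] sq[of x] sq[of a] by auto
    next
      case False
      then have "a div 2 \<noteq> b div 2" using ab by (auto simp: root_pairs_def)
      then show ?thesis using eq[of a] eq[of b] sq[of x] sq[of a] sq[of b] by auto
    qed
    finally show ?thesis by simp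
  qed
  have "a = c \<and> b = d" if "(a, b) \<in> root_pairs n" "(c, d) \<in> root_pairs n" "zwt a + zwt b = zwt c + zwt d" for a b c d
  proof -
    have "x = a \<or> x = b \<longleftrightarrow> x = c \<or> x = d" for x
      unfolding mem[OF that(1)] mem[OF that(2)] that(3) ..
    then have "a = c \<or> a = d" "b = c \<or> b = d" "c = a \<or> c = b" "d = a \<or> d = b" by metis+
    moreover have "a \<le> b" "c \<le> d" using that by (auto simp: root_pairs_def)
    ultimately show ?thesis by auto
  qed
  then show ?thesis by (intro inj_onI) auto
qed

lemma all_roots_pos: "all_roots n = pos_roots n \<union> uminus ` pos_roots n"
proof
  show "all_roots n \<subseteq> pos_roots n \<union> uminus ` pos_roots n"
  proof
    fix \<alpha> assume "\<alpha> \<in> all_roots n"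
    then obtain a b where ab: "\<alpha> = zwt a + zwt b" "a < 2 * n" "b < 2 * n" "a \<le> b" "a div 2 = b div 2 \<longrightarrow> a = b"
      unfolding all_roots_image root_pairs_def by auto
    define i j where "i = a div 2" and "j = b div 2"
    then have ij: "a = 2 * i \<or> a = Suc (2 * i)" "b = 2 * j \<or> b = Suc (2 * j)" by presburger+
    have lt: "i < n" "j < n" "i \<le> j" using ij ab by auto
    show "\<alpha> \<in> pos_roots n \<union> uminus ` pos_roots n"
    proof (cases "i = j")
      case True
      then have "a = b" using ab(5) by (simp add: i_def j_def)
      then have "\<alpha> = zwt a + zwt a" using ab(1) by simp
      then have "\<alpha> = eps i + eps i \<or> \<alpha> = - (eps i + eps i)"
        using ij(1) by (elim disjE) (simp_all only: zwt_double minus_add_distrib simp_thms)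
      moreover have "eps i + eps i \<in> pos_roots n" using lt by (auto simp: pos_roots_def)
      ultimately show ?thesis by blast
    next
      case False
      then have "i < j" using lt by simp
      then have p: "eps i + eps j \<in> pos_roots n" "eps i - eps j \<in> pos_roots n" using lt by (auto simp: pos_roots_def)
      have "\<alpha> = eps i + eps j \<or> \<alpha> = - (eps i + eps j) \<or> \<alpha> = eps i - eps j \<or> \<alpha> = - (eps i - eps j)"
        using ij ab(1) by (auto simp: zwt_double)
      with p show ?thesis by blast
    qed
  qed
  have mem: "zwt a + zwt b \<in> all_roots n" if "a < 2 * n" "b < 2 * n" "a div 2 = b div 2 \<longrightarrow> a = b" for a b
    using that unfolding all_roots_def by blast
  have "\<alpha> \<in> all_roots n \<and> - \<alpha> \<in> all_roots n" if "\<alpha> \<in> pos_roots n" for \<alpha>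
    using that
  proof (cases rule: pos_roots_cases)
    case (minus i j)
    then show ?thesis using mem[of "2 * i" "Suc (2 * j)"] mem[of "Suc (2 * i)" "2 * j"]
      by (simp add: zwt_double)
  next
    case (plus i j)
    then show ?thesis using mem[of "2 * i" "2 * j"] mem[of "Suc (2 * i)" "Suc (2 * j)"]
      by (simp add: zwt_double)
  next
    case (long i)
    have "eps i + eps i \<in> all_roots n" "- eps i + - eps i \<in> all_roots n"
      using long(1) mem[of "2 * i" "2 * i"] mem[of "Suc (2 * i)" "Suc (2 * i)"] unfolding zwt_double by auto
    then show ?thesis unfolding long(2) minus_add_distrib by blast
  qed
  then show "pos_roots n \<union> uminus ` pos_roots n \<subseteq> all_roots n" by auto
qed

lemma gact_add: "gact p s (v + u) = gact p s v + gact p s u"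
  by (simp add: gact_def fun_eq_iff algebra_simps)

text \<open>A signed permutation permutes the \<open>2n\<close> weights \<open>zwt a\<close> and
  respects negation; \<open>\<pi>\<close> is the induced permutation of indices.\<close>

lemma gact_all_roots:
  assumes ps: "(p, s) \<in> hyper n"
  shows "gact p s ` all_roots n = all_roots n"
proof (rule endo_inj_surj)
  have p: "p permutes {..<n}" and s: "s \<in> signs n" using ps by (auto simp: hyper_def)
  show "finite (all_roots n)"
    by (simp add: all_roots_pos finite_pos_roots)
  show "inj_on (gact p s) (all_roots n)"
  proof (rule inj_onI)
    fix u v assume e: "gact p s u = gact p s v"
    show "u = v"
    proof
      fix k
      obtain l where l: "p l = k" using permutes_surj[OF p] by (metis surjD)
      have "s l = 1 \<or> s l = - 1" using s unfolding signs_def by blast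
      moreover have "of_int (s l) * u k = of_int (s l) * v k"
        using arg_cong[OF e, of "\<lambda>w. w l"] unfolding gact_def l .
      ultimately show "u k = v k" by (elim disjE) simp_all
    qed
  qed
  define \<pi> where "\<pi> a = (let i = inv_into UNIV p (a div 2) in if zsg a * s i = 1 then 2 * i else Suc (2 * i))" for a
  have dv: "\<pi> a div 2 = inv_into UNIV p (a div 2)" for a by (simp add: \<pi>_def Let_def)
  have sg: "zsg (\<pi> a) = zsg a * s (inv_into UNIV p (a div 2))" for a
  proof -
    have "s (inv_into UNIV p (a div 2)) = 1 \<or> s (inv_into UNIV p (a div 2)) = - 1" using s unfolding signs_def by blast
    then show ?thesis by (auto simp: \<pi>_def Let_def zsg_def)
  qed
  have lt: "\<pi> a < 2 * n" if "a < 2 * n" for a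
  proof -
    have "inv_into UNIV p (a div 2) < n" using permutes_in_image[OF permutes_inv[OF p], of "a div 2"] that by simp
    then show ?thesis using dv[of a] by linarith
  qed
  have w: "gact p s (zwt a) = zwt (\<pi> a)" for a
  proof
    fix k
    have "p k = a div 2 \<longleftrightarrow> k = inv_into UNIV p (a div 2)" using permutes_inverses[OF p] by metis
    then show "gact p s (zwt a) k = zwt (\<pi> a) k"
      by (simp add: gact_def zwt_def sg dv mult.commute)
  qed
  show "gact p s ` all_roots n \<subseteq> all_roots n"
  proof
    fix \<beta> assume "\<beta> \<in> gact p s ` all_roots n"
    then obtain a b where ab: "\<beta> = gact p s (zwt a + zwt b)" "a < 2 * n" "b < 2 * n" "a div 2 = b div 2 \<longrightarrow> a = b"
      unfolding all_roots_def by blast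
    have "\<pi> a div 2 = \<pi> b div 2 \<longrightarrow> \<pi> a = \<pi> b"
      unfolding dv using ab(4) permutes_inj[OF permutes_inv[OF p]] by (metis injD)
    then have "zwt (\<pi> a) + zwt (\<pi> b) \<in> all_roots n" using lt ab(2,3) unfolding all_roots_def by blast
    then show "\<beta> \<in> all_roots n" unfolding ab(1) gact_add w .
  qed
qed

text \<open>The inner product with \<open>half_sum n\<close>. It separates positive from negative
  roots and bounds the number of summands in a decomposition into positive roots.\<close>

definition height :: "nat \<Rightarrow> weight \<Rightarrow> real" where
  "height n v = (\<Sum>k<n. (real n - real k) * v k)"

lemma height_add: "height n (u + v) = height n u + height n v"
  and height_diff: "height n (u - v) = height n u - height n v"
  and height_uminus: "height n (- u) = - height n u"
  by (simp_all add: height_def algebra_simps sum.distrib sum_subtractf sum_negf)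

lemma height_pos_root: "\<alpha> \<in> pos_roots n \<Longrightarrow> height n \<alpha> \<ge> 1"
proof -
  have e: "height n (eps i) = real n - real i" if "i < n" for i
    using that by (simp add: height_def sum_eps)
  assume "\<alpha> \<in> pos_roots n"
  then show ?thesis
    by (cases rule: pos_roots_cases) (simp_all only: height_add height_diff, auto simp: e)
qed

lemma pos_neg_roots_disjoint: "pos_roots n \<inter> uminus ` pos_roots n = {}"
proof -
  have False if "\<alpha> \<in> pos_roots n" "\<beta> \<in> pos_roots n" "\<alpha> = - \<beta>" for \<alpha> \<beta>
    using height_pos_root[OF that(1)] height_pos_root[OF that(2)] unfolding that(3) height_uminus by simp
  then show ?thesis by blast
qed

section \<open>Generating functions of decompositions into roots\<close>

definition geo :: "weight \<Rightarrow> laurent fps" where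
  "geo \<alpha> = Abs_fps (\<lambda>k. ex \<alpha> ^ k)"

lemma geo_nth: "fps_nth (geo \<alpha>) k = ex \<alpha> ^ k"
  by (simp add: geo_def)

lemma geo_inverse: "(1 - fps_const (ex \<alpha>) * fps_X) * geo \<alpha> = 1"
proof (rule fps_ext)
  fix k
  show "fps_nth ((1 - fps_const (ex \<alpha>) * fps_X) * geo \<alpha>) k = fps_nth 1 k"
    by (cases k) (simp_all only: left_diff_distrib mult.assoc fps_sub_nth fps_mult_left_const_nth
      mult_1_left fps_X_mult_nth geo_def fps_nth_Abs_fps, simp_all)
qed

text \<open>Fixing the number \<open>k\<close> of summands keeps the set finite even when
  \<open>S\<close> contains roots together with their negatives.\<close>

definition decs :: "weight set \<Rightarrow> nat \<Rightarrow> weight \<Rightarrow> (weight \<Rightarrow> nat) set" where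
  "decs S k \<beta> = {c. (\<forall>\<alpha>. \<alpha> \<notin> S \<longrightarrow> c \<alpha> = 0) \<and> (\<Sum>\<alpha>\<in>S. c \<alpha>) = k \<and>
    (\<forall>j. (\<Sum>\<alpha>\<in>S. real (c \<alpha>) * \<alpha> j) = \<beta> j)}"

lemma finite_decs:
  assumes "finite S"
  shows "finite (decs S k \<beta>)"
proof -
  have "c \<alpha> \<le> k" if "c \<in> decs S k \<beta>" "\<alpha> \<in> S" for c \<alpha>
    using that member_le_sum[of \<alpha> S c] assms by (auto simp: decs_def)
  then have "decs S k \<beta> \<subseteq> {c. \<forall>\<alpha>. (\<alpha> \<in> S \<longrightarrow> c \<alpha> \<in> {..k}) \<and> (\<alpha> \<notin> S \<longrightarrow> c \<alpha> = 0)}"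
    by (auto simp: decs_def)
  then show ?thesis
    by (rule finite_subset) (intro finite_set_of_finite_funs assms finite_atMost)
qed

lemma sum_fun_upd_notin:
  "a \<notin> S \<Longrightarrow> (\<Sum>\<alpha>\<in>S. g ((c(a := i)) \<alpha>) \<alpha>) = (\<Sum>\<alpha>\<in>S. g (c \<alpha>) \<alpha>)"
  by (rule sum.cong) auto

text \<open>A decomposition is split by the multiplicity \<open>i\<close> of the new root
  \<open>a\<close>, in parallel with multiplying by the series \<open>geo a\<close>.\<close>

lemma card_decs_insert:
  assumes S: "finite S" "a \<notin> S"
  shows "card (decs (insert a S) k \<beta>) = (\<Sum>i\<le>k. card (decs S (k - i) (\<beta> - (\<lambda>j. real i * a j))))"
proof -
  let ?D = "\<lambda>i. decs S (k - i) (\<beta> - (\<lambda>j. real i * a j))"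
  have z: "c a = 0" if "c \<in> decs S l \<gamma>" for c l \<gamma>
    using S(2) that by (simp add: decs_def)
  have "bij_betw (\<lambda>(i, c). c(a := i)) (SIGMA i:{..k}. ?D i) (decs (insert a S) k \<beta>)"
  proof (rule bij_betw_byWitness[where f' = "\<lambda>c. (c a, c(a := 0))"])
    show "\<forall>x\<in>SIGMA i:{..k}. ?D i. (\<lambda>c. (c a, c(a := 0))) ((\<lambda>(i, c). c(a := i)) x) = x"
      by (auto dest!: z intro!: fun_upd_idem)
    show "\<forall>c\<in>decs (insert a S) k \<beta>. (\<lambda>(i, c). c(a := i)) (c a, c(a := 0)) = c"
      by auto
    show "(\<lambda>(i, c). c(a := i)) ` (SIGMA i:{..k}. ?D i) \<subseteq> decs (insert a S) k \<beta>"
    proof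
      fix d assume "d \<in> (\<lambda>(i, c). c(a := i)) ` (SIGMA i:{..k}. ?D i)"
      then obtain i c where ic: "i \<le> k" "c \<in> ?D i" "d = c(a := i)" by auto
      have "(\<Sum>\<alpha>\<in>insert a S. real (d \<alpha>) * \<alpha> j) = \<beta> j" for j
        using ic(2) S sum_fun_upd_notin[OF S(2), where g = "\<lambda>x \<alpha>. real x * \<alpha> j" and c = c and i = i] by (simp add: ic(3) decs_def)
      moreover have "(\<Sum>\<alpha>\<in>insert a S. d \<alpha>) = k"
        using ic(1,2) S sum_fun_upd_notin[OF S(2), where g = "\<lambda>x \<alpha>. x" and c = c and i = i] by (simp add: ic(3) decs_def)
      ultimately show "d \<in> decs (insert a S) k \<beta>" using ic(2) by (simp add: ic(3) decs_def)
    qed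
    show "(\<lambda>c. (c a, c(a := 0))) ` decs (insert a S) k \<beta> \<subseteq> (SIGMA i:{..k}. ?D i)"
    proof
      fix x assume "x \<in> (\<lambda>c. (c a, c(a := 0))) ` decs (insert a S) k \<beta>"
      then obtain d where d: "d \<in> decs (insert a S) k \<beta>" "x = (d a, d(a := 0))" by blast
      have "(\<Sum>\<alpha>\<in>S. real ((d(a := 0)) \<alpha>) * \<alpha> j) = \<beta> j - real (d a) * a j" for j
      proof -
        have "real (d a) * a j + (\<Sum>\<alpha>\<in>S. real (d \<alpha>) * \<alpha> j) = \<beta> j" using d(1) S by (simp add: decs_def)
        then show ?thesis using sum_fun_upd_notin[OF S(2), where g = "\<lambda>x \<alpha>. real x * \<alpha> j" and c = d and i = 0] by linarith
      qed
      moreover have s: "d a + (\<Sum>\<alpha>\<in>S. d \<alpha>) = k" using d(1) S by (simp add: decs_def)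
      moreover have "(\<Sum>\<alpha>\<in>S. (d(a := 0)) \<alpha>) = k - d a"
        using s sum_fun_upd_notin[OF S(2), where g = "\<lambda>x \<alpha>. x" and c = d and i = 0] by simp
      ultimately show "x \<in> (SIGMA i:{..k}. ?D i)" using d by (simp add: decs_def)
    qed
  qed
  from bij_betw_same_card[OF this] have "card (decs (insert a S) k \<beta>) = card (SIGMA i:{..k}. ?D i)"
    by (rule sym)
  also have "\<dots> = (\<Sum>i\<le>k. card (?D i))"
    by (rule card_SigmaI) (use finite_decs[OF S(1)] in auto)
  finally show ?thesis .
qed

lemma cf_prod_geo: "finite S \<Longrightarrow> cf (fps_nth (\<Prod>\<alpha>\<in>S. geo \<alpha>) k) \<beta> = int (card (decs S k \<beta>))"
proof (induction S arbitrary: k \<beta> rule: finite_induct)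
  case empty
  have "decs {} k \<beta> = (if k = 0 \<and> \<beta> = 0 then {\<lambda>_. 0} else {})"
    by (auto simp: decs_def fun_eq_iff)
  then show ?case by (auto simp: lookup_one when_def)
next
  case (insert a S)
  have "cf (ex a ^ i * f) \<beta> = cf f (\<beta> - (\<lambda>j. real i * a j))" for i f
    unfolding ex_power by (subst mult.commute) (rule cf_mult_ex)
  then have "cf (fps_nth (\<Prod>\<alpha>\<in>insert a S. geo \<alpha>) k) \<beta> =
      (\<Sum>i\<le>k. cf (fps_nth (\<Prod>\<alpha>\<in>S. geo \<alpha>) (k - i)) (\<beta> - (\<lambda>j. real i * a j)))"
    unfolding prod.insert[OF insert.hyps] fps_mult_nth lookup_sum atMost_atLeast0
    by (simp only: geo_nth)
  also have "\<dots> = (\<Sum>i\<le>k. int (card (decs S (k - i) (\<beta> - (\<lambda>j. real i * a j)))))"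
    by (simp only: insert.IH)
  also have "\<dots> = int (card (decs (insert a S) k \<beta>))"
    by (simp only: card_decs_insert[OF insert.hyps] of_nat_sum)
  finally show ?case .
qed

lemma coeff_kostant_partition:
  "coeff (kostant_partition n \<beta>) k = cf (fps_nth (\<Prod>\<alpha>\<in>pos_roots n. geo \<alpha>) k) \<beta>"
proof -
  have "coeff (kostant_partition n \<beta>) k =
      (\<Sum>c\<in>root_decompositions n \<beta>. if (\<Sum>\<alpha>\<in>pos_roots n. c \<alpha>) = k then 1 else 0)"
    unfolding kostant_partition_def coeff_sum by (rule sum.cong) (simp_all add: coeff_monom)
  also have "\<dots> = int (card (root_decompositions n \<beta> \<inter> {c. (\<Sum>\<alpha>\<in>pos_roots n. c \<alpha>) = k}))"
    by (simp add: sum.If_cases[OF finite_root_decompositions])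
  also have "root_decompositions n \<beta> \<inter> {c. (\<Sum>\<alpha>\<in>pos_roots n. c \<alpha>) = k} = decs (pos_roots n) k \<beta>"
    by (auto simp: root_decompositions_def decs_def)
  finally show ?thesis by (simp only: cf_prod_geo[OF finite_pos_roots])
qed

definition full_geo :: "nat \<Rightarrow> laurent fps" where
  "full_geo n = (\<Prod>\<alpha>\<in>all_roots n. geo \<alpha>)"

lemma finite_all_roots: "finite (all_roots n)"
  by (simp add: all_roots_pos finite_pos_roots)

text \<open>The coefficients count decompositions into arbitrary roots, and the group permutes the
  roots; \<open>T\<close> transports multiplicities along this permutation.\<close>

lemma full_geo_invariant:
  assumes ps: "(p, s) \<in> hyper n"
  shows "cf (fps_nth (full_geo n) k) (gact p s \<mu>) = cf (fps_nth (full_geo n) k) \<mu>"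
proof -
  let ?R = "all_roots n" and ?g = "gact p s"
  have p: "p permutes {..<n}" and s: "s \<in> signs n" using ps by (auto simp: hyper_def)
  have inj: "inj_on ?g ?R"
    by (rule eq_card_imp_inj_on[OF finite_all_roots]) (simp only: gact_all_roots[OF ps])
  have re: "(\<Sum>\<alpha>\<in>?R. f \<alpha>) = (\<Sum>\<alpha>\<in>?R. f (?g \<alpha>))" for f :: "weight \<Rightarrow> 'b::comm_monoid_add"
    using sum.reindex[OF inj, of f] by (simp only: gact_all_roots[OF ps] o_def)
  define T where "T c = (\<lambda>\<alpha>. if \<alpha> \<in> ?R then c (?g \<alpha>) else 0 :: nat)" for c
  have gin: "?g \<alpha> \<in> ?R" if "\<alpha> \<in> ?R" for \<alpha> using gact_all_roots[OF ps] that by blast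
  have T1: "(\<Sum>\<alpha>\<in>?R. T c \<alpha>) = (\<Sum>\<alpha>\<in>?R. c \<alpha>)" for c
    unfolding re[of c] by (rule sum.cong) (simp_all add: T_def)
  have eqv: "(\<forall>j. (\<Sum>\<alpha>\<in>?R. real (T c \<alpha>) * \<alpha> j) = \<mu> j) \<longleftrightarrow> (\<forall>j. (\<Sum>\<alpha>\<in>?R. real (c \<alpha>) * \<alpha> j) = ?g \<mu> j)" for c
  proof -
    have "(\<Sum>\<alpha>\<in>?R. real (c \<alpha>) * \<alpha> j) = of_int (s j) * (\<Sum>\<alpha>\<in>?R. real (T c \<alpha>) * \<alpha> (p j))" for j
      unfolding re[of "\<lambda>\<alpha>. real (c \<alpha>) * \<alpha> j"] sum_distrib_left
      by (rule sum.cong) (simp_all add: T_def gact_def)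
    moreover have "of_int (s j) * x = of_int (s j) * y \<longleftrightarrow> x = y" for j and x y :: real
    proof -
      have "s j = 1 \<or> s j = - 1" using s unfolding signs_def by blast
      then show ?thesis by auto
    qed
    ultimately have "(\<forall>j. (\<Sum>\<alpha>\<in>?R. real (c \<alpha>) * \<alpha> j) = ?g \<mu> j) \<longleftrightarrow>
        (\<forall>j. (\<Sum>\<alpha>\<in>?R. real (T c \<alpha>) * \<alpha> (p j)) = \<mu> (p j))"
      by (simp only: gact_def)
    also have "\<dots> \<longleftrightarrow> (\<forall>j. (\<Sum>\<alpha>\<in>?R. real (T c \<alpha>) * \<alpha> j) = \<mu> j)"
      using permutes_surj[OF p] by (metis surjD)
    finally show ?thesis ..
  qed
  have "bij_betw T (decs ?R k (?g \<mu>)) (decs ?R k \<mu>)"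
  proof (rule bij_betwI')
    fix c d assume cd: "c \<in> decs ?R k (?g \<mu>)" "d \<in> decs ?R k (?g \<mu>)"
    show "T c = T d \<longleftrightarrow> c = d"
    proof
      assume e: "T c = T d"
      show "c = d"
      proof
        fix \<beta>
        show "c \<beta> = d \<beta>"
        proof (cases "\<beta> \<in> ?R")
          case True
          then obtain \<alpha> where a: "\<alpha> \<in> ?R" "\<beta> = ?g \<alpha>" using gact_all_roots[OF ps] by blast
          then show ?thesis using fun_cong[OF e, of \<alpha>] by (simp add: T_def)
        qed (use cd in \<open>simp add: decs_def\<close>)
      qed
    qed simp
  next
    fix c assume "c \<in> decs ?R k (?g \<mu>)"
    then show "T c \<in> decs ?R k \<mu>"
      unfolding decs_def mem_Collect_eq T1 eqv by (simp add: T_def)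
  next
    fix d assume d: "d \<in> decs ?R k \<mu>"
    define c where "c \<beta> = (if \<beta> \<in> ?R then d (inv_into ?R ?g \<beta>) else 0)" for \<beta>
    have Tc: "T c = d"
    proof
      fix \<alpha>
      show "T c \<alpha> = d \<alpha>"
      proof (cases "\<alpha> \<in> ?R")
        case True
        then show ?thesis by (simp only: T_def c_def gin inv_into_f_f[OF inj] if_True)
      qed (use d in \<open>simp add: T_def decs_def\<close>)
    qed
    have "c \<in> decs ?R k (?g \<mu>)"
      using d unfolding decs_def mem_Collect_eq eqv[symmetric] T1[of c, symmetric] Tc by (simp add: c_def)
    then show "\<exists>c\<in>decs ?R k (?g \<mu>). d = T c" using Tc by blast
  qed
  then show ?thesis
    unfolding full_geo_def cf_prod_geo[OF finite_all_roots] by (simp only: bij_betw_same_card)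
qed

text \<open>Completing the product to all roots makes it invariant under the Weyl group, at the
  price of a finite product over the negative roots.\<close>

lemma geo_split:
  "(\<Prod>\<alpha>\<in>pos_roots n. geo \<alpha>) = full_geo n * (\<Prod>\<alpha>\<in>pos_roots n. 1 - fps_const (ex (- \<alpha>)) * fps_X)"
proof -
  have inj: "inj_on uminus (pos_roots n)" by (rule inj_onI) (metis minus_minus)
  have "full_geo n = (\<Prod>\<alpha>\<in>pos_roots n. geo \<alpha>) * (\<Prod>\<alpha>\<in>uminus ` pos_roots n. geo \<alpha>)"
    unfolding full_geo_def all_roots_pos
    by (rule prod.union_disjoint) (simp_all add: finite_pos_roots pos_neg_roots_disjoint)
  also have "(\<Prod>\<alpha>\<in>uminus ` pos_roots n. geo \<alpha>) = (\<Prod>\<alpha>\<in>pos_roots n. geo (- \<alpha>))"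
    by (simp add: prod.reindex[OF inj] o_def)
  finally have f: "full_geo n = (\<Prod>\<alpha>\<in>pos_roots n. geo \<alpha>) * (\<Prod>\<alpha>\<in>pos_roots n. geo (- \<alpha>))" .
  have "(\<Prod>\<alpha>\<in>pos_roots n. 1 - fps_const (ex (- \<alpha>)) * fps_X) * (\<Prod>\<alpha>\<in>pos_roots n. geo (- \<alpha>)) = 1"
    unfolding prod.distrib[symmetric] geo_inverse by simp
  then show ?thesis unfolding f by (simp add: mult.assoc mult.commute[of "\<Prod>\<alpha>\<in>pos_roots n. geo (- \<alpha>)"])
qed

text \<open>Among the pairs \<open>i \<le> j\<close> of variables, \<open>n\<close> consist of a
  variable and its inverse and contribute \<open>1 - X\<close> each; the others run exactly once
  through the roots.\<close>

lemma lw_prod_full_geo: "lw_prod (2 * n) zv * full_geo n = (1 - fps_X) ^ n"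
proof -
  let ?T = "{(i, j). i \<le> j \<and> j < 2 * n}" and ?g = "\<lambda>(i, j). 1 - fps_const (zv i * zv j) * fps_X"
  let ?D = "(\<lambda>i. (2 * i, Suc (2 * i))) ` {..<n}"
  have T: "?T = root_pairs n \<union> ?D"
  proof
    show "?T \<subseteq> root_pairs n \<union> ?D"
    proof
      fix x assume "x \<in> ?T"
      then obtain i j where ij: "x = (i, j)" "i \<le> j" "j < 2 * n" by auto
      show "x \<in> root_pairs n \<union> ?D"
      proof (cases "i div 2 = j div 2 \<longrightarrow> i = j")
        case False
        then have "i = 2 * (i div 2)" "j = Suc (2 * (i div 2))" "i div 2 < n" using ij(2,3) by presburger+
        then show ?thesis using ij(1) by (intro UnI2 image_eqI[of _ _ "i div 2"]) auto
      qed (use ij in \<open>auto simp: root_pairs_def\<close>)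
    qed
  qed (auto simp: root_pairs_def)
  have fin: "finite (root_pairs n)"
    by (rule finite_subset[of _ "{..<2 * n} \<times> {..<2 * n}"]) (auto simp: root_pairs_def)
  have zz: "zv i * zv j = ex (zwt i + zwt j)" for i j by (simp only: zv_eq ex_add)
  have "lw_prod (2 * n) zv = (\<Prod>x\<in>root_pairs n. ?g x) * (\<Prod>x\<in>?D. ?g x)"
    unfolding lw_prod_def T by (rule prod.union_disjoint) (use fin in \<open>auto simp: root_pairs_def\<close>)
  also have "(\<Prod>x\<in>?D. ?g x) = (\<Prod>i<n. 1 - fps_X)"
    by (subst prod.reindex) (auto simp: inj_on_def)
  also have "(\<Prod>x\<in>root_pairs n. ?g x) = (\<Prod>\<alpha>\<in>all_roots n. 1 - fps_const (ex \<alpha>) * fps_X)"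
    unfolding all_roots_image prod.reindex[OF inj_root_pairs]
    by (rule prod.cong) (auto simp: zz)
  finally have "lw_prod (2 * n) zv * full_geo n =
      (\<Prod>\<alpha>\<in>all_roots n. (1 - fps_const (ex \<alpha>) * fps_X) * geo \<alpha>) * (1 - fps_X) ^ n"
    by (simp only: full_geo_def prod.distrib prod_constant card_lessThan mult_ac)
  then show ?thesis by (simp add: geo_inverse)
qed

section \<open>The half sum of the positive roots and the box around the origin\<close>

lemma sum_pos_roots_Suc:
  fixes f :: "weight \<Rightarrow> 'b::comm_monoid_add"
  shows "(\<Sum>\<alpha>\<in>pos_roots (Suc n). f \<alpha>) = (\<Sum>\<alpha>\<in>pos_roots n. f \<alpha>) +
    ((\<Sum>i<n. f (eps i - eps n)) + ((\<Sum>i<n. f (eps i + eps n)) + f (eps n + eps n)))"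
proof -
  let ?A = "(\<lambda>i. eps i - eps n) ` {..<n}" and ?B = "(\<lambda>i. eps i + eps n) ` {..<n}" and ?C = "{eps n + eps n}"
  have eq: "pos_roots (Suc n) = pos_roots n \<union> (?A \<union> (?B \<union> ?C))"
    unfolding pos_roots_def by (auto simp: less_Suc_eq)
  \<comment> \<open>The four families are told apart by their coordinate \<open>n\<close>, which is
    0, -1, 1 and 2.\<close>
  have P: "\<alpha> n = 0" if "\<alpha> \<in> pos_roots n" for \<alpha>
    using that by (cases rule: pos_roots_cases) (auto simp: eps_def plus_fun_def fun_diff_def)
  have A: "\<alpha> n = - 1" if "\<alpha> \<in> ?A" for \<alpha> using that by (auto simp: eps_def)
  have B: "\<alpha> n = 1" if "\<alpha> \<in> ?B" for \<alpha> using that by (auto simp: eps_def)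
  have C: "\<alpha> n = 2" if "\<alpha> \<in> ?C" for \<alpha> using that by (auto simp: eps_def plus_fun_def)
  have dis: "pos_roots n \<inter> (?A \<union> (?B \<union> ?C)) = {}" "?A \<inter> (?B \<union> ?C) = {}" "?B \<inter> ?C = {}"
    by (intro equals0I; elim IntE UnE; drule P A B C; drule P A B C; simp)+
  have e: "eps i i = 1" "i \<noteq> k \<Longrightarrow> eps i k = 0" for i k by (auto simp: eps_def)
  have inj: "inj_on (\<lambda>i. eps i - eps n) {..<n}" "inj_on (\<lambda>i. eps i + eps n) {..<n}"
    by (intro inj_onI; metis add_right_cancel diff_add_cancel e zero_neq_one)+
  have "(\<Sum>\<alpha>\<in>pos_roots (Suc n). f \<alpha>) = (\<Sum>\<alpha>\<in>pos_roots n. f \<alpha>) +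
      ((\<Sum>\<alpha>\<in>?A. f \<alpha>) + ((\<Sum>\<alpha>\<in>?B. f \<alpha>) + (\<Sum>\<alpha>\<in>?C. f \<alpha>)))"
    unfolding eq
    by (simp only: sum.union_disjoint dis finite_UnI finite_imageI finite_lessThan finite_pos_roots finite.intros)
  moreover have "(\<Sum>\<alpha>\<in>?C. f \<alpha>) = f (eps n + eps n)"
    by (simp only: sum.insert finite.emptyI empty_iff not_False_eq_True sum.empty add_0_right)
  ultimately show ?thesis by (simp only: sum.reindex[OF inj(1)] sum.reindex[OF inj(2)] o_def)
qed

lemma sum_pos_roots_coord: "(\<Sum>\<alpha>\<in>pos_roots n. \<alpha> k) = (if k < n then 2 * (real n - real k) else 0)"
proof (induction n)
  case 0
  have "pos_roots 0 = {}" by (auto simp: pos_roots_def)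
  then show ?case by simp
next
  case (Suc n)
  have s: "(\<Sum>i<n. eps i k) = of_bool (k < n)" by (auto simp: eps_def)
  show ?case
    unfolding sum_pos_roots_Suc Suc plus_fun_def fun_diff_def sum_subtractf sum.distrib s
    by (auto simp: eps_def)
qed

lemma sum_pos_roots_abs_coord: "(\<Sum>\<alpha>\<in>pos_roots n. \<bar>\<alpha> k\<bar>) = (if k < n then 2 * real n else 0)"
proof (induction n)
  case 0
  have "pos_roots 0 = {}" by (auto simp: pos_roots_def)
  then show ?case by simp
next
  case (Suc n)
  have s: "(\<Sum>i<n. \<bar>eps i k + eps n k\<bar>) = of_bool (k < n) + real n * of_bool (k = n)"
    and s': "(\<Sum>i<n. \<bar>eps i k - eps n k\<bar>) = of_bool (k < n) + real n * of_bool (k = n)"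
  proof -
    have "\<bar>eps i k + eps n k\<bar> = (if i = k then 1 else 0) + of_bool (k = n)"
      "\<bar>eps i k - eps n k\<bar> = (if i = k then 1 else 0) + of_bool (k = n)" if "i < n" for i
      using that by (auto simp: eps_def)
    then have "(\<Sum>i<n. \<bar>eps i k + eps n k\<bar>) = (\<Sum>i<n. (if i = k then 1 else 0) + of_bool (k = n))"
      "(\<Sum>i<n. \<bar>eps i k - eps n k\<bar>) = (\<Sum>i<n. (if i = k then 1 else 0) + of_bool (k = n))"
      by auto
    then show "(\<Sum>i<n. \<bar>eps i k + eps n k\<bar>) = of_bool (k < n) + real n * of_bool (k = n)"
      "(\<Sum>i<n. \<bar>eps i k - eps n k\<bar>) = of_bool (k < n) + real n * of_bool (k = n)"
      by (simp_all add: sum.distrib)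
  qed
  show ?case
    unfolding sum_pos_roots_Suc Suc plus_fun_def fun_diff_def s s'
    by (auto simp: eps_def)
qed

lemma half_sum_eq: "half_sum n k = (if k < n then real n - real k else 0)"
  by (simp add: half_sum_def sum_pos_roots_coord)

text \<open>Twice the vector is the sum of the positive roots outside \<open>T\<close> minus the sum
  of those in \<open>T\<close>, so twice the coordinate \<open>k\<close> is bounded by the sum of
  all \<open>\<bar>\<alpha> k\<bar>\<close>.\<close>

lemma half_sum_minus_subset:
  assumes T: "T \<subseteq> pos_roots n"
  shows "\<exists>c. half_sum n k - (\<Sum>\<alpha>\<in>T. \<alpha> k) = of_int c"
    and "\<bar>half_sum n k - (\<Sum>\<alpha>\<in>T. \<alpha> k)\<bar> \<le> (if k < n then real n else 0)"
proof -
  have fin: "finite T" using T finite_pos_roots finite_subset by blast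
  have "\<exists>c. \<alpha> k = of_int c" if "\<alpha> \<in> pos_roots n" for \<alpha>
  proof -
    have e: "eps i k = of_int (of_bool (k = i))" for i by (simp add: eps_def)
    show ?thesis
      using that
    proof (cases rule: pos_roots_cases)
      case (minus i j)
      show ?thesis unfolding minus(3) fun_diff_def e of_int_diff[symmetric] by (rule exI, rule refl)
    next
      case (plus i j)
      show ?thesis unfolding plus(3) plus_fun_def e of_int_add[symmetric] by (rule exI, rule refl)
    next
      case (long i)
      show ?thesis unfolding long(2) plus_fun_def e of_int_add[symmetric] by (rule exI, rule refl)
    qed
  qed
  then obtain c where c: "\<alpha> k = of_int (c \<alpha>)" if "\<alpha> \<in> pos_roots n" for \<alpha> by metis
  have "(\<Sum>\<alpha>\<in>T. \<alpha> k) = of_int (\<Sum>\<alpha>\<in>T. c \<alpha>)"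
    unfolding of_int_sum by (rule sum.cong) (use T c in auto)
  moreover have "half_sum n k = of_int (if k < n then int n - int k else 0)" by (simp add: half_sum_eq)
  ultimately show "\<exists>c. half_sum n k - (\<Sum>\<alpha>\<in>T. \<alpha> k) = of_int c" 
    unfolding of_int_diff[symmetric] by (simp only:) (rule exI, rule of_int_diff[symmetric])
  have S: "(\<Sum>\<alpha>\<in>pos_roots n. \<alpha> k) = (\<Sum>\<alpha>\<in>pos_roots n - T. \<alpha> k) + (\<Sum>\<alpha>\<in>T. \<alpha> k)"
    by (rule sum.subset_diff[OF T finite_pos_roots])
  have "2 * (half_sum n k - (\<Sum>\<alpha>\<in>T. \<alpha> k)) = (\<Sum>\<alpha>\<in>pos_roots n - T. \<alpha> k) - (\<Sum>\<alpha>\<in>T. \<alpha> k)"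
    unfolding half_sum_def S by simp
  also have "\<bar>\<dots>\<bar> \<le> (\<Sum>\<alpha>\<in>pos_roots n - T. \<bar>\<alpha> k\<bar>) + (\<Sum>\<alpha>\<in>T. \<bar>\<alpha> k\<bar>)"
    by (rule order_trans[OF abs_triangle_ineq4 add_mono]) (rule sum_abs)+
  also have "\<dots> = (if k < n then 2 * real n else 0)"
    using sum.subset_diff[OF T finite_pos_roots, of "\<lambda>\<alpha>. \<bar>\<alpha> k\<bar>"] sum_pos_roots_abs_coord[of k n] by simp
  finally show "\<bar>half_sum n k - (\<Sum>\<alpha>\<in>T. \<alpha> k)\<bar> \<le> (if k < n then real n else 0)" by (simp split: if_splits)
qed

text \<open>
  The exponents of \<open>e\<^sup>\<rho>\<close> times the product of the \<open>1 - t e\<^sup>-\<^sup>\<alpha>\<close> lie in this box, hence the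
  alternating sum of each of them over the Weyl group is 0 or plus or minus \<open>a\<^sub>\<rho>\<close>.
\<close>

lemma box_cases:
  assumes int: "\<And>k. \<exists>c. \<mu> k = of_int c" and box: "\<And>k. \<bar>\<mu> k\<bar> \<le> (if k < n then real n else 0)"
  obtains (stab) p s where "(p, s) \<in> hyper n" "hsign n p s = - 1" "gact p s \<mu> = \<mu>"
    | (orbit) p s where "(p, s) \<in> hyper n" "\<mu> = gact p s (half_sum n)"
proof -
  obtain c where c: "\<And>k. \<mu> k = of_int (c k)" using int by metis
  have c0: "c k = 0" if "k \<ge> n" for k using box[of k] that by (simp add: c)
  have cn: "\<bar>c k\<bar> \<le> int n" for k
  proof -
    have "\<bar>\<mu> k\<bar> \<le> real n" using box[of k] by (auto split: if_splits)
    then have "real_of_int \<bar>c k\<bar> \<le> of_int (int n)" by (simp add: c)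
    then show ?thesis by (simp only: of_int_le_iff)
  qed
  \<comment> \<open>A zero coordinate is fixed by a sign change, and two coordinates of equal
    modulus by a signed transposition. Otherwise the moduli are distinct numbers in
    \<open>{1..n}\<close>, that is, the coordinates of \<open>half_sum n\<close> in some
    order.\<close>
  consider (zero) k where "k < n" "c k = 0"
    | (same) i j where "i < n" "j < n" "i \<noteq> j" "\<bar>c i\<bar> = \<bar>c j\<bar>"
    | (reg) "\<And>k. k < n \<Longrightarrow> c k \<noteq> 0" "\<And>i j. i < n \<Longrightarrow> j < n \<Longrightarrow> \<bar>c i\<bar> = \<bar>c j\<bar> \<Longrightarrow> i = j"
    by blast
  then show thesis
  proof cases
    case zero
    have "hsign n id (flip1 k) = - 1" using zero(1) by (simp add: hsign_def flip1_def)
    moreover have "gact id (flip1 k) \<mu> = \<mu>" using zero by (auto simp: gact_def flip1_def c fun_eq_iff)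
    ultimately show thesis using stab hyper_flip1[OF zero(1)] by blast
  next
    case same
    \<comment> \<open>The ratio of the two coordinates. It enters the signs twice, so the
      transposition alone decides the sign of the group element.\<close>
    define e :: int where "e = (if c i = c j then 1 else - 1)"
    have e: "c i = e * c j" "c j = e * c i" "e = 1 \<or> e = - 1" using same(4) by (auto simp: e_def)
    let ?p = "Transposition.transpose i j" and ?s = "\<lambda>k. if k = i \<or> k = j then e else 1"
    have h: "(?p, ?s) \<in> hyper n" using same e(3) by (auto simp: hyper_def signs_def permutes_swap_id)
    have "(\<Prod>k<n. ?s k) = (\<Prod>k\<in>{i, j}. e)"
      by (rule prod.mono_neutral_cong_right) (use same in auto)
    also have "\<dots> = 1" using same(3) e(3) by auto
    finally have "hsign n ?p ?s = - 1" using same(3) by (simp add: hsign_def sign_swap_id)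
    moreover have "gact ?p ?s \<mu> = \<mu>"
    proof
      fix k
      have "?s k * c (?p k) = c k" using e(1,2) by (simp add: Transposition.transpose_def)
      then show "gact ?p ?s \<mu> k = \<mu> k" unfolding gact_def c of_int_mult[symmetric] of_int_eq_iff .
    qed
    ultimately show thesis using stab h by blast
  next
    case reg
    define p where "p k = (if k < n then n - nat \<bar>c k\<bar> else k)" for k
    define s where "s k = (if c k < 0 then - 1 else 1 :: int)" for k
    have lt: "p k < n" if "k < n" for k using reg(1)[OF that] that by (simp add: p_def)
    have inj: "inj_on p {..<n}"
    proof (rule inj_onI)
      fix i j assume ij: "i \<in> {..<n}" "j \<in> {..<n}" "p i = p j"
      have "nat \<bar>c i\<bar> \<le> n" "nat \<bar>c j\<bar> \<le> n" using cn[of i] cn[of j] by auto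
      moreover have "n - nat \<bar>c i\<bar> = n - nat \<bar>c j\<bar>" using ij by (simp add: p_def)
      ultimately have "nat \<bar>c i\<bar> = nat \<bar>c j\<bar>" by linarith
      then show "i = j" using reg(2)[of i j] ij(1,2) by simp
    qed
    have "p permutes {..<n}"
    proof (rule bij_imp_permutes)
      show "bij_betw p {..<n} {..<n}"
        using inj endo_inj_surj[of "{..<n}" p] lt by (auto simp: bij_betw_def)
    qed (simp add: p_def)
    moreover have "s \<in> signs n" using c0 by (auto simp: signs_def s_def)
    ultimately have h: "(p, s) \<in> hyper n" by (simp add: hyper_def)
    have "\<mu> = gact p s (half_sum n)"
    proof
      fix k
      show "\<mu> k = gact p s (half_sum n) k"
      proof (cases "k < n")
        case True
        have "nat \<bar>c k\<bar> \<le> n" using cn[of k] by simp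
        then have "real n - real (n - nat \<bar>c k\<bar>) = of_int \<bar>c k\<bar>" by (simp add: of_nat_diff)
        then show ?thesis using True lt[OF True]
          by (simp add: gact_def c half_sum_eq p_def s_def) 
      next
        case False
        then show ?thesis using c0[of k] by (simp add: gact_def c half_sum_eq p_def)
      qed
    qed
    then show thesis using orbit h by blast
  qed
qed

section \<open>Generalized exponents as constant terms\<close>

text \<open>For fixed \<open>f\<close>, the part of the Weyl alternating sum that depends on the
  shift \<open>\<mu>\<close>. The generalized exponent combines such values with
  \<open>\<mu>\<close> in the box, and each of them will be reduced to
  \<open>\<mu> = half_sum n\<close>.\<close>

definition asum :: "nat \<Rightarrow> laurent \<Rightarrow> weight \<Rightarrow> weight \<Rightarrow> int" where
  "asum n f v \<mu> = (\<Sum>(p, s)\<in>hyper n. hsign n p s * cf f (gact p s v - \<mu>))"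

definition invariant :: "nat \<Rightarrow> laurent \<Rightarrow> bool" where
  "invariant n f \<longleftrightarrow> (\<forall>(p, s)\<in>hyper n. \<forall>\<mu>. cf f (gact p s \<mu>) = cf f \<mu>)"

lemma sum_hyper_translate:
  assumes qr: "(q, r) \<in> hyper n"
  shows "(\<Sum>(p, s)\<in>hyper n. g (p \<circ> q) (\<lambda>k. r k * s (q k))) = (\<Sum>(p, s)\<in>hyper n. g p s)"
proof -
  let ?h = "\<lambda>(p, s). (p \<circ> q, \<lambda>k. r k * s (q k))"
  have q: "q permutes {..<n}" and r: "r \<in> signs n" using qr by (auto simp: hyper_def)
  have inj: "inj_on ?h (hyper n)"
  proof (rule inj_onI)
    fix x y assume "?h x = ?h y"
    moreover obtain p s p' s' where xy: "x = (p, s)" "y = (p', s')" by (cases x, cases y)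
    ultimately have e: "p \<circ> q = p' \<circ> q" "(\<lambda>k. r k * s (q k)) = (\<lambda>k. r k * s' (q k))" by auto
    have "p l = p' l \<and> s l = s' l" for l
    proof -
      obtain k where k: "q k = l" using permutes_surj[OF q] by (metis surjD)
      have "r k = 1 \<or> r k = - 1" using r unfolding signs_def by blast
      then show ?thesis using fun_cong[OF e(1), of k] fun_cong[OF e(2), of k] k by auto
    qed
    then show "x = y" using xy by auto
  qed
  have "?h ` hyper n \<subseteq> hyper n"
    using hyper_comp(1)[OF qr] by auto
  then have "?h ` hyper n = hyper n" by (rule endo_inj_surj[OF finite_hyper _ inj])
  then have "(\<Sum>(p, s)\<in>hyper n. g p s) = (\<Sum>x\<in>hyper n. case ?h x of (p, s) \<Rightarrow> g p s)"
    using sum.reindex[OF inj, of "\<lambda>(p, s). g p s"] by (simp only: o_def)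
  then show ?thesis by (simp add: case_prod_unfold)
qed

lemma gact_diff: "gact p s (v - u) = gact p s v - gact p s u"
  by (simp add: gact_def fun_eq_iff algebra_simps)

lemma hsign_sq: "(p, s) \<in> hyper n \<Longrightarrow> hsign n p s = 1 \<or> hsign n p s = - 1"
  by (metis neg_one_even_power neg_one_odd_power weyl_length_sign)

text \<open>Reindexing the group lets the same element act on both weights; the invariance of
  \<open>f\<close> removes it and the multiplicativity of \<open>hsign\<close> leaves its
  sign.\<close>

lemma asum_gact:
  assumes f: "invariant n f" and qr: "(q, r) \<in> hyper n"
  shows "asum n f v (gact q r \<mu>) = hsign n q r * asum n f v \<mu>"
proof -
  have "asum n f v (gact q r \<mu>) =
      (\<Sum>(p, s)\<in>hyper n. hsign n (p \<circ> q) (\<lambda>k. r k * s (q k)) * cf f (gact (p \<circ> q) (\<lambda>k. r k * s (q k)) v - gact q r \<mu>))"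
    unfolding asum_def by (rule sum_hyper_translate[OF qr, symmetric])
  also have "\<dots> = (\<Sum>(p, s)\<in>hyper n. hsign n q r * (hsign n p s * cf f (gact p s v - \<mu>)))"
  proof (rule sum.cong[OF refl])
    fix x assume "x \<in> hyper n"
    moreover obtain p s where x: "x = (p, s)" by (cases x)
    ultimately have ps: "(p, s) \<in> hyper n" by simp
    have "gact (p \<circ> q) (\<lambda>k. r k * s (q k)) v = gact q r (gact p s v)"
      using fun_cong[OF gact_comp[of q r p s], of v] by (simp only: o_apply)
    then have "cf f (gact (p \<circ> q) (\<lambda>k. r k * s (q k)) v - gact q r \<mu>) = cf f (gact p s v - \<mu>)"
      using f qr unfolding invariant_def by (auto simp: gact_diff[symmetric])
    then show "(case x of (p, s) \<Rightarrow> hsign n (p \<circ> q) (\<lambda>k. r k * s (q k)) *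
          cf f (gact (p \<circ> q) (\<lambda>k. r k * s (q k)) v - gact q r \<mu>)) =
        (case x of (p, s) \<Rightarrow> hsign n q r * (hsign n p s * cf f (gact p s v - \<mu>)))"
      using hyper_comp(2)[OF qr ps] by (simp add: x)
  qed
  finally show ?thesis by (simp add: asum_def sum_distrib_left case_prod_unfold)
qed

text \<open>The multiplier \<open>e\<close> depends on \<open>T\<close> only. That it serves all
  \<open>f\<close> and \<open>v\<close> at once is what makes the factor in
  \<open>gen_exponent_C_factor\<close> independent of the partition. A weight fixed by an element of
  sign -1 gives an integer equal to its own negative.\<close>

lemma asum_box:
  assumes T: "T \<subseteq> pos_roots n"
  obtains e where "\<And>f v. invariant n f \<Longrightarrow>
    asum n f v (half_sum n - (\<lambda>k. \<Sum>\<alpha>\<in>T. \<alpha> k)) = e * asum n f v (half_sum n)"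
proof -
  let ?\<mu> = "half_sum n - (\<lambda>k. \<Sum>\<alpha>\<in>T. \<alpha> k)"
  have \<mu>: "\<exists>c. ?\<mu> k = of_int c" "\<bar>?\<mu> k\<bar> \<le> (if k < n then real n else 0)" for k
    using half_sum_minus_subset[OF T, of k] by simp_all
  from box_cases[of ?\<mu> n] \<mu> show thesis
  proof cases
    case (stab p s)
    have "asum n f v ?\<mu> = - asum n f v ?\<mu>" if "invariant n f" for f v
      using asum_gact[OF that stab(1), of v ?\<mu>] unfolding stab(2,3) by simp
    then show thesis using that[of 0] by simp
  next
    case (orbit p s)
    then show thesis using that[of "hsign n p s"] asum_gact[OF _ orbit(1)] by simp
  qed
qed

lemma coeff_gen_exponent_C:
  "coeff (gen_exponent_C n lam) k = (\<Sum>(p, s)\<in>hyper n. hsign n p s *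
    cf (fps_nth (\<Prod>\<alpha>\<in>pos_roots n. geo \<alpha>) k)
      (gact p s (partition_weight lam + half_sum n) - half_sum n))"
proof -
  let ?v = "partition_weight lam + half_sum n"
  have "coeff ((of_int a :: int poly) * q) k = a * coeff q k" for a q
    by (simp add: of_int_poly)
  then show ?thesis
    unfolding gen_exponent_C_def sum_weyl_group coeff_sum
    by (intro sum.cong) (auto simp: coeff_kostant_partition)
qed

lemma invariant_full_geo: "invariant n (fps_nth (full_geo n) k)"
  unfolding invariant_def using full_geo_invariant by blast

lemma prod_one_minus_roots:
  "(\<Prod>\<alpha>\<in>pos_roots n. 1 - fps_const (ex (- \<alpha>)) * fps_X) =
    (\<Sum>T\<in>Pow (pos_roots n). fps_const ((- 1) ^ card T * ex (- (\<lambda>k. \<Sum>\<alpha>\<in>T. \<alpha> k))) * fps_X ^ card T)"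
proof -
  have "(\<Prod>\<alpha>\<in>pos_roots n. 1 - fps_const (ex (- \<alpha>)) * fps_X) =
      (\<Prod>\<alpha>\<in>pos_roots n. - (fps_const (ex (- \<alpha>)) * fps_X) + 1)"
    by (rule prod.cong) simp_all
  also have "\<dots> = (\<Sum>T\<in>Pow (pos_roots n). (\<Prod>\<alpha>\<in>T. - (fps_const (ex (- \<alpha>)) * fps_X)) * (\<Prod>\<alpha>\<in>pos_roots n - T. 1))"
    by (rule prod_add) (rule finite_pos_roots)
  also have "\<dots> = (\<Sum>T\<in>Pow (pos_roots n). fps_const ((- 1) ^ card T * ex (- (\<lambda>k. \<Sum>\<alpha>\<in>T. \<alpha> k))) * fps_X ^ card T)"
  proof (rule sum.cong[OF refl])
    fix T assume "T \<in> Pow (pos_roots n)"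
    then have fin: "finite T" using finite_pos_roots finite_subset by blast
    have "(\<Sum>\<alpha>\<in>T. - \<alpha>) = - (\<lambda>k. \<Sum>\<alpha>\<in>T. \<alpha> k)"
      by (simp add: fun_eq_iff sum_fun_apply sum_negf)
    then have "ex (- (\<lambda>k. \<Sum>\<alpha>\<in>T. \<alpha> k)) = (\<Prod>\<alpha>\<in>T. ex (- \<alpha>))"
      using ex_sum[OF fin, of uminus] by simp
    moreover have "fps_const ((- 1) ^ m :: laurent) = (- 1) ^ m" for m
      by (simp flip: fps_const_neg fps_const_power fps_const_1_eq_1)
    ultimately show "(\<Prod>\<alpha>\<in>T. - (fps_const (ex (- \<alpha>)) * fps_X)) * (\<Prod>\<alpha>\<in>pos_roots n - T. 1) =
        fps_const ((- 1) ^ card T * ex (- (\<lambda>k. \<Sum>\<alpha>\<in>T. \<alpha> k))) * fps_X ^ card T"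
      by (simp add: prod_uminus prod.distrib fps_const_prod fps_const_mult[symmetric] mult.assoc del: fps_const_mult)
  qed
  finally show ?thesis .
qed

text \<open>The product over the negative roots in \<open>geo_split\<close> is expanded over subsets
  \<open>T\<close>; each term shifts \<open>half_sum n\<close> within the box, and
  \<open>asum_box\<close> turns the shift into an integer.\<close>

lemma gen_exponent_C_factor:
  obtains C :: "int fps" where
    "\<And>lam. Abs_fps (coeff (gen_exponent_C n lam)) =
      C * Abs_fps (\<lambda>k. asum n (fps_nth (full_geo n) k) (partition_weight lam + half_sum n) (half_sum n))"
proof -
  let ?S = "\<lambda>T k. \<Sum>\<alpha>\<in>T. \<alpha> k" and ?F = "\<lambda>k. fps_nth (full_geo n) k" and ?P = "Pow (pos_roots n)"
  have finP: "finite ?P" by (simp add: finite_pos_roots)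
  have "\<exists>e. \<forall>f v. invariant n f \<longrightarrow> asum n f v (half_sum n - ?S T) = e * asum n f v (half_sum n)" if "T \<in> ?P" for T
    using asum_box[of T n] that by (metis PowD)
  then obtain e where e: "\<And>T f v. T \<in> ?P \<Longrightarrow> invariant n f \<Longrightarrow>
      asum n f v (half_sum n - ?S T) = e T * asum n f v (half_sum n)"
    by metis
  define C :: "int fps" where "C = (\<Sum>T\<in>?P. fps_const ((- 1) ^ card T * e T) * fps_X ^ card T)"
  have "Abs_fps (coeff (gen_exponent_C n lam)) =
      C * Abs_fps (\<lambda>k. asum n (?F k) (partition_weight lam + half_sum n) (half_sum n))" for lam
  proof (rule fps_ext)
    fix k
    let ?v = "partition_weight lam + half_sum n"
    have m1: "cf ((- 1) ^ m * f) \<kappa> = (- 1) ^ m * cf f \<kappa>" for m f \<kappa>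
      by (cases "even m") simp_all
    have cfA: "cf (fps_nth (\<Prod>\<alpha>\<in>pos_roots n. geo \<alpha>) k) \<kappa> =
        (\<Sum>T\<in>?P. if card T \<le> k then (- 1) ^ card T * cf (?F (k - card T)) (\<kappa> + ?S T) else 0)" for \<kappa>
    proof -
      have "fps_nth (full_geo n * (fps_const (c * d) * fps_X ^ m)) k =
          (if m \<le> k then c * (?F (k - m) * d) else 0)" for c d m
        unfolding mult.left_commute[of "full_geo n"] mult.assoc[of "fps_const (c * d)"]
        by (simp only: fps_mult_left_const_nth fps_X_power_mult_right_nth) (simp add: mult_ac not_le)
      then have "fps_nth (\<Prod>\<alpha>\<in>pos_roots n. geo \<alpha>) k =
          (\<Sum>T\<in>?P. if card T \<le> k then (- 1) ^ card T * (?F (k - card T) * ex (- ?S T)) else 0)"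
        unfolding geo_split prod_one_minus_roots sum_distrib_left fps_sum_nth by simp
      then show ?thesis
        by (simp add: lookup_sum if_distrib[of "\<lambda>f. cf f \<kappa>"] m1 cf_mult_ex cong: if_cong)
    qed
    have "coeff (gen_exponent_C n lam) k = (\<Sum>T\<in>?P. if card T \<le> k then
        (- 1) ^ card T * asum n (?F (k - card T)) ?v (half_sum n - ?S T) else 0)"
    proof -
      have "coeff (gen_exponent_C n lam) k = (\<Sum>x\<in>hyper n. \<Sum>T\<in>?P. if card T \<le> k then
          (- 1) ^ card T * (case x of (p, s) \<Rightarrow> hsign n p s * cf (?F (k - card T)) (gact p s ?v - (half_sum n - ?S T))) else 0)"
        unfolding coeff_gen_exponent_C
      proof (rule sum.cong[OF refl])
        fix x :: "(nat \<Rightarrow> nat) \<times> (nat \<Rightarrow> int)"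
        obtain p s where x: "x = (p, s)" by (cases x)
        have d: "gact p s ?v - half_sum n + ?S T = gact p s ?v - (half_sum n - ?S T)" for T by simp
        show "(case x of (p, s) \<Rightarrow> hsign n p s * cf (fps_nth (\<Prod>\<alpha>\<in>pos_roots n. geo \<alpha>) k) (gact p s ?v - half_sum n)) =
          (\<Sum>T\<in>?P. if card T \<le> k then
          (- 1) ^ card T * (case x of (p, s) \<Rightarrow> hsign n p s * cf (?F (k - card T)) (gact p s ?v - (half_sum n - ?S T))) else 0)"
          unfolding x prod.case cfA d sum_distrib_left by (rule sum.cong) auto
      qed
      also have "\<dots> = (\<Sum>T\<in>?P. \<Sum>x\<in>hyper n. if card T \<le> k then
          (- 1) ^ card T * (case x of (p, s) \<Rightarrow> hsign n p s * cf (?F (k - card T)) (gact p s ?v - (half_sum n - ?S T))) else 0)"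
        by (rule sum.swap)
      also have "\<dots> = (\<Sum>T\<in>?P. if card T \<le> k then
        (- 1) ^ card T * asum n (?F (k - card T)) ?v (half_sum n - ?S T) else 0)"
        unfolding asum_def by (rule sum.cong) (simp_all add: sum_distrib_left)
      finally show ?thesis .
    qed
    also have "\<dots> = (\<Sum>T\<in>?P. if card T \<le> k then
        (- 1) ^ card T * e T * asum n (?F (k - card T)) ?v (half_sum n) else 0)"
      by (rule sum.cong[OF refl]) (simp add: e invariant_full_geo del: Pow_iff)
    also have "\<dots> = fps_nth (C * Abs_fps (\<lambda>k. asum n (?F k) ?v (half_sum n))) k"
      unfolding C_def sum_distrib_right fps_sum_nth mult.assoc
      by (rule sum.cong[OF refl]) (simp add: fps_X_power_mult_nth mult.assoc)
    finally show "fps_nth (Abs_fps (coeff (gen_exponent_C n lam))) k =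
        fps_nth (C * Abs_fps (\<lambda>k. asum n (?F k) ?v (half_sum n))) k" by simp
  qed
  then show thesis using that by blast
qed

text \<open>Averaging over the orbit of \<open>\<mu>\<close> as well yields a product of two
  alternating sums, the form to which the determinant identities apply, at the price of the group
  order.\<close>

lemma card_hyper_asum:
  assumes f: "invariant n f"
  shows "int (card (hyper n)) * asum n f v \<mu> =
    cf (f * (\<Sum>(p, s)\<in>hyper n. of_int (hsign n p s) * ex (- gact p s v)) *
      (\<Sum>(p, s)\<in>hyper n. of_int (hsign n p s) * ex (gact p s \<mu>))) 0"
proof -
  have t: "cf (f * (of_int a * ex (- \<kappa>)) * (of_int b * ex \<kappa>')) 0 = b * (a * cf f (\<kappa> - \<kappa>'))" for a b \<kappa> \<kappa>'
  proof -
    have "f * (of_int a * ex (- \<kappa>)) * (of_int b * ex \<kappa>') = of_int b * (of_int a * (f * ex (- \<kappa>) * ex \<kappa>'))"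
      by (simp add: mult_ac)
    moreover have "0 - \<kappa>' - - \<kappa> = \<kappa> - \<kappa>'" by simp
    ultimately show ?thesis by (simp only: cf_of_int_mult cf_mult_ex)
  qed
  have "int (card (hyper n)) * asum n f v \<mu> = (\<Sum>x\<in>hyper n. asum n f v \<mu>)" by simp
  also have "\<dots> = (\<Sum>(q, r)\<in>hyper n. hsign n q r * asum n f v (gact q r \<mu>))"
  proof (rule sum.cong[OF refl])
    fix x assume "x \<in> hyper n"
    moreover obtain q r where x: "x = (q, r)" by (cases x)
    ultimately have qr: "(q, r) \<in> hyper n" by simp
    show "asum n f v \<mu> = (case x of (q, r) \<Rightarrow> hsign n q r * asum n f v (gact q r \<mu>))"
      using hsign_sq[OF qr] by (auto simp: x asum_gact[OF f qr])
  qed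
  also have "\<dots> = (\<Sum>y\<in>hyper n. \<Sum>x\<in>hyper n. cf (f * (case x of (p, s) \<Rightarrow> of_int (hsign n p s) * ex (- gact p s v)) *
      (case y of (p, s) \<Rightarrow> of_int (hsign n p s) * ex (gact p s \<mu>))) 0)"
    by (rule sum.cong[OF refl]) (simp add: asum_def sum_distrib_left t case_prod_unfold)
  also have "\<dots> = cf (f * (\<Sum>(p, s)\<in>hyper n. of_int (hsign n p s) * ex (- gact p s v)) *
      (\<Sum>(p, s)\<in>hyper n. of_int (hsign n p s) * ex (gact p s \<mu>))) 0"
    by (simp only: sum_distrib_left sum_distrib_right lookup_sum)
  finally show ?thesis .
qed

section \<open>Alternating sums over signed permutations as determinants\<close>

lemma signs_Suc: "signs (Suc n) = signs n \<union> (\<lambda>s. s(n := - 1)) ` signs n"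
proof
  show "signs (Suc n) \<subseteq> signs n \<union> (\<lambda>s. s(n := - 1)) ` signs n"
  proof
    fix s assume s: "s \<in> signs (Suc n)"
    show "s \<in> signs n \<union> (\<lambda>s. s(n := - 1)) ` signs n"
    proof (cases "s n = 1")
      case True
      have "s k = 1" if "k \<ge> n" for k using s True that by (cases "k = n") (auto simp: signs_def)
      then show ?thesis using s by (auto simp: signs_def)
    next
      case False
      then have "s = (s(n := 1))(n := - 1)" using s by (auto simp: signs_def fun_eq_iff)
      moreover have "s(n := 1) \<in> signs n" using s by (auto simp: signs_def)
      ultimately show ?thesis by blast
    qed
  qed
next
  have "s \<in> signs (Suc n) \<and> s(n := - 1) \<in> signs (Suc n)" if "s \<in> signs n" for s
  proof -
    have s: "s k = 1 \<or> s k = - 1" "k \<ge> n \<Longrightarrow> s k = 1" for k using that unfolding signs_def by blast+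
    then have "(s(n := - 1)) k = 1 \<or> (s(n := - 1)) k = - 1" for k by (cases "k = n") simp_all
    then show ?thesis using s unfolding signs_def by simp
  qed
  then show "signs n \<union> (\<lambda>s. s(n := - 1)) ` signs n \<subseteq> signs (Suc n)" by blast
qed

lemma finite_signs: "finite (signs n)"
proof (induction n)
  case 0
  have "signs 0 = {\<lambda>_. 1}" by (auto simp: signs_def fun_eq_iff)
  then show ?case by simp
qed (simp add: signs_Suc)

lemma sum_signs_Suc: "(\<Sum>s\<in>signs (Suc n). g s) = (\<Sum>s\<in>signs n. g s + g (s(n := - 1)))"
proof -
  have "s n = 1" if "s \<in> signs n" for s using that by (simp add: signs_def)
  note n1 = this
  have inj: "inj_on (\<lambda>s. s(n := - 1)) (signs n)"
  proof (rule inj_onI)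
    fix s t assume st: "s \<in> signs n" "t \<in> signs n" "s(n := - 1) = t(n := - 1)"
    have "s k = t k" for k using fun_cong[OF st(3), of k] n1[OF st(1)] n1[OF st(2)] by (cases "k = n") auto
    then show "s = t" by blast
  qed
  have "signs n \<inter> (\<lambda>s. s(n := - 1)) ` signs n = {}" using n1 by force
  then have "(\<Sum>s\<in>signs (Suc n). g s) = (\<Sum>s\<in>signs n. g s) + (\<Sum>s\<in>(\<lambda>s. s(n := - 1)) ` signs n. g s)"
    unfolding signs_Suc by (intro sum.union_disjoint finite_imageI finite_signs)
  then show ?thesis by (simp add: sum.reindex[OF inj] sum.distrib)
qed

lemma prod_signs:
  "(\<Prod>i<n. ex (scale_eps (c i) i) - ex (scale_eps (- c i) i)) =
    (\<Sum>s\<in>signs n. of_int (\<Prod>k<n. s k) * ex (\<lambda>k. if k < n then of_int (s k) * c k else 0))"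
proof (induction n)
  case 0
  have "signs 0 = {\<lambda>_. 1}" by (auto simp: signs_def fun_eq_iff)
  moreover have "(\<lambda>_. 0) = (0 :: weight)" by (simp add: fun_eq_iff)
  ultimately show ?case by simp
next
  case (Suc n)
  let ?E = "\<lambda>s n. ex (\<lambda>k. if k < n then of_int (s k) * c k else 0)"
  have "of_int (\<Prod>k<Suc n. s k) * ?E s (Suc n) +
      of_int (\<Prod>k<Suc n. (s(n := - 1)) k) * ?E (s(n := - 1)) (Suc n) =
      of_int (\<Prod>k<n. s k) * ?E s n * (ex (scale_eps (c n) n) - ex (scale_eps (- c n) n))" if "s \<in> signs n" for s
  proof -
    have n1: "s n = 1" using that by (simp add: signs_def)
    have "(\<lambda>k. if k < Suc n then of_int (s k) * c k else 0) = (\<lambda>k. if k < n then of_int (s k) * c k else 0) + scale_eps (c n) n"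
      by (auto simp: fun_eq_iff scale_eps_def eps_def n1 less_Suc_eq)
    moreover have "(\<lambda>k. if k < Suc n then of_int ((s(n := - 1)) k) * c k else 0) =
        (\<lambda>k. if k < n then of_int (s k) * c k else 0) + scale_eps (- c n) n"
      by (auto simp: fun_eq_iff scale_eps_def eps_def less_Suc_eq)
    moreover have "(\<Prod>k<n. (s(n := - 1)) k) = (\<Prod>k<n. s k)" by (rule prod.cong) auto
    ultimately show ?thesis by (simp add: n1 ex_add algebra_simps)
  qed
  then show ?case
    unfolding sum_signs_Suc prod.lessThan_Suc Suc.IH sum_distrib_right by (intro sum.cong) simp_all
qed

text \<open>Expanding the product in a Leibniz term chooses a sign for every coordinate;
  permutations and sign choices together run through \<open>hyper n\<close>.\<close>

lemma hyper_alternant: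
  assumes v: "\<And>k. k \<ge> n \<Longrightarrow> v k = 0"
  shows "(\<Sum>(p, s)\<in>hyper n. of_int (hsign n p s) * ex (gact p s v)) =
    dt n (\<lambda>i j. ex (scale_eps (v j) i) - ex (scale_eps (- v j) i))"
proof -
  have h: "hyper n = {p. p permutes {..<n}} \<times> signs n" by (auto simp: hyper_def)
  have "of_int (sign p) * (\<Prod>i<n. ex (scale_eps (v (p i)) i) - ex (scale_eps (- v (p i)) i)) =
      (\<Sum>s\<in>signs n. of_int (hsign n p s) * ex (gact p s v))" if p: "p permutes {..<n}" for p
    unfolding prod_signs[of "\<lambda>i. v (p i)"] sum_distrib_left
  proof (rule sum.cong[OF refl])
    fix s
    have "(\<lambda>k. if k < n then of_int (s k) * v (p k) else 0) = gact p s v"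
      using v permutes_not_in[OF p] by (auto simp: gact_def fun_eq_iff)
    then show "of_int (sign p) * (of_int (\<Prod>k<n. s k) * ex (\<lambda>k. if k < n then of_int (s k) * v (p k) else 0)) =
        of_int (hsign n p s) * ex (gact p s v)"
      by (simp add: hsign_def mult.assoc)
  qed
  then show ?thesis
    unfolding h dt_leibniz sum.cartesian_product[symmetric] by (intro sum.cong) auto
qed

lemma hyper_alternant_nat:
  assumes v: "\<And>k. k < n \<Longrightarrow> v k = real (e k)" "\<And>k. k \<ge> n \<Longrightarrow> v k = 0"
  shows "(\<Sum>(p, s)\<in>hyper n. of_int (hsign n p s) * ex (gact p s v)) = dt n (\<lambda>i j. xv i ^ e j - xi i ^ e j)"
    and "(\<Sum>(p, s)\<in>hyper n. of_int (hsign n p s) * ex (- gact p s v)) = (- 1) ^ n * dt n (\<lambda>i j. xv i ^ e j - xi i ^ e j)"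
proof -
  show "(\<Sum>(p, s)\<in>hyper n. of_int (hsign n p s) * ex (gact p s v)) = dt n (\<lambda>i j. xv i ^ e j - xi i ^ e j)"
    by (rule trans[OF hyper_alternant[OF v(2)] dt_cong]) (simp_all add: v(1) ex_eps_power)
  have g: "- gact p s v = gact p s (- v)" for p s by (simp add: gact_def fun_eq_iff)
  have "dt n (\<lambda>i j. ex (scale_eps ((- v) j) i) - ex (scale_eps (- (- v) j) i)) =
      dt n (\<lambda>i j. (- 1) * (xv i ^ e j - xi i ^ e j))"
    by (rule dt_cong) (simp add: v(1) ex_eps_power)
  then have "dt n (\<lambda>i j. ex (scale_eps ((- v) j) i) - ex (scale_eps (- (- v) j) i)) =
      (- 1) ^ n * dt n (\<lambda>i j. xv i ^ e j - xi i ^ e j)"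
    by (simp only: dt_scale_rows prod_constant card_lessThan)
  moreover have "(- v) k = 0" if "k \<ge> n" for k using v(2)[OF that] by simp
  note hyper_alternant[of n "- v", OF this]
  ultimately show "(\<Sum>(p, s)\<in>hyper n. of_int (hsign n p s) * ex (- gact p s v)) = (- 1) ^ n * dt n (\<lambda>i j. xv i ^ e j - xi i ^ e j)"
    by (simp only: g)
qed

text \<open>Mediates between the decreasing exponents of \<open>half_sum n\<close> and
  \<open>alt\<close> and the increasing ones in the denominator and Vandermonde
  determinants.\<close>

definition rev_perm :: "nat \<Rightarrow> nat \<Rightarrow> nat" where
  "rev_perm N j = (if j < N then N - 1 - j else j)"

lemma rev_perm_permutes: "rev_perm N permutes {..<N}"
proof (rule bij_imp_permutes)
  show "bij_betw (rev_perm N) {..<N} {..<N}"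
    by (rule bij_betw_byWitness[where f' = "\<lambda>j. N - 1 - j"]) (auto simp: rev_perm_def)
qed (simp add: rev_perm_def)

lemma sign_square: "sign p * sign p = 1"
  by (simp add: sign_def)

text \<open>Both alternating sums are multiples of the denominator \<open>D\<close>, and
  \<open>weyl_denominator_C_squared\<close> trades \<open>D * D\<close> for the alternant of the
  zero partition in \<open>2n\<close> variables and the product of the \<open>x i - 1 / x i\<close>.
  The sign from inverting the variables cancels the power of -1 in that identity.\<close>

lemma asum_jt_det:
  assumes f: "invariant n f" and p: "p permutes {..<n + m}"
    and v: "\<And>k. k < n \<Longrightarrow> v k = real (Suc (p k))" "\<And>k. k \<ge> n \<Longrightarrow> v k = 0"
  shows "int (card (hyper n)) * asum n f v (half_sum n) = sign p * sign (rev_perm n) * sign (rev_perm (2 * n)) *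
    cf (f * alt (2 * n) zv (\<lambda>_. 0) * (jt_det n m zv (\<lambda>k. Suc (p (n + k))) * (\<Prod>i<n. xv i - xi i))) 0"
proof -
  define A where "A p = dt n (\<lambda>i j. xv i ^ Suc (p j) - xi i ^ Suc (p j))" for p
  define D where "D = dt n (\<lambda>i j. xv i ^ Suc j - xi i ^ Suc j)"
  define J where "J = jt_det n m zv (\<lambda>k. Suc (p (n + k)))"
  define Q where "Q = (\<Prod>i<n. xv i - xi i)"
  define V where "V = alt (2 * n) zv (\<lambda>_. 0)"
  have inv: "xv i * xi i = 1" for i by simp
  have Ap: "of_int (sign p) * A p = D * J"
    unfolding A_def D_def J_def jt_det_def
    by (rule symplectic_jacobi_trudi[OF inv p])
  have Ar: "of_int (sign (rev_perm n)) * A (rev_perm n) = D"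
    unfolding A_def D_def
    using symplectic_jacobi_trudi[where n = n and m = 0 and x = xv and x' = xi and p = "rev_perm n"] rev_perm_permutes[of n] by simp
  have V: "of_int (sign (rev_perm (2 * n))) * V = dt (2 * n) (\<lambda>i j. zv i ^ j)"
  proof -
    have "V = dt (2 * n) (\<lambda>i j. zv i ^ (rev_perm (2 * n) j))"
      unfolding V_def alt_def by (rule dt_cong) (simp add: rev_perm_def)
    also have "\<dots> = of_int (sign (rev_perm (2 * n))) * dt (2 * n) (\<lambda>i j. zv i ^ j)"
      by (rule dt_permute_columns[OF rev_perm_permutes])
    finally show ?thesis
      by (simp add: mult.assoc[symmetric] of_int_mult[symmetric] sign_square del: of_int_mult)
  qed
  have D2: "D * D = (- 1) ^ n * (of_int (sign (rev_perm (2 * n))) * V) * Q"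
    using weyl_denominator_C_squared[of n xv xi, OF inv] unfolding V D_def Q_def power2_eq_square .
  have half: "half_sum n k = real (Suc (rev_perm n k))" if "k < n" for k
    using that by (simp add: half_sum_eq rev_perm_def of_nat_diff)
  have half0: "half_sum n k = 0" if "k \<ge> n" for k
    using that by (simp add: half_sum_eq)
  have *: "int (card (hyper n)) * asum n f v (half_sum n) = cf (f * ((- 1) ^ n * A p) * A (rev_perm n)) 0"
    unfolding card_hyper_asum[OF f] A_def
    by (simp only: hyper_alternant_nat(2)[of n v, OF v] hyper_alternant_nat(1)[of n "half_sum n", OF half half0])
  have "f * ((- 1) ^ n * A p) * A (rev_perm n) =
      of_int (sign p * sign (rev_perm n) * sign (rev_perm (2 * n))) * (f * V * (J * Q))"
  proof -
    let ?a = "of_int (sign p) :: laurent" and ?b = "of_int (sign (rev_perm n)) :: laurent"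
    have sq: "?a * ?a = 1" "?b * ?b = 1" by (simp_all flip: of_int_mult add: sign_square)
    have m: "((- 1) ^ n * (- 1) ^ n :: laurent) = 1" by (simp flip: power_mult_distrib)
    have "f * ((- 1) ^ n * A p) * A (rev_perm n) = (?a * ?a) * (?b * ?b) * (f * ((- 1) ^ n * A p) * A (rev_perm n))"
      by (simp add: sq)
    also have "\<dots> = ?a * ?b * (f * (- 1) ^ n) * (?a * A p) * (?b * A (rev_perm n))" by (simp only: mult_ac)
    also have "\<dots> = ?a * ?b * (f * (- 1) ^ n) * (D * D) * J" unfolding Ap Ar by (simp only: mult_ac)
    also have "\<dots> = ((- 1) ^ n * (- 1) ^ n) * (?a * ?b * of_int (sign (rev_perm (2 * n))) * (f * V * (J * Q)))"
      unfolding D2 by (simp only: mult_ac)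
    finally show ?thesis by (simp only: m mult_1_left of_int_mult)
  qed
  then show ?thesis unfolding * V_def J_def Q_def by (simp only: cf_of_int_mult)
qed

section \<open>The generalized exponent in terms of good chains\<close>

definition ctf :: "laurent \<Rightarrow> laurent fps \<Rightarrow> int fps" where
  "ctf g F = Abs_fps (\<lambda>k. cf (fps_nth F k * g) 0)"

lemma ctf_one_minus_X: "ctf g ((1 - fps_X) * F) = (1 - fps_X) * ctf g F"
proof (rule fps_ext)
  fix k
  show "fps_nth (ctf g ((1 - fps_X) * F)) k = fps_nth ((1 - fps_X) * ctf g F) k"
    by (cases k) (simp_all add: ctf_def left_diff_distrib lookup_minus)
qed

lemma ctf_one_minus_X_power: "ctf g ((1 - fps_X) ^ n * F) = (1 - fps_X) ^ n * ctf g F"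
  by (induction n) (simp_all add: ctf_one_minus_X mult.assoc)

definition good_gf :: "nat \<Rightarrow> nat \<Rightarrow> (nat \<Rightarrow> nat) \<Rightarrow> int fps" where
  "good_gf n m v = Abs_fps (\<lambda>d. \<Sum>\<nu>\<in>even_parts (2 * n) d. int (card (good n m v \<nu>)))"

lemma ctf_lw_sum:
  assumes v: "\<And>i j. i < j \<Longrightarrow> j < m \<Longrightarrow> v i < v j" "\<And>k. v k \<noteq> 0"
  shows "ctf (jt_det n m zv v * (\<Prod>i<n. xv i - xi i)) (lw_sum (2 * n) zv) = fps_const (pair_const n) * good_gf n m v"
proof (rule fps_ext)
  fix d
  let ?Q = "\<Prod>i<n. xv i - xi i"
  have "cf (alt (2 * n) zv \<nu> * (jt_det n m zv v * ?Q)) 0 = pair_const n * int (card (good n m v \<nu>))"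
    if \<nu>: "\<nu> \<in> even_parts (2 * n) d" for \<nu>
  proof -
    have P: "parts (2 * n) \<nu>" "even (\<Sum>i<2 * n. \<nu> i)" using \<nu> by (auto simp: even_parts_def parts_def)
    have r: "a * b * (c * d) = d * (a * b * c)" for a b c d :: int by simp
    have e: "alt (2 * n) zv \<nu> * (jt_det n m zv v * ?Q) =
        (\<Sum>c\<in>chains (2 * n) m \<nu>. of_int (sgn_chain n m v c * (- 1) ^ (\<Sum>b<m. pk c b (2 * n))) * (alt (2 * n) zv (c 0) * ?Q))"
    proof -
      have "alt (2 * n) zv \<nu> * (jt_det n m zv v * ?Q) = (jt_det n m zv v * alt (2 * n) zv \<nu>) * ?Q"
        by (simp only: mult_ac)
      then show ?thesis
        unfolding jt_det_mult_alt[OF P(1)] sum_distrib_right by (simp add: mult.assoc)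
    qed
    have "cf (alt (2 * n) zv \<nu> * (jt_det n m zv v * ?Q)) 0 =
        (\<Sum>c\<in>chains (2 * n) m \<nu>. sgn_chain n m v c * (- 1) ^ (\<Sum>b<m. pk c b (2 * n)) * (of_bool (paired (c 0)) * pair_const n))"
      unfolding e lookup_sum cf_of_int_mult
      by (rule sum.cong[OF refl]) (simp only: ct_alt_mult[OF chainsD(2)[OF _ P(1)]])
    also have "\<dots> = pair_const n * (\<Sum>c\<in>chains (2 * n) m \<nu>. sgn_chain n m v c * (- 1) ^ (\<Sum>b<m. pk c b (2 * n)) * of_bool (paired (c 0)))"
      unfolding sum_distrib_left by (rule sum.cong[OF refl]) (rule r)
    finally show ?thesis by (simp only: sum_chains_paired[OF P v])
  qed
  moreover have lw_nth: "fps_nth (lw_sum (2 * n) zv) d = (\<Sum>\<nu>\<in>even_parts (2 * n) d. alt (2 * n) zv \<nu>)"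
    by (simp only: lw_sum_def fps_nth_Abs_fps alt_def)
  ultimately show "fps_nth (ctf (jt_det n m zv v * ?Q) (lw_sum (2 * n) zv)) d = fps_nth (fps_const (pair_const n) * good_gf n m v) d"
    by (simp add: ctf_def lw_nth good_gf_def sum_distrib_right sum_distrib_left lookup_sum)
qed

text \<open>\<open>D\<close> depends on \<open>n\<close> alone; it collects the factor
  \<open>C\<close>, the power of \<open>1 - X\<close>, \<open>pair_const n\<close> and the signs of
  the reversals. The partition enters through the sign of \<open>p\<close> and the labels, which
  have to increase for \<open>good_sgn_chain\<close>.\<close>

lemma gen_exponent_C_good_gf:
  obtains D :: "int fps" where
    "\<And>lam m p. partition_at_most n lam \<Longrightarrow> p permutes {..<n + m} \<Longrightarrow> (\<And>j. j < n \<Longrightarrow> p j = lam j + (n - 1 - j)) \<Longrightarrow>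
      (\<And>i j. i < j \<Longrightarrow> j < m \<Longrightarrow> p (n + i) < p (n + j)) \<Longrightarrow>
      fps_const (int (card (hyper n))) * Abs_fps (coeff (gen_exponent_C n lam)) =
      fps_const (sign p) * D * good_gf n m (\<lambda>k. Suc (p (n + k)))"
proof -
  obtain C :: "int fps" where C: "\<And>lam. Abs_fps (coeff (gen_exponent_C n lam)) =
      C * Abs_fps (\<lambda>k. asum n (fps_nth (full_geo n) k) (partition_weight lam + half_sum n) (half_sum n))"
    using gen_exponent_C_factor[of n] by blast
  define e where "e = sign (rev_perm n) * sign (rev_perm (2 * n))"
  define D where "D = C * (fps_const (e * pair_const n) * (1 - fps_X) ^ n)"
  have "fps_const (int (card (hyper n))) * Abs_fps (coeff (gen_exponent_C n lam)) =
      fps_const (sign p) * D * good_gf n m (\<lambda>k. Suc (p (n + k)))"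
    if lam: "partition_at_most n lam" and p: "p permutes {..<n + m}" and pj: "\<And>j. j < n \<Longrightarrow> p j = lam j + (n - 1 - j)"
      and mono: "\<And>i j. i < j \<Longrightarrow> j < m \<Longrightarrow> p (n + i) < p (n + j)" for lam m p
  proof -
    define v where "v = partition_weight lam + half_sum n"
    let ?u = "\<lambda>k. Suc (p (n + k))" and ?F = "full_geo n"
    let ?g = "jt_det n m zv ?u * (\<Prod>i<n. xv i - xi i)"
    have v1: "v k = real (Suc (p k))" if "k < n" for k
      using that by (simp add: v_def pj partition_weight_def half_sum_eq of_nat_diff)
    have v2: "v k = 0" if "k \<ge> n" for k
      using that lam by (simp add: v_def partition_weight_def half_sum_eq partition_at_most_def)
    \<comment> \<open>The roots cancel between \<open>lw_prod\<close> and \<open>full_geo\<close>,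
      and Littlewood's sum takes the place of the product over all roots.\<close>
    have lw: "?F * fps_const (alt (2 * n) zv (\<lambda>_. 0)) = (1 - fps_X) ^ n * lw_sum (2 * n) zv"
    proof -
      have "fps_const (alt (2 * n) zv (\<lambda>_. 0)) = lw_prod (2 * n) zv * lw_sum (2 * n) zv"
        unfolding littlewood_even alt_def add_0 ..
      then have "?F * fps_const (alt (2 * n) zv (\<lambda>_. 0)) = (lw_prod (2 * n) zv * ?F) * lw_sum (2 * n) zv"
        by (simp only: mult_ac)
      then show ?thesis by (simp only: lw_prod_full_geo)
    qed
    have "fps_const (int (card (hyper n))) * Abs_fps (\<lambda>k. asum n (fps_nth ?F k) v (half_sum n)) =
        fps_const (sign p * e) * ctf ?g (?F * fps_const (alt (2 * n) zv (\<lambda>_. 0)))"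
    proof (rule fps_ext)
      fix k
      show "fps_nth (fps_const (int (card (hyper n))) * Abs_fps (\<lambda>k. asum n (fps_nth ?F k) v (half_sum n))) k =
        fps_nth (fps_const (sign p * e) * ctf ?g (?F * fps_const (alt (2 * n) zv (\<lambda>_. 0)))) k"
        using asum_jt_det[OF invariant_full_geo[of n k] p v1 v2]
        by (simp only: ctf_def e_def fps_mult_left_const_nth fps_mult_right_const_nth fps_nth_Abs_fps mult.assoc)
    qed
    also have "\<dots> = fps_const (sign p * e) * ((1 - fps_X) ^ n * (fps_const (pair_const n) * good_gf n m ?u))"
      unfolding lw ctf_one_minus_X_power using mono by (subst ctf_lw_sum) simp_all
    finally have "fps_const (int (card (hyper n))) * (C * Abs_fps (\<lambda>k. asum n (fps_nth ?F k) v (half_sum n))) =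
        C * (fps_const (sign p * e) * ((1 - fps_X) ^ n * (fps_const (pair_const n) * good_gf n m ?u)))"
      by (simp only: mult.left_commute[of "fps_const (int (card (hyper n)))" C])
    moreover have "C * (fps_const (sp * e) * (X * (fps_const pc * G))) = fps_const sp * (C * (fps_const (e * pc) * X)) * G"
      for sp pc and X G :: "int fps"
      by (simp add: mult_ac flip: fps_const_mult)
    ultimately show ?thesis unfolding D_def C v_def by (simp only:)
  qed
  then show thesis using that by blast
qed

section \<open>The constant factor\<close>

text \<open>The beta numbers of \<open>lam\<close>, followed by the numbers they miss in increasing
  order, which the conjugate partition describes.\<close>

definition beta_perm :: "nat \<Rightarrow> (nat \<Rightarrow> nat) \<Rightarrow> nat \<Rightarrow> nat" where
  "beta_perm n lam j = (if j < n then lam j + (n - 1 - j) else j - conjugate lam (j - n))"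

lemma conj_eqI: "(\<And>r. v < p r \<longleftrightarrow> r < k) \<Longrightarrow> conjugate p v = k"
  by (simp add: conjugate_def flip: lessThan_def)

text \<open>Induction on the size. Removing the last box of the last nonempty row lowers the beta
  number of this row by one and raises the missed number of the box's column by one, an adjacent
  transposition of values. The zero partition gives the reversal.\<close>

lemma beta_perm_sign:
  assumes "partition_at_most n lam" "lam 0 \<le> m"
  shows "beta_perm n lam permutes {..<n + m} \<and>
    sign (beta_perm n lam) = (- 1) ^ (\<Sum>i<n. lam i) * sign (rev_perm n)"
  using assms
proof (induction "\<Sum>i<n. lam i" arbitrary: lam)
  case 0
  then have "lam i = 0" for i by (cases "i < n") (auto simp: partition_at_most_def)
  then have lam: "lam = (\<lambda>_. 0)" by blast
  have "beta_perm n lam = rev_perm n"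
    by (auto simp: beta_perm_def rev_perm_def lam conjugate_def fun_eq_iff)
  moreover have "rev_perm n permutes {..<n + m}"
    by (rule permutes_subset[OF rev_perm_permutes]) auto
  ultimately show ?case by (simp add: lam)
next
  case (Suc s)
  have anti: "lam j \<le> lam i" if "i \<le> j" for i j using Suc.prems(1) that by (simp add: partition_at_most_def antimonoD)
  have ln: "lam i = 0" if "i \<ge> n" for i using Suc.prems(1) that by (simp add: partition_at_most_def)
  have "\<exists>i. lam i > 0"
  proof (rule ccontr)
    assume "\<not> (\<exists>i. lam i > 0)"
    then have "(\<Sum>i<n. lam i) = 0" by simp
    then show False using Suc.hyps(2) by simp
  qed
  moreover have bd: "\<forall>i. lam i > 0 \<longrightarrow> i \<le> n" using ln by (metis nat_le_linear less_not_refl)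
  ultimately obtain i where i: "lam i > 0" "\<And>j. lam j > 0 \<Longrightarrow> j \<le> i"
    using GreatestI_ex_nat[of "\<lambda>i. lam i > 0" n] Greatest_le_nat[of "\<lambda>i. lam i > 0" _ n] by (metis (no_types, lifting))
  have i_n: "i < n" using i(1) ln by (metis not_le less_not_refl)
  have after: "lam j = 0" if "j > i" for j using i(2)[of j] that by auto
  \<comment> \<open>The box to be removed lies in row \<open>i\<close>, the last nonempty one, and
    column \<open>c\<close>.\<close>
  define c where "c = lam i - 1"
  have lc: "lam i = Suc c" using i(1) by (simp add: c_def)
  define mu where "mu = lam(i := c)"
  have mu_le: "mu j \<le> lam j" for j by (simp add: mu_def lc)
  have mu: "partition_at_most n mu"
  proof -
    have "mu l \<le> mu k" if "k \<le> l" for k l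
      using anti[OF that] after[of l] lc that by (cases "k = i"; cases "l = i") (auto simp: mu_def)
    then show ?thesis using ln mu_le by (auto simp: partition_at_most_def intro!: antimonoI) (metis le_zero_eq)
  qed
  have sum: "(\<Sum>j<n. lam j) = Suc (\<Sum>j<n. mu j)"
  proof -
    have r: "(\<Sum>j\<in>{..<n} - {i}. lam j) = (\<Sum>j\<in>{..<n} - {i}. mu j)"
      by (rule sum.cong) (auto simp: mu_def)
    have "(\<Sum>j<n. lam j) = lam i + (\<Sum>j\<in>{..<n} - {i}. lam j)" "(\<Sum>j<n. mu j) = mu i + (\<Sum>j\<in>{..<n} - {i}. mu j)"
      by (rule sum.remove; simp add: i_n)+
    moreover have "lam i = Suc (mu i)" by (simp add: lc mu_def)
    ultimately show ?thesis using r by linarith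
  qed
  have IH: "beta_perm n mu permutes {..<n + m}" "sign (beta_perm n mu) = (- 1) ^ (\<Sum>j<n. mu j) * sign (rev_perm n)"
    using Suc.hyps(1)[of mu] Suc.hyps(2) Suc.prems(2) sum mu mu_le[of 0] by auto
  have cl: "conjugate lam c = Suc i"
  proof (rule conj_eqI)
    fix r
    show "c < lam r \<longleftrightarrow> r < Suc i"
      using anti[of r i] after[of r] lc by (cases "r \<le> i") auto
  qed
  have cm: "conjugate mu c = i"
  proof (rule conj_eqI)
    fix r
    show "c < mu r \<longleftrightarrow> r < i"
      using anti[of r i] after[of r] lc by (cases r i rule: linorder_cases) (auto simp: mu_def)
  qed
  have cne: "conjugate mu v = conjugate lam v" if "v \<noteq> c" for v
  proof -
    have "v < mu r \<longleftrightarrow> v < lam r" for r using that by (auto simp: mu_def lc)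
    then show ?thesis by (simp add: conjugate_def)
  qed
  define a where "a = beta_perm n mu i"
  have a: "a = c + (n - 1 - i)" using i_n by (simp add: a_def beta_perm_def mu_def)
  have b: "beta_perm n mu (n + c) = Suc a" using i_n by (simp add: beta_perm_def cm a)
  have la: "beta_perm n lam i = Suc a" "beta_perm n lam (n + c) = a"
    using i_n by (simp_all add: beta_perm_def cl a lc)
  have "beta_perm n lam = Transposition.transpose a (Suc a) \<circ> beta_perm n mu"
  proof
    fix j
    have inj: "beta_perm n mu j = beta_perm n mu k \<longleftrightarrow> j = k" for k
      using permutes_inj[OF IH(1)] by (auto simp: inj_def)
    consider "j = i" | "j = n + c" | "j \<noteq> i" "j \<noteq> n + c" by blast
    then show "beta_perm n lam j = (Transposition.transpose a (Suc a) \<circ> beta_perm n mu) j"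
    proof cases
      case 1
      then show ?thesis using la(1) a_def by (simp only: o_apply) simp
    next
      case 2
      then show ?thesis by (simp only: o_apply b la(2)) simp
    next
      case 3
      then have "beta_perm n mu j \<noteq> a" "beta_perm n mu j \<noteq> Suc a"
        using inj[of i] inj[of "n + c"] a_def b by auto
      moreover have "beta_perm n lam j = beta_perm n mu j"
      proof (cases "j < n")
        case True
        then show ?thesis using 3 by (simp add: beta_perm_def mu_def)
      next
        case False
        then have "j - n \<noteq> c" using 3 by auto
        then show ?thesis using False by (simp add: beta_perm_def cne)
      qed
      ultimately show ?thesis by (simp only: o_apply) (simp add: Transposition.transpose_def)
    qed
  qed
  moreover have lt: "a < n + m" "Suc a < n + m"
  proof -
    have "c < m" using Suc.prems(2) anti[of 0 i] lc by simp
    then show "a < n + m" "Suc a < n + m"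
      using permutes_in_image[OF IH(1), of i] permutes_in_image[OF IH(1), of "n + c"] i_n by (simp_all add: a_def[symmetric] b)
  qed
  ultimately have comp: "beta_perm n lam = Transposition.transpose a (Suc a) \<circ> beta_perm n mu"
    and lt: "a < n + m" "Suc a < n + m" by blast+
  have t: "Transposition.transpose a (Suc a) permutes {..<n + m}"
    by (rule permutes_swap_id) (use lt in auto)
  have "permutation (beta_perm n mu)" using IH(1) permutation_permutes by blast
  then have "sign (beta_perm n lam) = sign (Transposition.transpose a (Suc a)) * sign (beta_perm n mu)"
    unfolding comp by (rule sign_compose[OF permutation_swap_id])
  moreover have "sign (Transposition.transpose a (Suc a)) = - 1" by (simp add: sign_swap_id)
  ultimately have "sign (beta_perm n lam) = (- 1) ^ (\<Sum>i<n. lam i) * sign (rev_perm n)"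
    by (simp only: IH(2) sum power_Suc mult.assoc)
  then show ?case using permutes_compose[OF IH(1) t] unfolding comp by blast
qed

lemma sum_mult_diff_eq_norms:
  fixes r g :: "nat \<Rightarrow> real"
  assumes "(\<Sum>k<n. (g k)^2) = (\<Sum>k<n. (r k)^2)"
  shows "2 * (\<Sum>k<n. r k * (g k - r k)) = - (\<Sum>k<n. (g k - r k)^2)"
proof -
  have r: "2 * (a * (b - a)) + (b - a)^2 = b^2 - a^2" for a b :: real
    by (simp add: power2_eq_square algebra_simps)
  have "2 * (\<Sum>k<n. r k * (g k - r k)) + (\<Sum>k<n. (g k - r k)^2) = (\<Sum>k<n. (g k)^2 - (r k)^2)"
    unfolding sum_distrib_left sum.distrib[symmetric] by (rule sum.cong[OF refl]) (rule r)
  then show ?thesis using assms by (simp add: sum_subtractf)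
qed

text \<open>A Weyl group element \<open>w\<close> is an isometry, so twice the height of
  \<open>w \<rho> - \<rho>\<close> is minus its squared length, whereas every root in a
  decomposition adds at least 1 to the height. Only the identity with the empty decomposition
  remains.\<close>

lemma gen_exponent_C_zero: "gen_exponent_C n (\<lambda>_. 0) = 1"
proof -
  let ?\<rho> = "half_sum n"
  have height_decomp: "height n \<beta> \<ge> (\<Sum>\<alpha>\<in>pos_roots n. real (c \<alpha>))" if "c \<in> root_decompositions n \<beta>" for c \<beta>
  proof -
    have "height n \<beta> = (\<Sum>k<n. (real n - real k) * (\<Sum>\<alpha>\<in>pos_roots n. real (c \<alpha>) * \<alpha> k))"
      using that by (simp add: height_def root_decompositions_def)
    also have "\<dots> = (\<Sum>\<alpha>\<in>pos_roots n. real (c \<alpha>) * height n \<alpha>)"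
      unfolding height_def sum_distrib_left by (subst sum.swap) (simp add: ac_simps)
    also have "\<dots> \<ge> (\<Sum>\<alpha>\<in>pos_roots n. real (c \<alpha>) * 1)"
      by (intro sum_mono mult_left_mono height_pos_root) auto
    finally show ?thesis by simp
  qed
  have zero: "c = (\<lambda>_. 0)" if "c \<in> root_decompositions n \<beta>" "height n \<beta> \<le> 0" for c \<beta>
  proof -
    have "(\<Sum>\<alpha>\<in>pos_roots n. real (c \<alpha>)) = 0"
      using height_decomp[OF that(1)] that(2) sum_nonneg[of "pos_roots n" "\<lambda>\<alpha>. real (c \<alpha>)"] by simp
    then have "\<forall>\<alpha>\<in>pos_roots n. c \<alpha> = 0" by (simp add: sum_nonneg_eq_0_iff finite_pos_roots)
    then show ?thesis using that(1) by (auto simp: root_decompositions_def)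
  qed
  have "kostant_partition n (gact p s ?\<rho> - ?\<rho>) = (if p = id \<and> s = (\<lambda>_. 1) then 1 else 0)"
    if ps: "(p, s) \<in> hyper n" for p s
  proof -
    have p: "p permutes {..<n}" and s: "s \<in> signs n" using ps by (auto simp: hyper_def)
    have sv: "s k = 1 \<or> s k = - 1" for k using s unfolding signs_def by blast
    let ?\<delta> = "gact p s ?\<rho> - ?\<rho>"
    have "(\<Sum>k<n. (gact p s ?\<rho> k)^2) = (\<Sum>k<n. (?\<rho> (p k))^2)"
    proof (rule sum.cong[OF refl])
      fix k show "(gact p s ?\<rho> k)^2 = (?\<rho> (p k))^2" using sv[of k] by (auto simp: gact_def)
    qed
    also have "\<dots> = (\<Sum>k<n. (?\<rho> k)^2)"
      using sum.permute[OF p, of "\<lambda>k. (?\<rho> k)^2"] by (simp add: o_def)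
    finally have norm: "(\<Sum>k<n. (gact p s ?\<rho> k)^2) = (\<Sum>k<n. (?\<rho> k)^2)" .
    have "height n ?\<delta> = (\<Sum>k<n. ?\<rho> k * (gact p s ?\<rho> k - ?\<rho> k))"
      unfolding height_def minus_apply by (rule sum.cong) (simp_all add: half_sum_eq)
    then have "2 * height n ?\<delta> = - (\<Sum>k<n. (gact p s ?\<rho> k - ?\<rho> k)^2)"
      using sum_mult_diff_eq_norms[OF norm] by (simp only:)
    moreover have "(\<Sum>k<n. (gact p s ?\<rho> k - ?\<rho> k)^2) \<ge> 0"
      by (rule sum_nonneg) (rule zero_le_power2)
    ultimately have h0: "height n ?\<delta> \<le> 0" by linarith
    show ?thesis
    proof (cases "p = id \<and> s = (\<lambda>_. 1)")
      case True
      then have \<delta>: "?\<delta> = 0" using gact_id by simp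
      have "root_decompositions n ?\<delta> = {\<lambda>_. 0}"
        using zero[OF _ h0] unfolding \<delta> by (auto simp: root_decompositions_def)
      then show ?thesis using True by (simp add: kostant_partition_def)
    next
      case False
      have "root_decompositions n ?\<delta> = {}"
      proof (rule ccontr)
        assume "root_decompositions n ?\<delta> \<noteq> {}"
        then obtain c where c: "c \<in> root_decompositions n ?\<delta>" by blast
        then have "(\<lambda>_. 0) \<in> root_decompositions n ?\<delta>" using zero[OF c h0] by simp
        then have "?\<delta> k = 0" for k by (auto simp: root_decompositions_def)
        then have e: "of_int (s k) * ?\<rho> (p k) = ?\<rho> k" for k by (simp add: gact_def)
        have "p k = k \<and> s k = 1" for k
        proof (cases "k < n")
          case True
          have pk: "p k < n" using permutes_in_image[OF p, of k] True by simp
          show ?thesis using e[of k] sv[of k] True pk by (auto simp: half_sum_eq)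
        next
          case False
          then show ?thesis using s permutes_not_in[OF p] by (simp add: signs_def)
        qed
        then show False using False by (auto simp: fun_eq_iff)
      qed
      then show ?thesis using False by (simp add: kostant_partition_def)
    qed
  qed
  note kp = this
  have "gen_exponent_C n (\<lambda>_. 0) = (\<Sum>(p, s)\<in>hyper n. of_int (hsign n p s) * kostant_partition n (gact p s ?\<rho> - ?\<rho>))"
  proof -
    have "partition_weight (\<lambda>_. 0) + ?\<rho> = ?\<rho>" by (simp add: partition_weight_def fun_eq_iff)
    then show ?thesis unfolding gen_exponent_C_def sum_weyl_group by simp
  qed
  also have "\<dots> = (\<Sum>x\<in>hyper n. if x = (id, \<lambda>_. 1) then 1 else 0)"
  proof (rule sum.cong[OF refl])
    fix x assume "x \<in> hyper n"
    moreover obtain p s where x: "x = (p, s)" by (cases x)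
    ultimately have "kostant_partition n (gact p s ?\<rho> - ?\<rho>) = (if p = id \<and> s = (\<lambda>_. 1) then 1 else 0)"
      using kp by simp
    then show "(case x of (p, s) \<Rightarrow> of_int (hsign n p s) * kostant_partition n (gact p s ?\<rho> - ?\<rho>)) =
        (if x = (id, \<lambda>_. 1) then 1 else 0)"
      unfolding x prod.case by (simp add: hsign_def)
  qed
  also have "\<dots> = 1" using hyper_id[of n] by (simp add: finite_hyper)
  finally show ?thesis .
qed

section \<open>Minimal chains\<close>

text \<open>For \<open>i\<close> in \<open>S\<close>, some member has a gap of at most 1 after its
  first \<open>2 * i\<close> rows, which is what prevents subtracting 2 from these rows throughout.
  A variable \<open>S\<close> allows the factors \<open>1 - X ^ (2 * i)\<close> to be applied one at
  a time.\<close>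

definition min_good :: "nat \<Rightarrow> nat \<Rightarrow> (nat \<Rightarrow> nat) \<Rightarrow> nat set \<Rightarrow> nat \<Rightarrow> (nat \<Rightarrow> nat \<Rightarrow> nat) set" where
  "min_good n m v S d = {c. c m \<in> even_parts (2 * n) d \<and> c \<in> good n m v (c m) \<and>
    (\<forall>i\<in>S. \<exists>b\<le>m. c b (2 * i - 1) \<le> Suc (c b (2 * i)))}"

definition min_gf :: "nat \<Rightarrow> nat \<Rightarrow> (nat \<Rightarrow> nat) \<Rightarrow> nat set \<Rightarrow> int fps" where
  "min_gf n m v S = Abs_fps (\<lambda>d. int (card (min_good n m v S d)))"

text \<open>The bound \<open>b \<le> m\<close> spares the members after the end of the chain, which
  \<open>chains\<close> fixes to zero.\<close>

definition shift_rows :: "nat \<Rightarrow> nat \<Rightarrow> (nat \<Rightarrow> nat \<Rightarrow> nat) \<Rightarrow> nat \<Rightarrow> nat \<Rightarrow> nat" where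
  "shift_rows m i c = (\<lambda>b r. if b \<le> m \<and> r < 2 * i then c b r + 2 else c b r)"

definition unshift_rows :: "nat \<Rightarrow> nat \<Rightarrow> (nat \<Rightarrow> nat \<Rightarrow> nat) \<Rightarrow> nat \<Rightarrow> nat \<Rightarrow> nat" where
  "unshift_rows m i c = (\<lambda>b r. if b \<le> m \<and> r < 2 * i then c b r - 2 else c b r)"

lemma good_iff:
  "c \<in> good n m v (c m) \<longleftrightarrow> (\<forall>b<m. vstep (2 * n) (c b) (c (Suc b))) \<and> (\<forall>b>m. c b = (\<lambda>_. 0)) \<and>
    paired (c 0) \<and> \<not> bad n m c \<and> (\<forall>b<m. gam n c b = - int (v b))"
  by (auto simp: good_def pchains_def chains_def)

lemma finite_good: "parts (2 * n) \<nu> \<Longrightarrow> finite (good n m v \<nu>)"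
  by (rule finite_subset[OF _ finite_chains]) (auto simp: good_def pchains_def)

lemma min_good_empty: "min_good n m v {} d = (\<Union>\<nu>\<in>even_parts (2 * n) d. good n m v \<nu>)"
proof -
  have "c m = \<nu>" if "c \<in> good n m v \<nu>" for c \<nu> using that by (simp add: good_def pchains_def chains_def)
  then show ?thesis unfolding min_good_def by auto
qed

lemma finite_min_good: "finite (min_good n m v S d)"
proof -
  have "finite (min_good n m v {} d)"
    unfolding min_good_empty
    by (intro finite_UN_I finite_even_parts finite_good) (simp add: even_parts_def parts_def)
  then show ?thesis by (rule finite_subset[rotated]) (auto simp: min_good_def)
qed

lemma good_gf_eq: "good_gf n m v = min_gf n m v {}"
proof (rule fps_ext)
  fix d
  have "card (\<Union>\<nu>\<in>even_parts (2 * n) d. good n m v \<nu>) = (\<Sum>\<nu>\<in>even_parts (2 * n) d. card (good n m v \<nu>))"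
    by (rule card_UN_disjoint[OF finite_even_parts])
      (auto simp: good_def pchains_def chains_def even_parts_def parts_def intro: finite_subset[OF _ finite_chains])
  then show "fps_nth (good_gf n m v) d = fps_nth (min_gf n m v {}) d"
    by (simp add: good_gf_def min_gf_def min_good_empty)
qed

lemma shift_rows_pk:
  assumes "\<And>b r. b \<le> m \<Longrightarrow> r < 2 * i \<Longrightarrow> c' b r = c b r + 2" "\<And>b r. \<not> (b \<le> m \<and> r < 2 * i) \<Longrightarrow> c' b r = c b r"
  shows "b < m \<Longrightarrow> pk c' b r = pk c b r" "j < m \<Longrightarrow> violation c' r j = violation c r j"
proof -
  have p: "pk c' b r = pk c b r" if "b < m" for b r
    unfolding pk_def
  proof (rule sum.cong[OF refl])
    fix x
    show "c' b x - c' (Suc b) x = c b x - c (Suc b) x"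
      using that by (cases "x < 2 * i") (simp_all add: assms)
  qed
  then show "b < m \<Longrightarrow> pk c' b r = pk c b r" .
  show "j < m \<Longrightarrow> violation c' r j = violation c r j"
    by (cases j) (simp_all add: violation_def p)
qed

text \<open>The strips do not change, hence neither do \<open>gam\<close> and the lattice
  conditions. Adding 2 keeps the rows of \<open>c m\<close> even, and stopping after an even number
  of rows keeps \<open>c 0\<close> paired. The size grows by \<open>4 * i\<close>, so
  \<open>d\<close> grows by \<open>2 * i\<close>.\<close>

lemma shift_rows_good:
  assumes i: "1 \<le> i" "i \<le> n"
    and c': "\<And>b r. b \<le> m \<Longrightarrow> r < 2 * i \<Longrightarrow> c' b r = c b r + 2" "\<And>b r. \<not> (b \<le> m \<and> r < 2 * i) \<Longrightarrow> c' b r = c b r"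
    and gap: "\<And>b. b \<le> m \<Longrightarrow> c' b (2 * i) + 2 \<le> c' b (2 * i - 1)"
  shows "c' m \<in> even_parts (2 * n) (d + 2 * i) \<longleftrightarrow> c m \<in> even_parts (2 * n) d"
    and "c' m \<in> even_parts (2 * n) d' \<Longrightarrow> 2 * i \<le> d'"
    and "c' \<in> good n m v (c' m) \<longleftrightarrow> c \<in> good n m v (c m)"
proof -
  note pv = shift_rows_pk[where c = c and c' = c' and m = m and i = i, OF c']
  have dec: "c' b (Suc r) \<le> c' b r \<longleftrightarrow> c b (Suc r) \<le> c b r" if b: "b \<le> m" for b r
  proof -
    consider "Suc r < 2 * i" | "r = 2 * i - 1" | "\<not> r < 2 * i" using i by linarith
    then show ?thesis
    proof cases
      case 1
      then show ?thesis using b by (simp add: c'(1))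
    next
      case 2
      have "c' b (2 * i - 1) = c b (2 * i - 1) + 2" "c' b (2 * i) = c b (2 * i)" using b i by (simp_all add: c')
      moreover have "Suc r = 2 * i" using 2 i by simp
      ultimately show ?thesis using gap[OF b] 2 by simp
    next
      case 3
      then show ?thesis by (simp add: c'(2))
    qed
  qed
  have zero: "(\<forall>r\<ge>2 * n. c' b r = 0) \<longleftrightarrow> (\<forall>r\<ge>2 * n. c b r = 0)" for b
    using i by (auto simp: c'(2))
  have parts: "parts (2 * n) (c' b) \<longleftrightarrow> parts (2 * n) (c b)" if "b \<le> m" for b
    by (simp add: parts_def dec that zero)
  have ev: "even (c' m r) \<longleftrightarrow> even (c m r)" for r by (cases "r < 2 * i") (simp_all add: c')
  have sum: "(\<Sum>r<2 * n. c' m r) = (\<Sum>r<2 * n. c m r) + 4 * i"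
  proof -
    have "(\<Sum>r<2 * n. c' m r) = (\<Sum>r<2 * n. c m r + (if r < 2 * i then 2 else 0))"
      by (rule sum.cong) (simp_all add: c')
    also have "(\<Sum>r<2 * n. c m r + (if r < 2 * i then 2 else 0)) = (\<Sum>r<2 * n. c m r) + (\<Sum>r<2 * i. 2)"
    proof -
      have "(\<Sum>r<2 * n. if r < 2 * i then 2 else 0 :: nat) = (\<Sum>r<2 * i. 2)"
        by (rule sum.mono_neutral_cong_right) (use i in auto)
      then show ?thesis by (simp add: sum.distrib)
    qed
    finally show ?thesis by simp
  qed
  have s: "(\<Sum>r<2 * n. c' m r) = 2 * (d + 2 * i) \<longleftrightarrow> (\<Sum>r<2 * n. c m r) = 2 * d" 
  proof -
    have "x + 4 * i = 2 * (d + 2 * i) \<longleftrightarrow> x = 2 * d" for x by auto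
    then show ?thesis unfolding sum .
  qed
  show "c' m \<in> even_parts (2 * n) (d + 2 * i) \<longleftrightarrow> c m \<in> even_parts (2 * n) d"
    unfolding even_parts_def mem_Collect_eq ev dec[OF order_refl] zero s ..
  show "c' m \<in> even_parts (2 * n) d' \<Longrightarrow> 2 * i \<le> d'"
    using sum by (simp add: even_parts_def)
  have vs: "vstep (2 * n) (c' b) (c' (Suc b)) \<longleftrightarrow> vstep (2 * n) (c b) (c (Suc b))" if "b < m" for b
  proof -
    have "c' (Suc b) r \<le> c' b r \<and> c' b r \<le> Suc (c' (Suc b) r) \<longleftrightarrow> c (Suc b) r \<le> c b r \<and> c b r \<le> Suc (c (Suc b) r)" for r
      using that by (cases "r < 2 * i") (simp_all add: c')
    then show ?thesis using parts[of b] that by (simp add: vstep_def)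
  qed
  have z: "c' b = (\<lambda>_. 0) \<longleftrightarrow> c b = (\<lambda>_. 0)" if "b > m" for b
    using that by (simp add: fun_eq_iff c'(2))
  have pd: "paired (c' 0) \<longleftrightarrow> paired (c 0)"
  proof -
    have "c' 0 (2 * k) = c' 0 (Suc (2 * k)) \<longleftrightarrow> c 0 (2 * k) = c 0 (Suc (2 * k))" for k
      by (cases "k < i") (simp_all add: c')
    then show ?thesis by (simp add: paired_def)
  qed
  have bd: "bad n m c' \<longleftrightarrow> bad n m c" unfolding bad_def using pv(2) by blast
  have gm: "gam n c' b = gam n c b" if "b < m" for b using that by (simp add: gam_def pv(1))
  show "c' \<in> good n m v (c' m) \<longleftrightarrow> c \<in> good n m v (c m)"
    unfolding good_iff bd pd using vs z gm by simp
qed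

text \<open>The chains that allow the subtraction for \<open>i\<close> correspond to chains with
  \<open>d\<close> lowered by \<open>2 * i\<close>. For any other \<open>k\<close> the rows
  \<open>2 * k - 1\<close> and \<open>2 * k\<close> are shifted both or not at all, so the
  conditions from \<open>S\<close> are unaffected.\<close>

lemma card_min_good_insert:
  assumes i: "1 \<le> i" "i \<le> n" "i \<notin> S" and S: "S \<subseteq> {1..n}"
  shows "card (min_good n m v S d) = card (min_good n m v (insert i S) d) +
    (if 2 * i \<le> d then card (min_good n m v S (d - 2 * i)) else 0)"
proof -
  let ?X = "min_good n m v S d" and ?Y = "min_good n m v (insert i S) d"
  let ?Z = "{c \<in> ?X. \<forall>b\<le>m. c b (2 * i) + 2 \<le> c b (2 * i - 1)}"
  have gap_S: "c' b (2 * k - 1) \<le> Suc (c' b (2 * k)) \<longleftrightarrow> c b (2 * k - 1) \<le> Suc (c b (2 * k))"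
    if "k \<in> S" "b \<le> m" and c': "\<And>b r. b \<le> m \<Longrightarrow> r < 2 * i \<Longrightarrow> c' b r = c b r + 2" "\<And>b r. \<not> (b \<le> m \<and> r < 2 * i) \<Longrightarrow> c' b r = c b r"
    for k b and c c' :: "nat \<Rightarrow> nat \<Rightarrow> nat"
  proof -
    have "k \<noteq> i" "1 \<le> k" using that i S by auto
    then consider "2 * k < 2 * i" "2 * k - 1 < 2 * i" | "\<not> 2 * k < 2 * i" "\<not> 2 * k - 1 < 2 * i" by linarith
    then show ?thesis using that(2) by cases (simp_all add: c')
  qed
  have X: "?X = ?Y \<union> ?Z" and dis: "?Y \<inter> ?Z = {}"
    by (auto simp: min_good_def not_le less_Suc_eq_le Suc_le_eq)
  have "card ?X = card (?Y \<union> ?Z)" using X by (rule arg_cong)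
  also have "\<dots> = card ?Y + card ?Z"
    by (rule card_Un_disjoint[OF finite_min_good _ dis]) (simp add: finite_min_good)
  finally have "card ?X = card ?Y + card ?Z" .
  moreover have anti: "c b r \<le> c b r'" if "c \<in> min_good n m v S e" "b \<le> m" "r' \<le> r" for c b r r' e
  proof -
    have "parts (2 * n) (c m)" "c \<in> chains (2 * n) m (c m)"
      using that(1) by (auto simp: min_good_def even_parts_def parts_def good_def pchains_def)
    then have "parts (2 * n) (c b)" using chainsD(2) that(2) by blast
    then have "antimono (c b)" by (intro decseq_SucI) (simp add: parts_def)
    then show ?thesis using that(3) by (rule antimonoD)
  qed
  have un: "shift_rows m i (unshift_rows m i c') = c'" and
    Z: "2 * i \<le> d \<and> unshift_rows m i c' \<in> min_good n m v S (d - 2 * i)" if c': "c' \<in> ?Z" for c'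
  proof -
    have gap: "c' b (2 * i) + 2 \<le> c' b (2 * i - 1)" if "b \<le> m" for b using c' that by simp
    have X: "c' \<in> ?X" using c' by simp
    have ge: "2 \<le> c' b r" if "b \<le> m" "r < 2 * i" for b r
      using gap[OF that(1)] anti[OF X that(1), of r "2 * i - 1"] that(2) by linarith
    let ?c = "unshift_rows m i c'"
    have e: "b \<le> m \<Longrightarrow> r < 2 * i \<Longrightarrow> c' b r = ?c b r + 2" "\<not> (b \<le> m \<and> r < 2 * i) \<Longrightarrow> c' b r = ?c b r" for b r
      using ge[of b r] by (auto simp: unshift_rows_def)
    show "shift_rows m i ?c = c'"
      unfolding shift_rows_def fun_eq_iff using e by auto
    note sh = shift_rows_good[where c = ?c and c' = c' and m = m and i = i and n = n, OF i(1,2) e gap]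
    have id: "2 * i \<le> d" using X sh(2) by (simp add: min_good_def)
    then have "d - 2 * i + 2 * i = d" by simp
    then have "?c m \<in> even_parts (2 * n) (d - 2 * i)" using sh(1)[of "d - 2 * i"] X by (simp add: min_good_def)
    moreover have "?c \<in> good n m v (?c m)" using sh(3) X by (simp add: min_good_def)
    moreover have "\<exists>b\<le>m. ?c b (2 * k - 1) \<le> Suc (?c b (2 * k))" if k: "k \<in> S" for k
    proof -
      obtain b where b: "b \<le> m" "c' b (2 * k - 1) \<le> Suc (c' b (2 * k))" using X k by (auto simp: min_good_def)
      have "c' b (2 * k - 1) \<le> Suc (c' b (2 * k)) \<longleftrightarrow> ?c b (2 * k - 1) \<le> Suc (?c b (2 * k))"
        by (rule gap_S[OF k b(1)]) (fact e)+
      with b show ?thesis by (intro exI[of _ b]) simp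
    qed
    ultimately show "2 * i \<le> d \<and> ?c \<in> min_good n m v S (d - 2 * i)" using id by (simp add: min_good_def)
  qed
  have W: "shift_rows m i c \<in> ?Z" "unshift_rows m i (shift_rows m i c) = c"
    if c: "c \<in> min_good n m v S (d - 2 * i)" "2 * i \<le> d" for c
  proof -
    let ?c' = "shift_rows m i c"
    have e: "b \<le> m \<Longrightarrow> r < 2 * i \<Longrightarrow> ?c' b r = c b r + 2" "\<not> (b \<le> m \<and> r < 2 * i) \<Longrightarrow> ?c' b r = c b r" for b r
      by (auto simp: shift_rows_def)
    have gap: "?c' b (2 * i) + 2 \<le> ?c' b (2 * i - 1)" if "b \<le> m" for b
      using anti[OF c(1) that, of "2 * i - 1" "2 * i"] that i(1) by (simp add: e)
    show "unshift_rows m i ?c' = c"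
      unfolding unshift_rows_def fun_eq_iff using e by auto
    note sh = shift_rows_good[where c = c and c' = ?c' and m = m and i = i and n = n, OF i(1,2) e gap]
    have "?c' m \<in> even_parts (2 * n) d" using sh(1)[of "d - 2 * i"] c by (simp add: min_good_def)
    moreover have "?c' \<in> good n m v (?c' m)" using sh(3) c(1) by (simp add: min_good_def)
    moreover have "\<exists>b\<le>m. ?c' b (2 * k - 1) \<le> Suc (?c' b (2 * k))" if k: "k \<in> S" for k
    proof -
      obtain b where b: "b \<le> m" "c b (2 * k - 1) \<le> Suc (c b (2 * k))" using c(1) k by (auto simp: min_good_def)
      have "?c' b (2 * k - 1) \<le> Suc (?c' b (2 * k)) \<longleftrightarrow> c b (2 * k - 1) \<le> Suc (c b (2 * k))"
        by (rule gap_S[OF k b(1)]) (fact e)+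
      with b show ?thesis by (intro exI[of _ b]) simp
    qed
    ultimately show "?c' \<in> ?Z" using gap by (simp add: min_good_def)
  qed
  have "card ?Z = (if 2 * i \<le> d then card (min_good n m v S (d - 2 * i)) else 0)"
  proof (cases "2 * i \<le> d")
    case True
    have "bij_betw (shift_rows m i) (min_good n m v S (d - 2 * i)) ?Z"
      by (rule bij_betw_byWitness[where f' = "unshift_rows m i"]) (use W[OF _ True] Z un in blast)+
    from bij_betw_same_card[OF this] show ?thesis using True by simp
  next
    case False
    then have "?Z = {}" using Z by blast
    then show ?thesis using False by (simp only: card.empty if_False)
  qed
  ultimately show ?thesis by simp
qed

lemma min_gf_insert:
  assumes "1 \<le> i" "i \<le> n" "i \<notin> S" "S \<subseteq> {1..n}"
  shows "(1 - fps_X ^ (2 * i)) * min_gf n m v S = min_gf n m v (insert i S)"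
proof (rule fps_ext)
  fix d
  show "fps_nth ((1 - fps_X ^ (2 * i)) * min_gf n m v S) d = fps_nth (min_gf n m v (insert i S)) d"
    using card_min_good_insert[OF assms, of m v d]
    by (simp add: left_diff_distrib fps_X_power_mult_nth min_gf_def)
qed

lemma prod_mult_min_gf: "(\<Prod>i\<in>{1..n}. 1 - fps_X ^ (2 * i)) * min_gf n m v {} = min_gf n m v {1..n}"
proof -
  have "k \<le> n \<Longrightarrow> (\<Prod>i\<in>{1..k}. 1 - fps_X ^ (2 * i)) * min_gf n m v {} = min_gf n m v {1..k}" for k
  proof (induction k)
    case (Suc k)
    have s: "{1..Suc k} = insert (Suc k) {1..k}" by auto
    have "(\<Prod>i\<in>{1..Suc k}. 1 - fps_X ^ (2 * i)) * min_gf n m v {} =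
        (1 - fps_X ^ (2 * Suc k)) * ((\<Prod>i\<in>{1..k}. 1 - fps_X ^ (2 * i)) * min_gf n m v {})"
      unfolding s by (subst prod.insert) (simp_all add: mult.assoc)
    also have "\<dots> = min_gf n m v {1..Suc k}"
      unfolding s using Suc by (simp only: Suc_leD) (rule min_gf_insert, auto)
    finally show ?case .
  qed simp
  then show ?thesis by simp
qed

text \<open>With no strips a chain is a single partition that is paired and has even parts.
  Minimality bounds the gap between consecutive pairs of rows by 1, parity makes it 0, and row
  \<open>2 * n\<close> is zero.\<close>

lemma min_gf_zero: "min_gf n 0 v {1..n} = 1"
proof (rule fps_ext)
  fix d
  have "c = (\<lambda>_ _. 0)" if c: "c \<in> min_good n 0 v {1..n} d" for c
  proof -
    have z: "c b = (\<lambda>_. 0)" if "b > 0" for b using c that by (simp add: min_good_def good_iff)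
    have pd: "paired (c 0)" and ev: "even (c 0 r)" and pt: "c 0 (Suc r) \<le> c 0 r" "r \<ge> 2 * n \<Longrightarrow> c 0 r = 0" for r
      using c by (simp_all add: min_good_def good_iff even_parts_def)
    have m: "c 0 (2 * i - 1) \<le> Suc (c 0 (2 * i))" if "1 \<le> i" "i \<le> n" for i
      using c that by (simp add: min_good_def)
    have step: "c 0 (2 * i) = c 0 (2 * Suc i)" if "i < n" for i
    proof -
      have "c 0 (2 * i) = c 0 (Suc (2 * i))" using pd by (simp add: paired_def)
      moreover have "c 0 (Suc (2 * i)) \<le> Suc (c 0 (2 * Suc i))" using m[of "Suc i"] that by simp
      moreover have "c 0 (2 * Suc i) \<le> c 0 (Suc (2 * i))" using pt(1)[of "Suc (2 * i)"] by simp
      moreover have "c 0 (Suc (2 * i)) \<noteq> Suc (c 0 (2 * Suc i))" using ev by (metis even_Suc)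
      ultimately show ?thesis by linarith
    qed
    have "i \<le> n \<Longrightarrow> c 0 0 = c 0 (2 * i)" for i
    proof (induction i)
      case (Suc i)
      then show ?case using step[of i] by simp
    qed simp
    from this[of n] have "c 0 0 = 0" using pt(2)[of "2 * n"] by simp
    moreover have "c 0 r \<le> c 0 0" for r
      by (induction r) (use pt(1) order_trans in blast)+
    ultimately have "c 0 r = 0" for r by (metis le_zero_eq)
    then have "c b = (\<lambda>_. 0)" for b using z[of b] by (cases "b = 0") auto
    then show ?thesis by blast
  qed
  moreover have "(\<lambda>_ _. 0) \<in> min_good n 0 v {1..n} d \<longleftrightarrow> d = 0"
    by (auto simp: min_good_def good_iff even_parts_def paired_def bad_def)
  ultimately have "min_good n 0 v {1..n} d = (if d = 0 then {\<lambda>_ _. 0} else {})" by auto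
  then show "fps_nth (min_gf n 0 v {1..n}) d = fps_nth 1 d" by (simp add: min_gf_def)
qed

text \<open>\<open>n\<close> and the labels grow by one together, which leaves the prescribed strip
  sizes unchanged. The two additional rows are empty, so the gap condition for
  \<open>i = Suc n\<close> holds by itself.\<close>

lemma min_good_Suc: "min_good n m v {1..n} d \<subseteq> min_good (Suc n) m (\<lambda>k. Suc (v k)) {1..Suc n} d"
proof
  fix c assume c: "c \<in> min_good n m v {1..n} d"
  have chain: "\<forall>b<m. vstep (2 * n) (c b) (c (Suc b))" "\<forall>b>m. c b = (\<lambda>_. 0)" "paired (c 0)" "\<not> bad n m c"
      "\<forall>b<m. gam n c b = - int (v b)" and ev: "c m \<in> even_parts (2 * n) d"
    using c by (simp_all add: min_good_def good_iff)
  have zero: "c b r = 0" if "r \<ge> 2 * n" for b r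
  proof -
    consider "b < m" | "b = m" | "b > m" by linarith
    then show ?thesis
      using chain(1,2) ev that by cases (auto simp: vstep_def parts_def even_parts_def)
  qed
  have pk: "pk c b r = pk c b (2 * n)" if "r \<ge> 2 * n" for b r
    unfolding pk_def by (rule sum.mono_neutral_right) (use that zero in auto)
  have pS: "pk c b (2 * Suc n) = pk c b (2 * n)" for b by (rule pk) simp
  have "vstep (2 * Suc n) (c b) (c (Suc b))" if "b < m" for b
    using chain(1) that by (simp add: vstep_def parts_def)
  moreover have "gam (Suc n) c b = - int (Suc (v b))" if "b < m" for b
    using chain(5) that by (simp only: gam_def pS) auto
  moreover have "\<not> bad (Suc n) m c"
  proof
    assume "bad (Suc n) m c"
    then obtain r j where r: "r \<le> 2 * Suc n" "j < m" "violation c r j" by (auto simp: bad_def)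
    \<comment> \<open>Beyond row \<open>2 * n\<close> the counts are constant while the bound
      \<open>r div 2\<close> can only grow, so a violation there is one at \<open>2 * n\<close>
      already.\<close>
    have "violation c (min r (2 * n)) j"
    proof (cases "r \<le> 2 * n")
      case False
      then show ?thesis using r(3) pk[of r] by (auto simp: violation_def split: nat.splits)
    qed (use r in simp)
    then show False using chain(4) r(2) unfolding bad_def by (meson min.cobounded2)
  qed
  moreover have "c m \<in> even_parts (2 * Suc n) d"
    using ev zero by (auto simp: even_parts_def)
  moreover have "\<exists>b\<le>m. c b (2 * i - 1) \<le> Suc (c b (2 * i))" if "i \<in> {1..Suc n}" for i
  proof (cases "i = Suc n")
    case True
    then show ?thesis using zero[of "2 * i - 1" 0] by (intro exI[of _ 0]) simp
  next
    case False
    then show ?thesis using c that by (simp add: min_good_def)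
  qed
  ultimately show "c \<in> min_good (Suc n) m (\<lambda>k. Suc (v k)) {1..Suc n} d"
    using chain by (simp add: min_good_def good_iff)
qed

text \<open>There is one strip for each of the \<open>lam 0\<close> columns, and the labels
  prescribe the size \<open>conjugate lam b\<close> for strip \<open>b\<close>. The zero partition,
  with exponent 1 and the zero chain as its only minimal chain, reveals the common factor.\<close>

lemma gen_exponent_C_min_gf:
  assumes lam: "partition_at_most n lam"
  shows "Abs_fps (coeff (gen_exponent_C n lam)) = min_gf n (lam 0) (\<lambda>k. Suc (n + k - conjugate lam k)) {1..n}"
proof -
  let ?m = "lam 0" and ?v = "\<lambda>k. Suc (n + k - conjugate lam k)" and ?z = "\<lambda>_. 0 :: nat"
  define h where "h = int (card (hyper n))"
  define Q :: "int fps" where "Q = (\<Prod>i\<in>{1..n}. 1 - fps_X ^ (2 * i))"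
  have h0: "h \<noteq> 0" using hyper_id[of n] finite_hyper[of n] by (auto simp: h_def card_eq_0_iff)
  obtain D :: "int fps" where D: "\<And>lam m p. partition_at_most n lam \<Longrightarrow> p permutes {..<n + m} \<Longrightarrow>
      (\<And>j. j < n \<Longrightarrow> p j = lam j + (n - 1 - j)) \<Longrightarrow> (\<And>i j. i < j \<Longrightarrow> j < m \<Longrightarrow> p (n + i) < p (n + j)) \<Longrightarrow>
      fps_const h * Abs_fps (coeff (gen_exponent_C n lam)) = fps_const (sign p) * D * good_gf n m (\<lambda>k. Suc (p (n + k)))"
    using gen_exponent_C_good_gf[of n] unfolding h_def by blast
  have anti: "antimono lam" and ln: "\<And>i. i \<ge> n \<Longrightarrow> lam i = 0" using lam by (auto simp: partition_at_most_def)
  have part: "part lam" using anti ln by (auto simp: part_def)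
  have cn: "conjugate lam k \<le> n" for k
    using less_conj_iff[OF part, of n k] ln[of n] by (simp add: not_less[symmetric])
  have cdec: "conjugate lam j \<le> conjugate lam i" if "i \<le> j" for i j
    using part_conj[OF part] that by (auto simp: part_def dest: antimonoD)
  note beta = beta_perm_sign[OF lam order_refl]
  have B: "fps_const h * Abs_fps (coeff (gen_exponent_C n lam)) =
      fps_const (sign (beta_perm n lam)) * D * min_gf n ?m ?v {}"
  proof -
    have "fps_const h * Abs_fps (coeff (gen_exponent_C n lam)) =
        fps_const (sign (beta_perm n lam)) * D * good_gf n ?m (\<lambda>k. Suc (beta_perm n lam (n + k)))"
    proof (rule D[OF lam conjunct1[OF beta]])
      show "beta_perm n lam j = lam j + (n - 1 - j)" if "j < n" for j using that by (simp add: beta_perm_def)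
      show "beta_perm n lam (n + i) < beta_perm n lam (n + j)" if "i < j" for i j
        using that cn[of i] cn[of j] cdec[of i j] by (simp add: beta_perm_def)
    qed
    then show ?thesis by (simp add: good_gf_eq beta_perm_def)
  qed
  have Z: "fps_const h = fps_const (sign (rev_perm n)) * D * min_gf n 0 (\<lambda>k. Suc (rev_perm n (n + k))) {}"
  proof -
    have "fps_const h * Abs_fps (coeff (gen_exponent_C n ?z)) =
        fps_const (sign (rev_perm n)) * D * good_gf n 0 (\<lambda>k. Suc (rev_perm n (n + k)))"
      by (rule D) (use rev_perm_permutes[of n] in \<open>auto simp: partition_at_most_def rev_perm_def\<close>)
    moreover have "Abs_fps (coeff (1 :: int poly)) = 1"
      by (rule fps_ext) (simp add: coeff_1)
    ultimately show ?thesis by (simp only: gen_exponent_C_zero good_gf_eq mult_1_right)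
  qed
  \<comment> \<open>Multiplication by \<open>Q\<close> collapses the generating function of the zero
    partition to 1, which expresses \<open>D\<close> through \<open>Q\<close> and the group
    order.\<close>
  have "fps_const h * Q = fps_const (sign (rev_perm n)) * D * (Q * min_gf n 0 (\<lambda>k. Suc (rev_perm n (n + k))) {})"
    unfolding Z by (simp only: mult_ac)
  then have ZQ: "fps_const h * Q = fps_const (sign (rev_perm n)) * D"
    unfolding Q_def prod_mult_min_gf min_gf_zero by simp
  let ?e = "(- 1) ^ (\<Sum>i<n. lam i) :: int"
  have "fps_const h * Abs_fps (coeff (gen_exponent_C n lam)) =
      fps_const ?e * (fps_const (sign (rev_perm n)) * D) * min_gf n ?m ?v {}"
    unfolding B conjunct2[OF beta] by (simp only: fps_const_mult[symmetric] mult.assoc)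
  also have "\<dots> = fps_const h * (fps_const ?e * (Q * min_gf n ?m ?v {}))"
    unfolding ZQ[symmetric] by (simp only: mult_ac)
  also have "Q * min_gf n ?m ?v {} = min_gf n ?m ?v {1..n}"
    unfolding Q_def by (rule prod_mult_min_gf)
  finally have main: "fps_const h * Abs_fps (coeff (gen_exponent_C n lam)) =
      fps_const h * (fps_const ?e * min_gf n ?m ?v {1..n})" .
  \<comment> \<open>The size of \<open>lam\<close> is the difference of the sizes of the paired
    first member and the even last member. So the sign is 1 whenever a minimal chain exists, and
    otherwise it multiplies 0.\<close>
  have even: "even (\<Sum>i<n. lam i)" if c: "c \<in> min_good n ?m ?v {1..n} d" for c d
  proof -
    have g: "paired (c 0)" "\<forall>b<?m. gam n c b = - int (?v b)" and ev: "c ?m \<in> even_parts (2 * n) d"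
      and ch: "c \<in> chains (2 * n) ?m (c ?m)"
      using c by (auto simp: min_good_def good_def pchains_def)
    have "pk c b (2 * n) = conjugate lam b" if "b < ?m" for b
    proof -
      have "conjugate lam b \<le> n + b" using cn[of b] by simp
      then show ?thesis using g(2) that by (auto simp: gam_def of_nat_diff)
    qed
    then have "(\<Sum>b<?m. pk c b (2 * n)) = (\<Sum>b<?m. conjugate lam b)" by simp
    also have "\<dots> = (\<Sum>b<?m. min (conjugate lam b) n)" by (rule sum.cong) (use cn in \<open>auto simp: min_def le_antisym\<close>)
    also have "\<dots> = (\<Sum>i<n. lam i)" by (rule sum_rows_conj[OF part order_refl, symmetric])
    finally have "(\<Sum>i<n. lam i) + (\<Sum>i<2 * n. c ?m i) = (\<Sum>i<2 * n. c 0 i)"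
      using sum_pk_total[OF ch] ev by (simp add: even_parts_def parts_def)
    moreover have "even (\<Sum>i<2 * n. c 0 i)" by (rule paired_sum_even) (rule g(1))
    moreover have "even (\<Sum>i<2 * n. c ?m i)" using ev by (simp add: even_parts_def)
    ultimately show ?thesis by (metis even_add)
  qed
  show ?thesis
  proof (rule fps_ext)
    fix d
    have "h * coeff (gen_exponent_C n lam) d = h * (?e * int (card (min_good n ?m ?v {1..n} d)))"
      using arg_cong[OF main, of "\<lambda>f. fps_nth f d"] by (simp add: min_gf_def)
    then have "coeff (gen_exponent_C n lam) d = ?e * int (card (min_good n ?m ?v {1..n} d))"
      using h0 by simp
    moreover have "?e * int (card (min_good n ?m ?v {1..n} d)) = int (card (min_good n ?m ?v {1..n} d))"
      using even by (cases "min_good n ?m ?v {1..n} d = {}") auto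
    ultimately show "fps_nth (Abs_fps (coeff (gen_exponent_C n lam))) d = fps_nth (min_gf n ?m ?v {1..n}) d"
      by (simp add: min_gf_def)
  qed
qed

theorem theorem7p1:
  fixes n :: nat and lam :: "nat \<Rightarrow> nat"
  assumes "n \<ge> 1" and "partition_at_most n lam"
  shows "\<forall>k. coeff (gen_exponent_C (n + 1) lam - gen_exponent_C n lam) k \<ge> 0"
proof
  fix k
  let ?v = "\<lambda>k. Suc (n + k - conjugate lam k)" and ?v' = "\<lambda>k. Suc (Suc n + k - conjugate lam k)"
  have lam': "partition_at_most (Suc n) lam" using assms(2) by (auto simp: partition_at_most_def)
  have c: "coeff (gen_exponent_C m lam) k = int (card (min_good m (lam 0) (\<lambda>k. Suc (m + k - conjugate lam k)) {1..m} k))"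
    if "partition_at_most m lam" for m
    using arg_cong[OF gen_exponent_C_min_gf[OF that], of "\<lambda>f. fps_nth f k"] by (simp add: min_gf_def)
  \<comment> \<open>This makes the truncated subtraction in the labels exact, so the labels for
    \<open>n + 1\<close> are the successors of those for \<open>n\<close>, as
    \<open>min_good_Suc\<close> requires.\<close>
  have "conjugate lam k \<le> n" for k
  proof -
    have "part lam" using assms(2) by (auto simp: part_def partition_at_most_def)
    then show ?thesis using less_conj_iff[of lam n k] assms(2) by (simp add: partition_at_most_def not_less[symmetric])
  qed
  then have "Suc n + k - conjugate lam k = Suc (n + k - conjugate lam k)" for k
    by (simp add: Suc_diff_le trans_le_add1)
  then have "min_good n (lam 0) ?v {1..n} k \<subseteq> min_good (Suc n) (lam 0) ?v' {1..Suc n} k"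
    using min_good_Suc[of n "lam 0" ?v k] by (simp only:)
  then have "card (min_good n (lam 0) ?v {1..n} k) \<le> card (min_good (Suc n) (lam 0) ?v' {1..Suc n} k)"
    by (rule card_mono[OF finite_min_good])
  then show "coeff (gen_exponent_C (n + 1) lam - gen_exponent_C n lam) k \<ge> 0"
    using c[OF assms(2)] c[OF lam'] by (simp only: coeff_diff Suc_eq_plus1[symmetric])
qed

end
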